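(* Let $(M^n,g,V,\lambda,\beta)$, $n\ge4$, $\beta\neq0$, be a compact almost $\omega$-Bach soliton, where $\omega$ is the $1$-form associated to a vector field $P$, such that the $\omega$-Bach tensor is divergence free. Then $M$ is $\omega$-Bach flat (i.e. $B_\omega=0$) provided $$\beta\int_M V(|P|^2)\,\mathrm{dVol}_g+\beta^2\int_M|P|^4\,\mathrm{dVol}_g\le 0 .$$
   Context: $S$ denotes the Ricci tensor and $W$ the Weyl tensor, $W=R-\frac{2}{n-2}S\odot g+\frac{r}{(n-1)(n-2)}g\odot g$ ($\odot$ is the Kulkarni-Nomizu product, normalized so that $W$ is the trace-free part of the curvature tensor $R$; $r$ is the scalar curvature). The Bach tensor is the symmetric trace-free $(0,2)$ tensor $$B(X,Y)=\frac{1}{n-3}\sum_{i,j}(\nabla_{e_i}\nabla_{e_j}W)(X,e_i,e_j,Y)+\frac{1}{n-2}\sum_{i,j}S(e_i,e_j)W(X,e_i,e_j,Y),$$ with $\{e_i\}$ a local orthonormal frame. Given a vector field $P$ with associated $1$-form $\omega(X)=g(X,P)$ and $\beta\in\mathbb{R}$, the $\omega$-Bach tensor is $B_\omega=B-\beta\,\omega\otimes\omega$. $(M^n,g,V,\lambda,\beta)$ is an almost $\omega$-Bach soliton with potential vector field $V$ if $\frac12\mathfrak{L}_Vg+B_\omega=\lambda g$ with $\lambda\in C^\infty(M)$. The divergence of a symmetric $(0,2)$ tensor $T$ is $(\operatorname{div}T)(Z)=\sum_i(\nabla_{e_i}T)(e_i,Z)$. *)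

theory Defs
  imports "HOL-Analysis.Analysis"
begin

section \<open>Smooth maps on open subsets of Euclidean space\<close>

definition pd :: "'n \<Rightarrow> (real ^ 'n \<Rightarrow> 'b::real_normed_vector) \<Rightarrow> real ^ 'n \<Rightarrow> 'b" where
  "pd i f x = frechet_derivative f (at x) (axis i 1)"

primrec iter_pd ::
    "'n list \<Rightarrow> (real ^ 'n \<Rightarrow> 'b::real_normed_vector) \<Rightarrow> real ^ 'n \<Rightarrow> 'b" where
  "iter_pd [] f = f"
| "iter_pd (i # js) f = pd i (iter_pd js f)"

text \<open>For open \<open>S\<close> this is infinite differentiability on \<open>S\<close>: differentiability of all iterated
  partial derivatives includes their continuity.\<close>

definition smooth_on :: "(real ^ 'n) set \<Rightarrow> (real ^ 'n \<Rightarrow> 'b::real_normed_vector) \<Rightarrow> bool" where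
  "smooth_on S f \<longleftrightarrow> (\<forall>js. \<forall>x\<in>S. iter_pd js f differentiable (at x))"


section \<open>Smooth manifolds\<close>

text \<open>The manifold is the whole type \<open>'m\<close>, Hausdorff and second countable through its type
  class constraints; its dimension is \<open>CARD('n)\<close>. A chart is a pair of a domain in \<open>'m\<close> and a
  coordinate map, whose values off the domain are irrelevant. There is no boundary, and
  connectedness is not required.\<close>

type_synonym ('m, 'n) chart = "'m set \<times> ('m \<Rightarrow> real ^ 'n)"

definition coord_image :: "('m, 'n) chart \<Rightarrow> (real ^ 'n) set" where
  "coord_image c = snd c ` fst c"

definition coord_inv :: "('m, 'n) chart \<Rightarrow> real ^ 'n \<Rightarrow> 'm" where
  "coord_inv c = inv_into (fst c) (snd c)"

definition is_chart :: "('m::topological_space, 'n::finite) chart \<Rightarrow> bool" where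
  "is_chart c \<longleftrightarrow> open (fst c) \<and> open (coord_image c) \<and>
     homeomorphism (fst c) (coord_image c) (snd c) (coord_inv c)"

definition transition :: "('m, 'n) chart \<Rightarrow> ('m, 'n) chart \<Rightarrow> real ^ 'n \<Rightarrow> real ^ 'n" where
  "transition c c' = snd c' \<circ> coord_inv c"

definition overlap :: "('m, 'n) chart \<Rightarrow> ('m, 'n) chart \<Rightarrow> (real ^ 'n) set" where
  "overlap c c' = snd c ` (fst c \<inter> fst c')"

definition smooth_atlas :: "('m::topological_space, 'n::finite) chart set \<Rightarrow> bool" where
  "smooth_atlas A \<longleftrightarrow>
     (\<forall>c\<in>A. is_chart c) \<and> (\<Union>c\<in>A. fst c) = UNIV \<and>
     (\<forall>c\<in>A. \<forall>c'\<in>A. smooth_on (overlap c c') (transition c c'))"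

definition jacobian :: "('m, 'n::finite) chart \<Rightarrow> ('m, 'n) chart \<Rightarrow> real ^ 'n \<Rightarrow> real ^ 'n ^ 'n" where
  "jacobian c c' x = (\<chi> k i. pd i (\<lambda>y. transition c c' y $ k) x)"

definition chart_at :: "('m, 'n) chart set \<Rightarrow> 'm \<Rightarrow> ('m, 'n) chart" where
  "chart_at A p = (SOME c. c \<in> A \<and> p \<in> fst c)"


section \<open>Functions, vector fields and metrics\<close>

text \<open>Vector fields and metrics are families of local coordinate expressions, one for each
  chart \<open>c\<close>, as functions of the coordinates \<open>x \<in> coord_image c\<close>, that are related by the
  tensor transformation law on overlaps.\<close>

type_synonym ('m, 'n) vfield = "('m, 'n) chart \<Rightarrow> real ^ 'n \<Rightarrow> real ^ 'n"
type_synonym ('m, 'n) metric = "('m, 'n) chart \<Rightarrow> real ^ 'n \<Rightarrow> real ^ 'n ^ 'n"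

definition smooth_function :: "('m, 'n::finite) chart set \<Rightarrow> ('m \<Rightarrow> real) \<Rightarrow> bool" where
  "smooth_function A f \<longleftrightarrow> (\<forall>c\<in>A. smooth_on (coord_image c) (f \<circ> coord_inv c))"

definition smooth_vector_field :: "('m, 'n::finite) chart set \<Rightarrow> ('m, 'n) vfield \<Rightarrow> bool" where
  "smooth_vector_field A V \<longleftrightarrow>
     (\<forall>c\<in>A. smooth_on (coord_image c) (V c)) \<and>
     (\<forall>c\<in>A. \<forall>c'\<in>A. \<forall>x\<in>overlap c c'. V c' (transition c c' x) = jacobian c c' x *v V c x)"

definition riemannian_metric :: "('m, 'n::finite) chart set \<Rightarrow> ('m, 'n) metric \<Rightarrow> bool" where
  "riemannian_metric A g \<longleftrightarrow>
     (\<forall>c\<in>A. smooth_on (coord_image c) (g c)) \<and>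
     (\<forall>c\<in>A. \<forall>x\<in>coord_image c. transpose (g c x) = g c x \<and> (\<forall>v. v \<noteq> 0 \<longrightarrow> v \<bullet> (g c x *v v) > 0)) \<and>
     (\<forall>c\<in>A. \<forall>c'\<in>A. \<forall>x\<in>overlap c c'.
        g c x = transpose (jacobian c c' x) ** g c' (transition c c' x) ** jacobian c c' x)"

text \<open>The squared length \<open>|P|^2\<close> and the derivative \<open>V(f)\<close>; by the transformation laws both are
  independent of the chart that is used at each point.\<close>

definition norm_sq :: "('m, 'n::finite) chart set \<Rightarrow> ('m, 'n) metric \<Rightarrow> ('m, 'n) vfield \<Rightarrow> 'm \<Rightarrow> real" where
  "norm_sq A g P p = (let c = chart_at A p; x = snd c p in P c x \<bullet> (g c x *v P c x))"

definition vf_deriv :: "('m, 'n::finite) chart set \<Rightarrow> ('m, 'n) vfield \<Rightarrow> ('m \<Rightarrow> real) \<Rightarrow> 'm \<Rightarrow> real" where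
  "vf_deriv A V f p =
     (let c = chart_at A p; x = snd c p in \<Sum>i\<in>UNIV. V c x $ i * pd i (f \<circ> coord_inv c) x)"

text \<open>The Riemannian measure is the unique Borel measure whose expression in each chart has
  density \<open>sqrt (det g)\<close> with respect to Lebesgue measure.\<close>

definition is_riemannian_measure ::
    "('m::topological_space, 'n::finite) chart set \<Rightarrow> ('m, 'n) metric \<Rightarrow> 'm measure \<Rightarrow> bool" where
  "is_riemannian_measure A g \<mu> \<longleftrightarrow>
     sets \<mu> = sets borel \<and>
     (\<forall>c\<in>A. \<forall>D\<in>sets borel. D \<subseteq> coord_image c \<longrightarrow>
        emeasure \<mu> {p \<in> fst c. snd c p \<in> D} = (\<integral>\<^sup>+ x\<in>D. ennreal (sqrt (det (g c x))) \<partial>lborel))"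

definition dVol :: "('m::topological_space, 'n::finite) chart set \<Rightarrow> ('m, 'n) metric \<Rightarrow> 'm measure" where
  "dVol A g = (SOME \<mu>. is_riemannian_measure A g \<mu>)"


section \<open>Tensor calculus in a chart\<close>

text \<open>Below, \<open>G\<close> is the coordinate expression of the metric in a fixed chart. A covariant tensor
  field of rank \<open>r\<close> is given by its components, indexed by lists of length \<open>r\<close>; values on
  lists of other lengths are irrelevant.\<close>

type_synonym 'n ctensor = "real ^ 'n \<Rightarrow> 'n list \<Rightarrow> real"

definition metric_trace :: "(real ^ 'n ^ 'n::finite) \<Rightarrow> ('n \<Rightarrow> 'n \<Rightarrow> real) \<Rightarrow> real" where
  "metric_trace g T = (\<Sum>i\<in>UNIV. \<Sum>j\<in>UNIV. matrix_inv g $ i $ j * T i j)"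

text \<open>Contraction with the inverse metric is the sum over any orthonormal frame \<open>e\<close>:
  \<open>metric_trace g T\<close> is the sum of the \<open>T (e_a, e_a)\<close>.\<close>

lemma metric_trace_orthonormal_frame:
  fixes g :: "real ^ 'n ^ 'n::finite" and e :: "'n \<Rightarrow> real ^ 'n"
  assumes orth: "\<And>a b. e a \<bullet> (g *v e b) = (if a = b then 1 else 0)"
  shows "(\<Sum>a\<in>UNIV. \<Sum>i\<in>UNIV. \<Sum>j\<in>UNIV. e a $ i * e a $ j * T i j) = metric_trace g T"
proof -
  define E :: "real ^ 'n ^ 'n" where "E = (\<chi> i a. e a $ i)"
  have "(transpose E ** (g ** E)) $ a $ b = e a \<bullet> (g *v e b)" for a b
    by (simp add: E_def matrix_matrix_mult_def matrix_vector_mult_def transpose_def inner_vec_def)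
  then have "transpose E ** (g ** E) = mat 1"
    by (simp add: vec_eq_iff orth mat_def)
  then have "(transpose E ** g) ** E = mat 1"
    by (simp add: matrix_mul_assoc)
  then have "E ** (transpose E ** g) = mat 1"
    by (simp add: matrix_left_right_inverse)
  then have l: "(E ** transpose E) ** g = mat 1"
    by (simp add: matrix_mul_assoc)
  then have r: "g ** (E ** transpose E) = mat 1"
    by (simp add: matrix_left_right_inverse)
  have "g ** matrix_inv g = mat 1"
    unfolding matrix_inv_def using l r by (rule_tac someI2) auto
  then have "matrix_inv g = E ** transpose E"
    by (metis l matrix_mul_assoc matrix_mul_lid matrix_mul_rid)
  then have inv: "matrix_inv g $ i $ j = (\<Sum>a\<in>UNIV. e a $ i * e a $ j)" for i j
    by (simp add: E_def matrix_matrix_mult_def transpose_def)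
  have "metric_trace g T = (\<Sum>i\<in>UNIV. \<Sum>j\<in>UNIV. \<Sum>a\<in>UNIV. e a $ i * e a $ j * T i j)"
    by (simp add: metric_trace_def inv sum_distrib_right)
  also have "\<dots> = (\<Sum>i\<in>UNIV. \<Sum>a\<in>UNIV. \<Sum>j\<in>UNIV. e a $ i * e a $ j * T i j)"
    by (intro sum.cong refl sum.swap)
  also have "\<dots> = (\<Sum>a\<in>UNIV. \<Sum>i\<in>UNIV. \<Sum>j\<in>UNIV. e a $ i * e a $ j * T i j)"
    by (rule sum.swap)
  finally show ?thesis by simp
qed

definition christoffel :: "(real ^ 'n \<Rightarrow> real ^ 'n ^ 'n::finite) \<Rightarrow> 'n \<Rightarrow> 'n \<Rightarrow> 'n \<Rightarrow> real ^ 'n \<Rightarrow> real" where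
  "christoffel G k i j x = (1/2) * (\<Sum>l\<in>UNIV. matrix_inv (G x) $ k $ l *
     (pd i (\<lambda>y. G y $ j $ l) x + pd j (\<lambda>y. G y $ i $ l) x - pd l (\<lambda>y. G y $ i $ j) x))"

text \<open>Covariant derivative; the direction of differentiation is the new first slot. Applied
  twice it yields the second covariant derivative, with components
  \<open>cov G (cov G T) x (i # j # ks)\<close> where \<open>i\<close> is the slot of the outer derivative.\<close>

definition cov :: "(real ^ 'n \<Rightarrow> real ^ 'n ^ 'n::finite) \<Rightarrow> 'n ctensor \<Rightarrow> 'n ctensor" where
  "cov G T x js = (case js of [] \<Rightarrow> 0 | i # ks \<Rightarrow>
     pd i (\<lambda>y. T y ks) x -
     (\<Sum>a<length ks. \<Sum>m\<in>UNIV. christoffel G m i (ks ! a) x * T x (ks[a := m])))"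

text \<open>\<open>curv_op G l i j k\<close> is the \<open>l\<close>-th component of \<open>R(\<partial>_i, \<partial>_j) \<partial>_k\<close>, where
  \<open>R(X,Y) = [\<nabla>_X, \<nabla>_Y] - \<nabla>_[X,Y]\<close>, and \<open>riemann\<close> is \<open>R(X,Y,Z,U) = g(R(X,Y)Z, U)\<close>. Hence the
  Ricci tensor is the trace over the outer two slots, \<open>S(Y,Z)\<close> being the sum of the
  \<open>R(e_a,Y,Z,e_a)\<close>; it is positive on round spheres.\<close>

definition curv_op ::
    "(real ^ 'n \<Rightarrow> real ^ 'n ^ 'n::finite) \<Rightarrow> 'n \<Rightarrow> 'n \<Rightarrow> 'n \<Rightarrow> 'n \<Rightarrow> real ^ 'n \<Rightarrow> real" where
  "curv_op G l i j k x =
     pd i (christoffel G l j k) x - pd j (christoffel G l i k) x +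
     (\<Sum>m\<in>UNIV. christoffel G m j k x * christoffel G l i m x -
                 christoffel G m i k x * christoffel G l j m x)"

definition riemann ::
    "(real ^ 'n \<Rightarrow> real ^ 'n ^ 'n::finite) \<Rightarrow> real ^ 'n \<Rightarrow> 'n \<Rightarrow> 'n \<Rightarrow> 'n \<Rightarrow> 'n \<Rightarrow> real" where
  "riemann G x i j k l = (\<Sum>m\<in>UNIV. curv_op G m i j k x * G x $ m $ l)"

definition ricci :: "(real ^ 'n \<Rightarrow> real ^ 'n ^ 'n::finite) \<Rightarrow> real ^ 'n \<Rightarrow> 'n \<Rightarrow> 'n \<Rightarrow> real" where
  "ricci G x j k = metric_trace (G x) (\<lambda>i l. riemann G x i j k l)"

definition scalar_curvature :: "(real ^ 'n \<Rightarrow> real ^ 'n ^ 'n::finite) \<Rightarrow> real ^ 'n \<Rightarrow> real" where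
  "scalar_curvature G x = metric_trace (G x) (ricci G x)"

text \<open>Kulkarni-Nomizu product of symmetric bilinear forms. The factor \<open>1/2\<close> is the normalization
  for which the coefficients of \<open>weyl\<close> make it the trace-free part of \<open>riemann\<close>.\<close>

definition kulkarni_nomizu ::
    "('n \<Rightarrow> 'n \<Rightarrow> real) \<Rightarrow> ('n \<Rightarrow> 'n \<Rightarrow> real) \<Rightarrow> 'n \<Rightarrow> 'n \<Rightarrow> 'n \<Rightarrow> 'n \<Rightarrow> real" where
  "kulkarni_nomizu h k a b c d =
     (1/2) * (h b c * k a d - h a c * k b d + k b c * h a d - k a c * h b d)"

definition weyl ::
    "(real ^ 'n \<Rightarrow> real ^ 'n ^ 'n::finite) \<Rightarrow> real ^ 'n \<Rightarrow> 'n \<Rightarrow> 'n \<Rightarrow> 'n \<Rightarrow> 'n \<Rightarrow> real" where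
  "weyl G x a b c d =
     (let n = real CARD('n); g = (\<lambda>i j. G x $ i $ j) in
      riemann G x a b c d
      - 2 / (n - 2) * kulkarni_nomizu (ricci G x) g a b c d
      + scalar_curvature G x / ((n - 1) * (n - 2)) * kulkarni_nomizu g g a b c d)"

definition tensor2 :: "(real ^ 'n \<Rightarrow> 'n \<Rightarrow> 'n \<Rightarrow> real) \<Rightarrow> 'n ctensor" where
  "tensor2 T x js = (case js of [i, j] \<Rightarrow> T x i j | _ \<Rightarrow> 0)"

definition tensor4 :: "(real ^ 'n \<Rightarrow> 'n \<Rightarrow> 'n \<Rightarrow> 'n \<Rightarrow> 'n \<Rightarrow> real) \<Rightarrow> 'n ctensor" where
  "tensor4 T x js = (case js of [i, j, k, l] \<Rightarrow> T x i j k l | _ \<Rightarrow> 0)"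

text \<open>In the next definition \<open>i, i'\<close> are the two slots filled with \<open>e_i\<close>, and \<open>j, j'\<close> those
  filled with \<open>e_j\<close>.\<close>

definition bach :: "(real ^ 'n \<Rightarrow> real ^ 'n ^ 'n::finite) \<Rightarrow> real ^ 'n \<Rightarrow> 'n \<Rightarrow> 'n \<Rightarrow> real" where
  "bach G x a b =
     1 / (real CARD('n) - 3) *
       metric_trace (G x) (\<lambda>i i'. metric_trace (G x) (\<lambda>j j'.
         cov G (cov G (tensor4 (weyl G))) x [i, j, a, i', j', b]))
   + 1 / (real CARD('n) - 2) *
       metric_trace (G x) (\<lambda>i i'. metric_trace (G x) (\<lambda>j j'.
         ricci G x i j * weyl G x a i' j' b))"

definition lower :: "(real ^ 'n \<Rightarrow> real ^ 'n ^ 'n::finite) \<Rightarrow> (real ^ 'n \<Rightarrow> real ^ 'n) \<Rightarrow> real ^ 'n \<Rightarrow> 'n \<Rightarrow> real" where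
  "lower G P x i = (\<Sum>j\<in>UNIV. G x $ i $ j * P x $ j)"

definition omega_bach ::
    "(real ^ 'n \<Rightarrow> real ^ 'n ^ 'n::finite) \<Rightarrow> real \<Rightarrow> (real ^ 'n \<Rightarrow> 'n \<Rightarrow> real) \<Rightarrow> real ^ 'n \<Rightarrow> 'n \<Rightarrow> 'n \<Rightarrow> real" where
  "omega_bach G \<beta> \<omega> x i j = bach G x i j - \<beta> * (\<omega> x i * \<omega> x j)"

definition divergence ::
    "(real ^ 'n \<Rightarrow> real ^ 'n ^ 'n::finite) \<Rightarrow> (real ^ 'n \<Rightarrow> 'n \<Rightarrow> 'n \<Rightarrow> real) \<Rightarrow> real ^ 'n \<Rightarrow> 'n \<Rightarrow> real" where
  "divergence G T x k = metric_trace (G x) (\<lambda>i j. cov G (tensor2 T) x [i, j, k])"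

definition lie_metric ::
    "(real ^ 'n \<Rightarrow> real ^ 'n ^ 'n::finite) \<Rightarrow> (real ^ 'n \<Rightarrow> real ^ 'n) \<Rightarrow> real ^ 'n \<Rightarrow> 'n \<Rightarrow> 'n \<Rightarrow> real" where
  "lie_metric G V x i j = (\<Sum>k\<in>UNIV.
     V x $ k * pd k (\<lambda>y. G y $ i $ j) x +
     G x $ k $ j * pd i (\<lambda>y. V y $ k) x + G x $ i $ k * pd j (\<lambda>y. V y $ k) x)"


section \<open>Almost \<open>\<omega>\<close>-Bach solitons\<close>

text \<open>\<open>\<omega>\<close> is the 1-form associated to the vector field \<open>P\<close>.\<close>

definition almost_omega_bach_soliton ::
    "('m, 'n::finite) chart set \<Rightarrow> ('m, 'n) metric \<Rightarrow> ('m, 'n) vfield \<Rightarrow> ('m \<Rightarrow> real) \<Rightarrow> real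
      \<Rightarrow> ('m, 'n) vfield \<Rightarrow> bool" where
  "almost_omega_bach_soliton A g V lam \<beta> P \<longleftrightarrow>
     smooth_vector_field A V \<and> smooth_vector_field A P \<and> smooth_function A lam \<and>
     (\<forall>c\<in>A. \<forall>x\<in>coord_image c. \<forall>i j.
        (1/2) * lie_metric (g c) (V c) x i j + omega_bach (g c) \<beta> (lower (g c) (P c)) x i j
        = lam (coord_inv c x) * g c x $ i $ j)"

definition omega_bach_divergence_free ::
    "('m, 'n::finite) chart set \<Rightarrow> ('m, 'n) metric \<Rightarrow> real \<Rightarrow> ('m, 'n) vfield \<Rightarrow> bool" where
  "omega_bach_divergence_free A g \<beta> P \<longleftrightarrow>
     (\<forall>c\<in>A. \<forall>x\<in>coord_image c. \<forall>k.
        divergence (g c) (omega_bach (g c) \<beta> (lower (g c) (P c))) x k = 0)"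

definition omega_bach_flat ::
    "('m, 'n::finite) chart set \<Rightarrow> ('m, 'n) metric \<Rightarrow> real \<Rightarrow> ('m, 'n) vfield \<Rightarrow> bool" where
  "omega_bach_flat A g \<beta> P \<longleftrightarrow>
     (\<forall>c\<in>A. \<forall>x\<in>coord_image c. \<forall>i j. omega_bach (g c) \<beta> (lower (g c) (P c)) x i j = 0)"

end

theory Submission
  imports Defs
begin

text \<open>Write \<open>T = B_\<omega>\<close> and \<open>f = |P|^2\<close>. By the soliton equation \<open>T = \<lambda> g - (1/2) L_V g\<close>, so
  \<open>T\<close> is smooth and symmetric and transforms as a tensor; none of this has
  to be checked on the Bach tensor. Its trace is \<open>- \<beta> f\<close> since the Bach tensor is trace free, and the trace of the soliton
  equation gives \<open>div V = n \<lambda> + \<beta> f\<close>. As \<open>T\<close> is divergence free,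
  \<open>div (T(V)) = (1/2) <T, L_V g> = - \<beta> \<lambda> f - |T|^2\<close>. Integrating this identity and
  \<open>div (f V) = V(f) + f div V\<close> over \<open>M\<close> and eliminating the integral of \<open>\<lambda> f\<close>, one finds that \<open>n\<close> times
  the integral of \<open>|T|^2\<close> is \<open>\<beta> \<integral> V(f) + \<beta>^2 \<integral> f^2\<close>, which is at most \<open>0\<close>; hence \<open>T = 0\<close>.\<close>

section \<open>Partial derivatives and continuously differentiable maps\<close>

text \<open>The Bach tensor is trace free because the Weyl tensor has vanishing outer trace and
  covariant differentiation commutes with traces; its formula is used for nothing else. Most of the
  work lies behind the words "integrating over M". The measure \<open>dVol\<close> is chosen from a
  specification, so a measure with the prescribed chart densities has to be constructed first;
  afterwards only the specification is used. The divergence theorem is proved with densities and a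
  partition of unity, so it also covers nonorientable manifolds. Cutoffs and density are
  differentiated only once, so class C^1 suffices for them, and finite differentiability classes are
  developed along with smoothness. The soliton equation holds chart by chart, so the tensoriality of
  \<open>T\<close> rests on the naturality of the Lie derivative under transition maps. Finally,
  |T|^2 is an expression with two inverse metrics whose sign is not visible; writing the inverse
  metric as a sum of squares, that is, choosing an orthonormal frame at a point, exhibits it as a
  sum of squares.\<close>

lemma pd_has_derivative:
  "(f has_derivative f') (at x) \<Longrightarrow> pd i f x = f' (axis i 1)"
  by (metis frechet_derivative_at pd_def)

lemma has_derivative_pd:
  fixes f :: "real ^ 'n::finite \<Rightarrow> 'b::real_normed_vector"
  assumes "f differentiable (at x)"
  shows "(f has_derivative (\<lambda>h. \<Sum>i\<in>UNIV. h $ i *\<^sub>R pd i f x)) (at x)"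
proof -
  let ?D = "frechet_derivative f (at x)"
  have D: "(f has_derivative ?D) (at x)"
    using assms frechet_derivative_works by blast
  then interpret bounded_linear ?D
    by (rule has_derivative_bounded_linear)
  have "?D h = (\<Sum>i\<in>UNIV. h $ i *\<^sub>R pd i f x)" for h
  proof -
    have "h = (\<Sum>i\<in>UNIV. h $ i *\<^sub>R axis i 1)"
      by (simp add: vec_eq_iff axis_def if_distrib[of "\<lambda>t. _ * t"] cong: if_cong)
    then have "?D h = ?D (\<Sum>i\<in>UNIV. h $ i *\<^sub>R axis i 1)"
      by simp
    then show ?thesis
      by (simp add: sum scaleR pd_def)
  qed
  then have "?D = (\<lambda>h. \<Sum>i\<in>UNIV. h $ i *\<^sub>R pd i f x)"
    by blast
  then show ?thesis
    using D by simp
qed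

lemma has_derivative_cong_open:
  assumes "open S" "x \<in> S" "\<And>y. y \<in> S \<Longrightarrow> f y = g y"
  shows "(f has_derivative f') (at x) \<longleftrightarrow> (g has_derivative f') (at x)"
  using assms has_derivative_transform_within_open[of f f' x UNIV S g]
    has_derivative_transform_within_open[of g f' x UNIV S f] by auto

lemma pd_cong_open:
  assumes "open S" "x \<in> S" "\<And>y. y \<in> S \<Longrightarrow> f y = g y"
  shows "pd i f x = pd i g x"
  using has_derivative_cong_open[OF assms] by (simp add: pd_def frechet_derivative_def)

lemma differentiable_cong_open:
  assumes "open S" "x \<in> S" "\<And>y. y \<in> S \<Longrightarrow> f y = g y"
  shows "f differentiable (at x) \<longleftrightarrow> g differentiable (at x)"
  using has_derivative_cong_open[OF assms] by (simp add: differentiable_def)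

lemma pd_const: "pd i (\<lambda>_. c) x = 0"
  using pd_has_derivative[of "\<lambda>_. c" "\<lambda>_. 0" x i] by simp

lemma frechet_works:
  "f differentiable (at x) \<Longrightarrow> (f has_derivative frechet_derivative f (at x)) (at x)"
  using frechet_derivative_works by blast

lemma pd_bounded_linear:
  assumes "bounded_linear L" "f differentiable (at x)"
  shows "pd i (\<lambda>y. L (f y)) x = L (pd i f x)"
  by (subst pd_has_derivative[OF bounded_linear.has_derivative[OF assms(1) frechet_works[OF assms(2)]]])
    (simp add: pd_def)

lemma pd_add:
  assumes "f differentiable (at x)" "g differentiable (at x)"
  shows "pd i (\<lambda>y. f y + g y) x = pd i f x + pd i g x"
  by (subst pd_has_derivative[OF has_derivative_add[OF assms[THEN frechet_works]]]) (simp add: pd_def)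

lemma pd_mult:
  fixes f g :: "real ^ 'n::finite \<Rightarrow> real"
  assumes "f differentiable (at x)" "g differentiable (at x)"
  shows "pd i (\<lambda>y. f y * g y) x = pd i f x * g x + f x * pd i g x"
  by (subst pd_has_derivative[OF has_derivative_mult[OF assms[THEN frechet_works]]]) (simp add: pd_def)

lemma pd_sum:
  assumes "\<And>a. a \<in> I \<Longrightarrow> f a differentiable (at x)"
  shows "pd i (\<lambda>y. \<Sum>a\<in>I. f a y) x = (\<Sum>a\<in>I. pd i (f a) x)"
  using assms by (induction I rule: infinite_finite_induct)
    (auto simp: pd_const pd_add differentiable_sum)

lemma pd_component:
  fixes f :: "real ^ 'n::finite \<Rightarrow> 'b::real_normed_vector ^ 'm::finite"
  assumes "f differentiable (at x)"
  shows "pd i (\<lambda>y. f y $ k) x = pd i f x $ k"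
  by (rule pd_bounded_linear[OF bounded_linear_vec_nth assms])

lemma pd_chain:
  fixes f :: "real ^ 'n::finite \<Rightarrow> 'b::real_normed_vector"
    and \<phi> :: "real ^ 'm::finite \<Rightarrow> real ^ 'n"
  assumes f: "f differentiable (at (\<phi> x))" and \<phi>: "\<phi> differentiable (at x)"
  shows "pd i (\<lambda>y. f (\<phi> y)) x = (\<Sum>j\<in>UNIV. pd i (\<lambda>y. \<phi> y $ j) x *\<^sub>R pd j f (\<phi> x))"
proof -
  have "(f \<circ> \<phi> has_derivative (\<lambda>h. \<Sum>j\<in>UNIV. h $ j *\<^sub>R pd j f (\<phi> x)) \<circ> frechet_derivative \<phi> (at x)) (at x)"
    by (rule diff_chain_at[OF frechet_works[OF \<phi>] has_derivative_pd[OF f]])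
  then have "pd i (f \<circ> \<phi>) x = (\<Sum>j\<in>UNIV. pd i \<phi> x $ j *\<^sub>R pd j f (\<phi> x))"
    using pd_has_derivative by (fastforce simp: pd_def)
  then show ?thesis
    by (simp add: pd_component[OF \<phi>] comp_def)
qed

text \<open>Class C^k, by recursion on the order with the map varying, so that product, quotient and
  chain rules go by induction; order 1 is needed in its own right for the volume density and the
  cutoffs. The recursion strips the innermost derivative whereas \<open>iter_pd\<close> adds the
  outermost one, hence \<open>iter_pd_append\<close> in the comparison with
  \<open>smooth_on\<close>.\<close>

primrec ck :: "nat \<Rightarrow> (real ^ 'n::finite) set \<Rightarrow> (real ^ 'n \<Rightarrow> 'b::real_normed_vector) \<Rightarrow> bool" where
  "ck 0 S f = continuous_on S f"
| "ck (Suc k) S f = ((\<forall>x\<in>S. f differentiable (at x)) \<and> (\<forall>i. ck k S (pd i f)))"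

lemma ck_cong:
  assumes "open S" "\<And>x. x \<in> S \<Longrightarrow> f x = g x"
  shows "ck k S f \<longleftrightarrow> ck k S g"
  using assms(2)
proof (induction k arbitrary: f g)
  case 0
  then show ?case by (simp cong: continuous_on_cong)
next
  case (Suc k)
  have "ck k S (pd i f) \<longleftrightarrow> ck k S (pd i g)" for i
    using Suc pd_cong_open[OF assms(1)] by blast
  moreover have "f differentiable (at x) \<longleftrightarrow> g differentiable (at x)" if "x \<in> S" for x
    using differentiable_cong_open[OF assms(1) that] Suc by blast
  ultimately show ?case by auto
qed

lemma ck_subset: "ck k T f \<Longrightarrow> S \<subseteq> T \<Longrightarrow> ck k S f"
  by (induction k arbitrary: f) (auto intro: continuous_on_subset)

lemma ck_Suc_imp: "ck (Suc k) S f \<Longrightarrow> ck k S f"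
proof (induction k arbitrary: f)
  case 0
  then show ?case
    by (auto intro!: continuous_at_imp_continuous_on differentiable_imp_continuous_within)
qed auto

lemma ck_differentiable: "ck (Suc k) S f \<Longrightarrow> x \<in> S \<Longrightarrow> f differentiable (at x)"
  by simp

lemma ck_imp_continuous_on: "ck k S f \<Longrightarrow> continuous_on S f"
  by (induction k) (use ck_Suc_imp in auto)

lemma ck_const:
  fixes S :: "(real ^ 'n::finite) set"
  shows "ck k S (\<lambda>_. c)"
proof (induction k arbitrary: c)
  case (Suc k)
  have "pd i (\<lambda>_ :: real ^ 'n. c) = (\<lambda>_. 0)" for i by (simp add: pd_const fun_eq_iff)
  then show ?case using Suc by simp
qed simp

text \<open>Any formula \<open>D\<close> for the derivative will do: as \<open>S\<close> is open,
  \<open>pd i f\<close> may be replaced on \<open>S\<close> by an explicit expression, to which the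
  closure rules apply.\<close>

lemma ck_SucI:
  assumes "open S" "\<And>x. x \<in> S \<Longrightarrow> (f has_derivative D x) (at x)"
    and "\<And>i. ck k S (\<lambda>x. D x (axis i 1))"
  shows "ck (Suc k) S f"
proof -
  have "ck k S (pd i f)" for i
    using ck_cong[OF assms(1), of "pd i f" "\<lambda>x. D x (axis i 1)"] assms(2,3) pd_has_derivative by blast
  then show ?thesis using assms(2) by (auto simp: differentiable_def)
qed

lemma ck_Suc_has_derivative:
  "ck (Suc k) S f \<Longrightarrow> x \<in> S \<Longrightarrow> (f has_derivative frechet_derivative f (at x)) (at x)"
  by (simp add: frechet_works)

lemma ck_Suc_pd: "ck (Suc k) S f \<Longrightarrow> ck k S (\<lambda>x. frechet_derivative f (at x) (axis i 1))"
  by (simp add: pd_def[abs_def])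

lemma ck_bounded_linear:
  assumes S: "open S" and L: "bounded_linear L" and "ck k S f"
  shows "ck k S (\<lambda>x. L (f x))"
  using assms(3)
proof (induction k arbitrary: f)
  case 0
  then show ?case
    using bounded_linear.continuous_on[OF L] by auto
next
  case (Suc k)
  show ?case
    by (rule ck_SucI[OF S bounded_linear.has_derivative[OF L ck_Suc_has_derivative[OF Suc.prems]]])
      (use Suc.IH[OF ck_Suc_pd[OF Suc.prems]] in auto)
qed

lemma ck_add:
  assumes S: "open S" and "ck k S f" "ck k S g"
  shows "ck k S (\<lambda>x. f x + g x)"
  using assms(2,3)
proof (induction k arbitrary: f g)
  case 0
  then show ?case by (auto intro: continuous_intros)
next
  case (Suc k)
  show ?case
    by (rule ck_SucI[OF S has_derivative_add[OF Suc.prems[THEN ck_Suc_has_derivative]]])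
      (use Suc.IH[OF Suc.prems[THEN ck_Suc_pd]] in auto)
qed

lemma ck_mult:
  fixes f g :: "real ^ 'n::finite \<Rightarrow> real"
  assumes S: "open S" and "ck k S f" "ck k S g"
  shows "ck k S (\<lambda>x. f x * g x)"
  using assms(2,3)
proof (induction k arbitrary: f g)
  case 0
  then show ?case by (auto intro: continuous_intros)
next
  case (Suc k)
  note f = Suc.prems(1) and g = Suc.prems(2)
  show ?case
    by (rule ck_SucI[OF S has_derivative_mult[OF Suc.prems[THEN ck_Suc_has_derivative]]])
      (auto intro!: ck_add[OF S] Suc.IH ck_Suc_imp[OF f] ck_Suc_imp[OF g] ck_Suc_pd[OF f] ck_Suc_pd[OF g])
qed

lemma ck_sum:
  assumes "open S" "\<And>a. a \<in> I \<Longrightarrow> ck k S (f a)"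
  shows "ck k S (\<lambda>x. \<Sum>a\<in>I. f a x)"
  using assms(2) by (induction I rule: infinite_finite_induct) (auto intro: ck_const ck_add[OF assms(1)])

lemma ck_prod:
  fixes f :: "'a \<Rightarrow> real ^ 'n::finite \<Rightarrow> real"
  assumes "open S" "\<And>a. a \<in> I \<Longrightarrow> ck k S (f a)"
  shows "ck k S (\<lambda>x. \<Prod>a\<in>I. f a x)"
  using assms(2) by (induction I rule: infinite_finite_induct) (auto intro: ck_const ck_mult[OF assms(1)])

lemma ck_inverse:
  fixes f :: "real ^ 'n::finite \<Rightarrow> real"
  assumes S: "open S" and "ck k S f" "\<And>x. x \<in> S \<Longrightarrow> f x \<noteq> 0"
  shows "ck k S (\<lambda>x. inverse (f x))"
  using assms(2)
proof (induction k)
  case 0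
  then show ?case using assms(3) by (auto intro: continuous_intros)
next
  case (Suc k)
  \<comment> \<open>The sign is written as a constant factor so that the derivative is a product,
    ready for \<open>ck_mult\<close> and \<open>ck_const\<close>.\<close>
  have der: "((\<lambda>y. inverse (f y)) has_derivative (\<lambda>h. - 1 * (inverse (f x) * frechet_derivative f (at x) h * inverse (f x)))) (at x)"
    if "x \<in> S" for x
    using Deriv.has_derivative_inverse[OF assms(3)[OF that] ck_Suc_has_derivative[OF Suc.prems that]] by simp
  have "ck k S (\<lambda>x. inverse (f x))"
    using Suc ck_Suc_imp by blast
  then show ?case
    by (intro ck_SucI[OF S der] ck_mult S ck_const ck_Suc_pd[OF Suc.prems])
qed

text \<open>The induction varies \<open>f\<close> and keeps \<open>\<phi>\<close>: by the chain rule
  a partial derivative is a sum of products of first partials of \<open>\<phi>\<close> with maps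
  \<open>pd j f\<close> composed with \<open>\<phi>\<close>, and the latter fall under the induction
  hypothesis.\<close>

lemma ck_compose:
  fixes f :: "real ^ 'n::finite \<Rightarrow> real" and \<phi> :: "real ^ 'm::finite \<Rightarrow> real ^ 'n"
  assumes S: "open S" and "ck k T f" "ck k S \<phi>" "\<phi> ` S \<subseteq> T"
  shows "ck k S (\<lambda>x. f (\<phi> x))"
  using assms(2,3)
proof (induction k arbitrary: f)
  case 0
  then show ?case using assms(4) by (auto intro: continuous_on_compose2)
next
  case (Suc k)
  have "ck k T (pd j f)" for j
    using Suc.prems(1) by simp
  then have k: "ck k S (\<lambda>x. pd j f (\<phi> x))" for j
    using Suc.IH ck_Suc_imp[OF Suc.prems(2)] by blast
  have "ck k S (\<lambda>x. \<Sum>j\<in>UNIV. frechet_derivative \<phi> (at x) (axis i 1) $ j *\<^sub>R pd j f (\<phi> x))" for i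
    unfolding real_scaleR_def
    by (intro ck_sum ck_mult S k ck_bounded_linear[OF S bounded_linear_vec_nth] ck_Suc_pd[OF Suc.prems(2)])
  moreover have "((\<lambda>y. f (\<phi> y)) has_derivative
      (\<lambda>h. \<Sum>j\<in>UNIV. frechet_derivative \<phi> (at x) h $ j *\<^sub>R pd j f (\<phi> x))) (at x)" if "x \<in> S" for x
    using Suc.prems(1) assms(4) that
    by (intro has_derivative_compose[OF ck_Suc_has_derivative[OF Suc.prems(2) that] has_derivative_pd]) auto
  ultimately show ?case
    by (intro ck_SucI[OF S]) auto
qed

text \<open>Each component enters through the bounded linear embedding \<open>axis j\<close>, so the
  vector is a finite sum of C^k maps.\<close>

lemma ck_vec:
  fixes f :: "'k::finite \<Rightarrow> real ^ 'n::finite \<Rightarrow> 'b::euclidean_space"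
  assumes "open S" "\<And>j. ck k S (f j)"
  shows "ck k S (\<lambda>x. \<chi> j. f j x)"
proof -
  have "bounded_linear (\<lambda>v. axis j v :: 'b ^ 'k)" for j
    unfolding linear_conv_bounded_linear[symmetric]
    by (rule linearI) (auto simp: vec_eq_iff axis_def)
  then have "ck k S (\<lambda>x. \<Sum>j\<in>UNIV. axis j (f j x) :: 'b ^ 'k)"
    by (intro ck_sum assms(1) ck_bounded_linear[where L = "axis _", OF assms(1) _ assms(2)])
  moreover have "(\<chi> j. f j x) = (\<Sum>j\<in>UNIV. axis j (f j x) :: 'b ^ 'k)" for x
    by (simp add: vec_eq_iff axis_def if_distrib cong: if_cong)
  ultimately show ?thesis by simp
qed

lemma iter_pd_append: "iter_pd (is @ js) f = iter_pd is (iter_pd js f)"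
  by (induction "is") auto

lemma smooth_on_imp_ck: "smooth_on S f \<Longrightarrow> ck k S f"
proof (induction k arbitrary: f)
  case 0
  then have "\<forall>x\<in>S. f differentiable (at x)"
    unfolding smooth_on_def by (metis iter_pd.simps(1))
  then show ?case
    by (auto intro!: continuous_at_imp_continuous_on differentiable_imp_continuous_within)
next
  case (Suc k)
  have "smooth_on S (pd i f)" for i
    unfolding smooth_on_def
  proof (intro allI ballI)
    fix js x assume "x \<in> S"
    then show "iter_pd js (pd i f) differentiable (at x)"
      using Suc.prems iter_pd_append[of js "[i]" f] unfolding smooth_on_def by (metis iter_pd.simps)
  qed
  moreover have "\<forall>x\<in>S. f differentiable (at x)"
    using Suc.prems unfolding smooth_on_def by (metis iter_pd.simps(1))
  ultimately show ?case using Suc.IH by simp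
qed

lemma ck_imp_iter_pd:
  assumes "ck (k + length js) S f"
  shows "ck k S (iter_pd js f)"
  using assms
proof (induction js arbitrary: k)
  case (Cons i js)
  have "ck (Suc k) S (iter_pd js f)"
    using Cons.IH[of "Suc k"] Cons.prems by simp
  then show ?case by simp
qed simp

lemma smooth_on_iff_ck: "smooth_on S f \<longleftrightarrow> (\<forall>k. ck k S f)"
proof
  assume "\<forall>k. ck k S f"
  then have "ck (Suc 0) S (iter_pd js f)" for js
    using ck_imp_iter_pd by blast
  then show "smooth_on S f"
    unfolding smooth_on_def using ck_differentiable by blast
qed (simp add: smooth_on_imp_ck)

lemma smooth_on_differentiable: "smooth_on S f \<Longrightarrow> x \<in> S \<Longrightarrow> f differentiable (at x)"
  unfolding smooth_on_def by (metis iter_pd.simps(1))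

section \<open>Closure properties of smooth maps\<close>

named_theorems smooth

lemma smooth_on_cong:
  assumes "open S" "\<And>x. x \<in> S \<Longrightarrow> f x = g x"
  shows "smooth_on S f \<longleftrightarrow> smooth_on S g"
  unfolding smooth_on_iff_ck using ck_cong[OF assms] by simp

lemma smooth_on_pd [smooth]: "smooth_on S f \<Longrightarrow> smooth_on S (pd i f)"
  unfolding smooth_on_iff_ck by (meson ck.simps(2))

lemma smooth_on_const [smooth]: "smooth_on S (\<lambda>_. c)"
  by (simp add: smooth_on_iff_ck ck_const)

lemma smooth_on_bounded_linear:
  "open S \<Longrightarrow> bounded_linear L \<Longrightarrow> smooth_on S f \<Longrightarrow> smooth_on S (\<lambda>x. L (f x))"
  by (simp add: smooth_on_iff_ck ck_bounded_linear)

lemma smooth_on_component [smooth]: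
  "open S \<Longrightarrow> smooth_on S f \<Longrightarrow> smooth_on S (\<lambda>x. f x $ i)"
  by (rule smooth_on_bounded_linear[OF _ bounded_linear_vec_nth])

lemma smooth_on_add [smooth]:
  "open S \<Longrightarrow> smooth_on S f \<Longrightarrow> smooth_on S g \<Longrightarrow> smooth_on S (\<lambda>x. f x + g x)"
  by (simp add: smooth_on_iff_ck ck_add)

lemma smooth_on_mult [smooth]:
  fixes f g :: "real ^ 'n::finite \<Rightarrow> real"
  shows "open S \<Longrightarrow> smooth_on S f \<Longrightarrow> smooth_on S g \<Longrightarrow> smooth_on S (\<lambda>x. f x * g x)"
  by (simp add: smooth_on_iff_ck ck_mult)

lemma smooth_on_uminus [smooth]:
  "open S \<Longrightarrow> smooth_on S f \<Longrightarrow> smooth_on S (\<lambda>x. - f x)"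
  by (rule smooth_on_bounded_linear[OF _ bounded_linear_minus[OF bounded_linear_ident]])

lemma smooth_on_diff [smooth]:
  "open S \<Longrightarrow> smooth_on S f \<Longrightarrow> smooth_on S g \<Longrightarrow> smooth_on S (\<lambda>x. f x - g x)"
  using smooth_on_add[of S f "\<lambda>x. - g x"] smooth_on_uminus[of S g] by simp

lemma smooth_on_sum [smooth]:
  "open S \<Longrightarrow> (\<And>a. a \<in> I \<Longrightarrow> smooth_on S (f a)) \<Longrightarrow> smooth_on S (\<lambda>x. \<Sum>a\<in>I. f a x)"
  by (simp add: smooth_on_iff_ck ck_sum)

lemma smooth_on_prod [smooth]:
  fixes f :: "'a \<Rightarrow> real ^ 'n::finite \<Rightarrow> real"
  shows "open S \<Longrightarrow> (\<And>a. a \<in> I \<Longrightarrow> smooth_on S (f a)) \<Longrightarrow> smooth_on S (\<lambda>x. \<Prod>a\<in>I. f a x)"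
  by (simp add: smooth_on_iff_ck ck_prod)

lemma smooth_on_inverse:
  fixes f :: "real ^ 'n::finite \<Rightarrow> real"
  shows "open S \<Longrightarrow> smooth_on S f \<Longrightarrow> (\<And>x. x \<in> S \<Longrightarrow> f x \<noteq> 0) \<Longrightarrow> smooth_on S (\<lambda>x. inverse (f x))"
  by (simp add: smooth_on_iff_ck ck_inverse)

lemma smooth_on_vec:
  fixes f :: "'k::finite \<Rightarrow> real ^ 'n::finite \<Rightarrow> 'b::euclidean_space"
  shows "open S \<Longrightarrow> (\<And>j. smooth_on S (f j)) \<Longrightarrow> smooth_on S (\<lambda>x. \<chi> j. f j x)"
  by (simp add: smooth_on_iff_ck ck_vec)

lemma smooth_on_det:
  fixes M :: "real ^ 'n::finite \<Rightarrow> real ^ 'k ^ 'k::finite"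
  assumes "open S" "\<And>i j. smooth_on S (\<lambda>x. M x $ i $ j)"
  shows "smooth_on S (\<lambda>x. det (M x))"
  unfolding det_def by (intro smooth assms)

section \<open>Smooth dependence of the inverse matrix\<close>

lemma matrix_inv_inverse:
  fixes M :: "real ^ 'k ^ 'k::finite"
  assumes "det M \<noteq> 0"
  shows "M ** matrix_inv M = mat 1" "matrix_inv M ** M = mat 1"
proof -
  have "\<exists>B. M ** B = mat 1 \<and> B ** M = mat 1"
    using assms by (simp add: invertible_det_nz[symmetric] invertible_def)
  then have "M ** matrix_inv M = mat 1 \<and> matrix_inv M ** M = mat 1"
    unfolding matrix_inv_def by (rule someI_ex)
  then show "M ** matrix_inv M = mat 1" "matrix_inv M ** M = mat 1" by auto
qed

text \<open>Cramer's rule presents the entries as quotients of polynomials in the entries of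
  \<open>M\<close>, from which smoothness can be read off.\<close>

lemma matrix_inv_cramer:
  fixes M :: "real ^ 'k ^ 'k::finite"
  assumes "det M \<noteq> 0"
  shows "matrix_inv M $ a $ b = det (\<chi> i j. if j = a then axis b 1 $ i else M $ i $ j) * inverse (det M)"
proof -
  have "M ** matrix_inv M = mat 1"
    by (rule matrix_inv_inverse[OF assms])
  then have "M *v (matrix_inv M *v axis b 1) = axis b 1"
    by (simp add: matrix_vector_mul_assoc)
  then have "matrix_inv M *v axis b 1 = (\<chi> k. det (\<chi> i j. if j = k then axis b 1 $ i else M $ i $ j) / det M)"
    using cramer[OF assms] by blast
  then have "(matrix_inv M *v axis b 1) $ a = det (\<chi> i j. if j = a then axis b 1 $ i else M $ i $ j) / det M"
    by simp
  then show ?thesis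
    by (simp add: matrix_vector_mult_basis column_def divide_inverse)
qed

lemma smooth_on_matrix_inv:
  fixes M :: "real ^ 'n::finite \<Rightarrow> real ^ 'k ^ 'k::finite"
  assumes S: "open S" and M: "\<And>i j. smooth_on S (\<lambda>x. M x $ i $ j)"
    and nz: "\<And>x. x \<in> S \<Longrightarrow> det (M x) \<noteq> 0"
  shows "smooth_on S (\<lambda>x. matrix_inv (M x) $ a $ b)"
proof -
  have "smooth_on S (\<lambda>x. (\<chi> i j. if j = a then axis b 1 $ i else M x $ i $ j) $ i $ j)" for i j
    using M by (cases "j = a") (auto intro: smooth_on_const)
  then have "smooth_on S (\<lambda>x. det (\<chi> i j. if j = a then axis b 1 $ i else M x $ i $ j) * inverse (det (M x)))"
    using M by (intro smooth_on_mult smooth_on_inverse smooth_on_det S nz)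
  then show ?thesis
    by (subst smooth_on_cong[OF S matrix_inv_cramer[OF nz]])
qed

text \<open>Order 1 is the regularity that integration by parts asks of the volume density.\<close>

lemma ck_sqrt:
  fixes f :: "real ^ 'n::finite \<Rightarrow> real"
  assumes S: "open S" and f: "ck (Suc 0) S f" and "\<And>x. x \<in> S \<Longrightarrow> f x > 0"
  shows "ck (Suc 0) S (\<lambda>x. sqrt (f x))"
proof -
  have "((\<lambda>y. sqrt (f y)) has_derivative (\<lambda>h. inverse (sqrt (f x)) / 2 * frechet_derivative f (at x) h)) (at x)"
    if "x \<in> S" for x
    using has_derivative_compose[OF ck_Suc_has_derivative[OF f that]
        DERIV_real_sqrt[OF assms(3)[OF that], unfolded has_field_derivative_def]]
    by simp
  moreover have "ck 0 S (\<lambda>x. inverse (sqrt (f x)) / 2 * frechet_derivative f (at x) (axis i 1))" for i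
    using ck_imp_continuous_on[OF f] ck_Suc_pd[OF f, of i] assms(3)
    by (auto intro!: continuous_intros simp: less_imp_neq[symmetric])
  ultimately show ?thesis
    by (rule ck_SucI[OF S])
qed

section \<open>Symmetry of mixed partial derivatives\<close>

lemma pd_line:
  fixes f :: "real ^ 'n::finite \<Rightarrow> real"
  assumes "f differentiable (at (y + t *\<^sub>R axis i 1))"
  shows "((\<lambda>t. f (y + t *\<^sub>R axis i 1)) has_real_derivative pd i f (y + t *\<^sub>R axis i 1)) (at t)"
proof -
  have "(f has_derivative frechet_derivative f (at (y + t *\<^sub>R axis i 1))) (at (y + t *\<^sub>R axis i 1))"
    using assms frechet_derivative_works by blast
  moreover have "((\<lambda>t. y + t *\<^sub>R axis i 1) has_derivative (\<lambda>h. h *\<^sub>R axis i 1)) (at t)"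
    by (auto intro!: derivative_eq_intros)
  ultimately have "((\<lambda>t. f (y + t *\<^sub>R axis i 1)) has_derivative
      (\<lambda>h. frechet_derivative f (at (y + t *\<^sub>R axis i 1)) (h *\<^sub>R axis i 1))) (at t)"
    using has_derivative_compose by blast
  moreover have "frechet_derivative f (at (y + t *\<^sub>R axis i 1)) (h *\<^sub>R axis i 1)
      = pd i f (y + t *\<^sub>R axis i 1) * h" for h
    using linear_scale[OF linear_frechet_derivative[OF assms]] by (simp add: pd_def mult.commute)
  ultimately show ?thesis
    by (simp add: has_field_derivative_def)
qed

text \<open>Schwarz's theorem: by the mean value theorem, the second difference of \<open>f\<close> over a small
  square is \<open>t^2\<close> times each mixed derivative at some point of the square.\<close>

lemma second_difference_mean_value:
  fixes f :: "real ^ 'n::finite \<Rightarrow> real"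
  assumes f: "ck 2 (ball x r) f" and t: "0 < t" "2 * t < r"
  shows "\<exists>z \<in> ball x (3 * t).
    f (x + t *\<^sub>R axis i 1 + t *\<^sub>R axis j 1) - f (x + t *\<^sub>R axis i 1) - f (x + t *\<^sub>R axis j 1) + f x
    = t * t * pd i (pd j f) z"
proof -
  let ?e = "\<lambda>k. axis k (1::real) :: real ^ 'n"
  \<comment> \<open>Two coordinate steps of length at most \<open>t\<close> end within distance
    \<open>2 * t\<close> of \<open>x\<close>, hence inside the ball where \<open>f\<close> is of
    class C^2; the radius \<open>3 * t\<close> leaves room for a strict inequality.\<close>
  have near: "norm (a *\<^sub>R ?e i + b *\<^sub>R ?e j) < 3 * t \<and> x + b *\<^sub>R ?e j + a *\<^sub>R ?e i \<in> ball x r"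
    if "0 \<le> a" "a \<le> t" "0 \<le> b" "b \<le> t" for a b
  proof -
    have "norm (a *\<^sub>R ?e i + b *\<^sub>R ?e j) \<le> 2 * t"
      using norm_triangle_ineq[of "a *\<^sub>R ?e i" "b *\<^sub>R ?e j"] that by simp
    then show ?thesis
      using t by (simp add: dist_norm norm_minus_commute add.commute add.left_commute)
  qed
  have d: "f differentiable (at y)" "pd j f differentiable (at y)" if "y \<in> ball x r" for y
    using f that by (auto simp: numeral_2_eq_2)
  \<comment> \<open>The second difference is \<open>u t - u 0\<close>; the mean value theorem is
    applied to it in direction \<open>j\<close> and then to the result in direction
    \<open>i\<close>.\<close>
  define u where "u b = f (x + t *\<^sub>R ?e i + b *\<^sub>R ?e j) - f (x + b *\<^sub>R ?e j)" for b
  have "\<exists>b>0. b < t \<and> u t - u 0 = (t - 0) *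
      (pd j f (x + t *\<^sub>R ?e i + b *\<^sub>R ?e j) - pd j f (x + b *\<^sub>R ?e j))"
  proof (rule MVT2[OF t(1)])
    fix b assume "0 \<le> b" "b \<le> t"
    then show "(u has_real_derivative pd j f (x + t *\<^sub>R ?e i + b *\<^sub>R ?e j) - pd j f (x + b *\<^sub>R ?e j)) (at b)"
      unfolding u_def using near[of t b] near[of 0 b] t
      by (intro derivative_intros pd_line d) (auto simp: add.commute add.left_commute)
  qed
  then obtain b where b: "0 < b" "b < t" and ub: "u t - u 0 = t *
      (pd j f (x + b *\<^sub>R ?e j + t *\<^sub>R ?e i) - pd j f (x + b *\<^sub>R ?e j + 0 *\<^sub>R ?e i))"
    by (auto simp: add.commute add.left_commute)
  have "\<exists>a>0. a < t \<and> pd j f (x + b *\<^sub>R ?e j + t *\<^sub>R ?e i) - pd j f (x + b *\<^sub>R ?e j + 0 *\<^sub>R ?e i)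
      = (t - 0) * pd i (pd j f) (x + b *\<^sub>R ?e j + a *\<^sub>R ?e i)"
  proof (rule MVT2[OF t(1)])
    fix a assume "0 \<le> a" "a \<le> t"
    then show "((\<lambda>a. pd j f (x + b *\<^sub>R ?e j + a *\<^sub>R ?e i)) has_real_derivative
        pd i (pd j f) (x + b *\<^sub>R ?e j + a *\<^sub>R ?e i)) (at a)"
      using near[of a b] b by (intro pd_line d) auto
  qed
  then obtain a where "0 < a" "a < t" "u t - u 0 = t * t * pd i (pd j f) (x + b *\<^sub>R ?e j + a *\<^sub>R ?e i)"
    using ub by auto
  moreover have "x + b *\<^sub>R ?e j + a *\<^sub>R ?e i \<in> ball x (3 * t)"
    using near[of a b] b \<open>0 < a\<close> \<open>a < t\<close> by (simp add: dist_norm norm_minus_commute add.commute)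
  ultimately show ?thesis
    unfolding u_def by (intro bexI[of _ "x + b *\<^sub>R ?e j + a *\<^sub>R ?e i"]) simp_all
qed

lemma pd_commute:
  fixes f :: "real ^ 'n::finite \<Rightarrow> real"
  assumes S: "open S" "x \<in> S" and f: "ck 2 S f"
  shows "pd i (pd j f) x = pd j (pd i f) x"
proof (rule ccontr)
  assume ne: "pd i (pd j f) x \<noteq> pd j (pd i f) x"
  \<comment> \<open>Half the gap: the two mixed derivatives take equal values at points near
    \<open>x\<close> where each is less than \<open>e\<close> away from its value at
    \<open>x\<close>, which contradicts the triangle inequality.\<close>
  define e where "e = \<bar>pd i (pd j f) x - pd j (pd i f) x\<bar> / 2"
  have "e > 0" using ne by (simp add: e_def)
  obtain r where r: "r > 0" "ball x r \<subseteq> S" using S open_contains_ball by blast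
  have fr: "ck 2 (ball x r) f" using f r(2) ck_subset by blast
  have "continuous_on S (pd k (pd l f))" for k l
    using f by (simp add: numeral_2_eq_2)
  then have "isCont (pd k (pd l f)) x" for k l
    using S continuous_on_eq_continuous_at by blast
  then obtain d1 d2 where d: "d1 > 0" "\<And>y. dist y x < d1 \<Longrightarrow> dist (pd i (pd j f) y) (pd i (pd j f) x) < e"
    "d2 > 0" "\<And>y. dist y x < d2 \<Longrightarrow> dist (pd j (pd i f) y) (pd j (pd i f) x) < e"
    using \<open>e > 0\<close> unfolding continuous_at_eps_delta by meson
  define t where "t = min r (min d1 d2) / 4"
  have t: "0 < t" "2 * t < r" "3 * t < d1" "3 * t < d2"
    using r d by (auto simp: t_def)
  obtain z where z: "z \<in> ball x (3 * t)"
    "f (x + t *\<^sub>R axis i 1 + t *\<^sub>R axis j 1) - f (x + t *\<^sub>R axis i 1) - f (x + t *\<^sub>R axis j 1) + f x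
    = t * t * pd i (pd j f) z"
    using second_difference_mean_value[OF fr t(1,2)] by blast
  obtain w where w: "w \<in> ball x (3 * t)"
    "f (x + t *\<^sub>R axis j 1 + t *\<^sub>R axis i 1) - f (x + t *\<^sub>R axis j 1) - f (x + t *\<^sub>R axis i 1) + f x
    = t * t * pd j (pd i f) w"
    using second_difference_mean_value[OF fr t(1,2)] by blast
  have "t * t * pd i (pd j f) z = t * t * pd j (pd i f) w"
    using z(2) w(2) by (simp add: algebra_simps)
  then have "pd i (pd j f) z = pd j (pd i f) w" using t(1) by simp
  moreover have "dist (pd i (pd j f) z) (pd i (pd j f) x) < e" "dist (pd j (pd i f) w) (pd j (pd i f) x) < e"
    using z(1) w(1) t d(2)[of z] d(4)[of w] by (simp_all add: dist_commute[of x])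
  ultimately show False
    unfolding e_def dist_real_def by (auto simp: abs_if split: if_splits)
qed

section \<open>Positive definite matrices and the derivative of the determinant\<close>

lemma posdef_det_nonzero:
  fixes M :: "real ^ 'k ^ 'k::finite"
  assumes "\<And>v. v \<noteq> 0 \<Longrightarrow> v \<bullet> (M *v v) > 0"
  shows "det M \<noteq> 0"
proof
  assume "det M = 0"
  then have "\<not> invertible M" by (simp add: invertible_det_nz)
  then obtain v where "v \<noteq> 0" "M *v v = 0"
    using matrix_left_invertible_ker[of M] invertible_left_inverse by blast
  then show False using assms[of v] by simp
qed

text \<open>On the segment from the identity to \<open>M\<close> all matrices are positive definite,
  so the determinant cannot change sign there.\<close>

lemma posdef_det_pos:
  fixes M :: "real ^ 'k ^ 'k::finite"
  assumes M: "\<And>v. v \<noteq> 0 \<Longrightarrow> v \<bullet> (M *v v) > 0"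
  shows "det M > 0"
proof (rule ccontr)
  assume "\<not> det M > 0"
  define p where "p t = t *\<^sub>R M + (1 - t) *\<^sub>R (mat 1 :: real ^ 'k ^ 'k)" for t :: real
  have "continuous_on {0..1} (\<lambda>t. det (p t))"
    unfolding p_def det_def by (auto intro!: continuous_intros)
  moreover have "det (p 0) > 0" "det (p 1) \<le> 0"
    using \<open>\<not> det M > 0\<close> by (auto simp: p_def)
  ultimately obtain t where t: "0 \<le> t" "t \<le> 1" "det (p t) = 0"
    using IVT2'[of "\<lambda>t. det (p t)" 1 0 0] by auto
  have "v \<bullet> (p t *v v) > 0" if "v \<noteq> 0" for v
  proof -
    have "v \<bullet> (p t *v v) = t * (v \<bullet> (M *v v)) + (1 - t) * (v \<bullet> v)"
      by (simp add: p_def matrix_vector_mult_add_rdistrib inner_add_right scaleR_matrix_vector_assoc[symmetric])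
    moreover have "t * (v \<bullet> (M *v v)) \<ge> 0" "(1 - t) * (v \<bullet> v) \<ge> 0"
      using t M[OF that] by auto
    moreover have "t * (v \<bullet> (M *v v)) > 0 \<or> (1 - t) * (v \<bullet> v) > 0"
      using t M[OF that] that by (cases "t = 0") auto
    ultimately show ?thesis by linarith
  qed
  then show False using posdef_det_nonzero[of "p t"] t by blast
qed

lemma has_derivative_det_mat_1:
  "(det has_derivative (\<lambda>D :: real ^ 'k ^ 'k::finite. \<Sum>i\<in>UNIV. D $ i $ i)) (at (mat 1))"
proof -
  let ?P = "{p. p permutes (UNIV :: 'k set)}"
  let ?q = "\<lambda>p i. \<Prod>j\<in>UNIV - {i}. (mat 1 :: real ^ 'k ^ 'k) $ j $ p j"
  have "(det has_derivative (\<lambda>D :: real ^ 'k ^ 'k. \<Sum>p\<in>?P. of_int (sign p) * (\<Sum>i\<in>UNIV. D $ i $ p i * ?q p i)))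
      (at (mat 1))"
    unfolding det_def
    by (intro has_derivative_sum has_derivative_mult_right has_derivative_prod bounded_linear_imp_has_derivative
        bounded_linear_compose[OF bounded_linear_vec_nth bounded_linear_vec_nth])
  moreover have "(\<Sum>p\<in>?P. of_int (sign p) * (\<Sum>i\<in>UNIV. D $ i $ p i * ?q p i)) = (\<Sum>i\<in>UNIV. D $ i $ i)"
    for D :: "real ^ 'k ^ 'k"
  proof -
    \<comment> \<open>A permutation that fixes all points but one fixes that one too. So for
      \<open>p \<noteq> id\<close>, whichever factor is deleted, a zero entry of the identity matrix
      remains in the product.\<close>
    have q0: "?q p i = 0" if p: "p \<in> ?P" "p \<noteq> id" for p i
    proof (rule ccontr)
      assume "?q p i \<noteq> 0"
      then have "\<forall>j\<in>UNIV - {i}. (mat 1 :: real ^ 'k ^ 'k) $ j $ p j \<noteq> 0"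
        by (simp add: prod_zero_iff)
      then have fixed: "p j = j" if "j \<noteq> i" for j
        using that by (force simp: mat_def split: if_splits)
      moreover have "p i = i"
        using fixed permutes_inj[of p UNIV] p by (metis injD mem_Collect_eq)
      ultimately show False using p by (metis eq_id_iff)
    qed
    have "(\<Sum>p\<in>?P. of_int (sign p) * (\<Sum>i\<in>UNIV. D $ i $ p i * ?q p i))
        = (\<Sum>p\<in>?P. if p = id then \<Sum>i\<in>UNIV. D $ i $ i else 0)"
    proof (intro sum.cong refl)
      fix p assume p: "p \<in> ?P"
      show "of_int (sign p) * (\<Sum>i\<in>UNIV. D $ i $ p i * ?q p i) = (if p = id then \<Sum>i\<in>UNIV. D $ i $ i else 0)"
      proof (cases "p = id")
        case True
        then show ?thesis by (simp add: mat_def)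
      next
        case False
        then have "?q p i = 0" for i using q0 p by blast
        then show ?thesis using False by (simp only: mult_zero_right sum.neutral_const if_False)
      qed
    qed
    then show ?thesis
      by (simp add: permutes_id)
  qed
  ultimately show ?thesis by simp
qed

text \<open>Jacobi's formula. Factoring out \<open>det (G x)\<close> leaves the determinant of a
  matrix that is the identity at \<open>x\<close>, where the derivative is the trace.\<close>

lemma pd_det:
  fixes G :: "real ^ 'n::finite \<Rightarrow> real ^ 'k ^ 'k::finite"
  assumes G: "G differentiable (at x)" and nz: "det (G x) \<noteq> 0"
  shows "pd k (\<lambda>y. det (G y)) x =
    det (G x) * (\<Sum>a\<in>UNIV. \<Sum>b\<in>UNIV. matrix_inv (G x) $ a $ b * pd k (\<lambda>y. G y $ b $ a) x)"
proof -
  let ?H = "matrix_inv (G x)" and ?D = "frechet_derivative G (at x)"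
  have inv: "G x ** ?H = mat 1" "?H ** G x = mat 1"
    using matrix_inv_inverse[OF nz] by auto
  have eq: "det (G y) = det (G x) * det (?H ** G y)" for y
  proof -
    have "det (G x) * det ?H = 1" by (metis det_mul inv(1) det_I)
    then show ?thesis by (simp add: det_mul mult.assoc[symmetric])
  qed
  have "bounded_linear (\<lambda>M. ?H ** M)"
    unfolding matrix_matrix_mult_def
    by (intro linear_conv_bounded_linear[THEN iffD1] linearI) 
       (auto simp: vec_eq_iff algebra_simps sum.distrib sum_distrib_left)
  then have "((\<lambda>y. ?H ** G y) has_derivative (\<lambda>h. ?H ** ?D h)) (at x)"
    using bounded_linear.has_derivative frechet_works[OF G] by blast
  then have "((\<lambda>y. det (?H ** G y)) has_derivative (\<lambda>h. \<Sum>a\<in>UNIV. (?H ** ?D h) $ a $ a)) (at x)"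
    by (rule has_derivative_compose) (simp add: inv(2) has_derivative_det_mat_1)
  then have "((\<lambda>y. det (G x) * det (?H ** G y)) has_derivative
      (\<lambda>h. det (G x) * (\<Sum>a\<in>UNIV. (?H ** ?D h) $ a $ a))) (at x)"
    by (rule has_derivative_mult_right)
  then have "pd k (\<lambda>y. det (G y)) x = det (G x) * (\<Sum>a\<in>UNIV. (?H ** ?D (axis k 1)) $ a $ a)"
    unfolding eq[symmetric] by (rule pd_has_derivative)
  moreover have "?D (axis k 1) $ b $ a = pd k (\<lambda>y. G y $ b $ a) x" for a b
  proof -
    have "(\<lambda>y. G y $ b) differentiable (at x)"
      using G bounded_linear.has_derivative[OF bounded_linear_vec_nth] unfolding differentiable_def by blast
    then show ?thesis
      using pd_component[OF G] pd_component[of "\<lambda>y. G y $ b" x k a] by (simp add: pd_def)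
  qed
  ultimately show ?thesis by (simp add: matrix_matrix_mult_def)
qed

section \<open>Metrics in a chart\<close>

lemma differentiable_sumI:
  "(\<And>a. a \<in> I \<Longrightarrow> f a differentiable F) \<Longrightarrow> (\<lambda>x. \<Sum>a\<in>I. f a x) differentiable F"
  by (induction I rule: infinite_finite_induct) auto

lemma transpose_nth: "transpose M $ a $ b = M $ b $ a"
  by (simp add: transpose_def)

lemma sum_rotate3:
  "(\<Sum>k\<in>K. \<Sum>a\<in>A. \<Sum>b\<in>B. f k a b) = (\<Sum>a\<in>A. \<Sum>b\<in>B. \<Sum>k\<in>K. f k a b)"
proof -
  have "(\<Sum>k\<in>K. \<Sum>a\<in>A. \<Sum>b\<in>B. f k a b) = (\<Sum>a\<in>A. \<Sum>k\<in>K. \<Sum>b\<in>B. f k a b)"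
    by (rule sum.swap)
  also have "\<dots> = (\<Sum>a\<in>A. \<Sum>b\<in>B. \<Sum>k\<in>K. f k a b)"
    by (intro sum.cong refl sum.swap)
  finally show ?thesis .
qed

text \<open>\<open>G\<close> is constrained on \<open>S\<close> only: identities hold at points of
  \<open>S\<close>, and they may be differentiated because \<open>S\<close> is open.\<close>

locale metric_chart =
  fixes S :: "(real ^ 'n::finite) set" and G :: "real ^ 'n \<Rightarrow> real ^ 'n ^ 'n"
  assumes S_open: "open S" and G_smooth: "smooth_on S G"
    and G_transpose: "\<And>x. x \<in> S \<Longrightarrow> transpose (G x) = G x"
    and G_posdef: "\<And>x v. x \<in> S \<Longrightarrow> v \<noteq> 0 \<Longrightarrow> v \<bullet> (G x *v v) > 0"
begin

abbreviation H :: "real ^ 'n \<Rightarrow> 'n \<Rightarrow> 'n \<Rightarrow> real" where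
  "H x a b \<equiv> matrix_inv (G x) $ a $ b"

abbreviation Gam :: "real ^ 'n \<Rightarrow> 'n \<Rightarrow> 'n \<Rightarrow> 'n \<Rightarrow> real" where
  "Gam x m i j \<equiv> christoffel G m i j x"

lemma det_pos: "x \<in> S \<Longrightarrow> det (G x) > 0"
  using posdef_det_pos G_posdef by blast

lemma G_comp_smooth [smooth]: "smooth_on S (\<lambda>x. G x $ i $ j)"
  by (intro smooth S_open G_smooth)

lemma H_smooth [smooth]: "smooth_on S (\<lambda>x. H x a b)"
  by (rule smooth_on_matrix_inv[OF S_open G_comp_smooth]) (use det_pos in force)

lemma GH: "x \<in> S \<Longrightarrow> G x ** matrix_inv (G x) = mat 1" and HG: "x \<in> S \<Longrightarrow> matrix_inv (G x) ** G x = mat 1"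
  using det_pos[of x] matrix_inv_inverse[of "G x"] by auto

lemma G_sym: "x \<in> S \<Longrightarrow> G x $ a $ b = G x $ b $ a"
  using transpose_nth[of "G x" b a] by (simp add: G_transpose)

lemma H_sym: assumes "x \<in> S" shows "H x a b = H x b a"
proof -
  let ?H = "matrix_inv (G x)"
  have "transpose ?H ** G x = mat 1"
    using arg_cong[OF GH[OF assms], of transpose] by (simp add: matrix_transpose_mul G_transpose[OF assms])
  then have "transpose ?H ** (G x ** ?H) = ?H"
    by (simp add: matrix_mul_assoc)
  then show ?thesis
    using transpose_nth[of ?H b a] by (simp add: GH[OF assms])
qed

lemma sum_HG: assumes "x \<in> S" shows "(\<Sum>b\<in>UNIV. H x a b * G x $ b $ c) = (if a = c then 1 else 0)"
proof -
  have "(matrix_inv (G x) ** G x) $ a $ c = (if a = c then 1 else 0)"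
    using HG[OF assms] by (simp add: mat_def)
  then show ?thesis by (simp add: matrix_matrix_mult_def)
qed

lemma sum_GH: assumes "x \<in> S" shows "(\<Sum>b\<in>UNIV. G x $ a $ b * H x b c) = (if a = c then 1 else 0)"
proof -
  have "(G x ** matrix_inv (G x)) $ a $ c = (if a = c then 1 else 0)"
    using GH[OF assms] by (simp add: mat_def)
  then show ?thesis by (simp add: matrix_matrix_mult_def)
qed

text \<open>Lowering and then raising an index. The nested sums are the shape that contractions with
  the inverse metric produce, so the equation works as a rewrite rule.\<close>

lemma H_G_cancel: assumes "x \<in> S" shows "(\<Sum>b\<in>UNIV. H x a b * (\<Sum>c\<in>UNIV. G x $ b $ c * e c)) = e a"
proof -
  have "(\<Sum>b\<in>UNIV. H x a b * (\<Sum>c\<in>UNIV. G x $ b $ c * e c))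
      = (\<Sum>c\<in>UNIV. (\<Sum>b\<in>UNIV. H x a b * G x $ b $ c) * e c)"
    by (simp add: sum_distrib_left sum_distrib_right mult.assoc) (rule sum.swap)
  then show ?thesis by (simp add: sum_HG[OF assms] if_distrib[of "\<lambda>t. t * _"] cong: if_cong)
qed

lemma G_H_cancel: assumes "x \<in> S" shows "(\<Sum>b\<in>UNIV. G x $ a $ b * (\<Sum>c\<in>UNIV. H x b c * e c)) = e a"
proof -
  have "(\<Sum>b\<in>UNIV. G x $ a $ b * (\<Sum>c\<in>UNIV. H x b c * e c))
      = (\<Sum>c\<in>UNIV. (\<Sum>b\<in>UNIV. G x $ a $ b * H x b c) * e c)"
    by (simp add: sum_distrib_left sum_distrib_right mult.assoc) (rule sum.swap)
  then show ?thesis by (simp add: sum_GH[OF assms] if_distrib[of "\<lambda>t. t * _"] cong: if_cong)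
qed

lemma pd_G_sym: "x \<in> S \<Longrightarrow> pd k (\<lambda>y. G y $ a $ b) x = pd k (\<lambda>y. G y $ b $ a) x"
  by (rule pd_cong_open[OF S_open]) (auto simp: G_sym)

lemma Gam_sym: "x \<in> S \<Longrightarrow> Gam x m i j = Gam x m j i"
  by (simp add: christoffel_def pd_G_sym[of x _ i j] add.commute[of "pd i _ _"])

lemma Gam_smooth [smooth]: "smooth_on S (christoffel G m i j)"
  unfolding christoffel_def[abs_def] by (intro smooth S_open)

lemma lower_Gam:
  assumes "x \<in> S"
  shows "(\<Sum>m\<in>UNIV. G x $ c $ m * Gam x m i j)
    = (1/2) * (pd i (\<lambda>y. G y $ j $ c) x + pd j (\<lambda>y. G y $ i $ c) x - pd c (\<lambda>y. G y $ i $ j) x)"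
proof -
  have "(\<Sum>m\<in>UNIV. G x $ c $ m * Gam x m i j) = (\<Sum>m\<in>UNIV. G x $ c $ m * (\<Sum>l\<in>UNIV. H x m l * ((1/2) *
     (pd i (\<lambda>y. G y $ j $ l) x + pd j (\<lambda>y. G y $ i $ l) x - pd l (\<lambda>y. G y $ i $ j) x))))"
    by (simp add: christoffel_def sum_distrib_left mult.left_commute)
  then show ?thesis by (simp only: G_H_cancel[OF assms])
qed

text \<open>Metric compatibility of the Levi-Civita connection: in the sum of the two symbols of the
  first kind given by \<open>lower_Gam\<close>, all derivatives cancel except the one along
  \<open>k\<close>.\<close>

lemma pd_G:
  assumes "x \<in> S"
  shows "pd k (\<lambda>y. G y $ a $ b) x = (\<Sum>m\<in>UNIV. G x $ a $ m * Gam x m k b) + (\<Sum>m\<in>UNIV. G x $ b $ m * Gam x m k a)"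
  unfolding lower_Gam[OF assms] pd_G_sym[OF assms, of _ b a] by (simp add: field_simps)

lemma H_diff: "x \<in> S \<Longrightarrow> (\<lambda>y. H y a b) differentiable (at x)"
  using H_smooth smooth_on_differentiable by blast

lemma G_diff: "x \<in> S \<Longrightarrow> (\<lambda>y. G y $ a $ b) differentiable (at x)"
  using G_comp_smooth smooth_on_differentiable by blast

text \<open>Differentiating \<open>sum_HG\<close> determines the product of the unknown derivative
  \<open>D\<close> with the metric (\<open>DG\<close>). The claimed value \<open>K\<close> has the
  same product (\<open>KG\<close>), and the metric can be cancelled.\<close>

lemma pd_H:
  assumes x: "x \<in> S"
  shows "pd k (\<lambda>y. H y a b) x = - (\<Sum>c\<in>UNIV. H x a c * Gam x b k c) - (\<Sum>c\<in>UNIV. H x b c * Gam x a k c)"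
proof -
  define K where "K b = - (\<Sum>c\<in>UNIV. H x a c * Gam x b k c) - (\<Sum>c\<in>UNIV. H x b c * Gam x a k c)" for b
  define D where "D b = pd k (\<lambda>y. H y a b) x" for b
  have DG: "(\<Sum>b\<in>UNIV. D b * G x $ b $ c) = - Gam x a k c - (\<Sum>b\<in>UNIV. H x a b * (\<Sum>m\<in>UNIV. G x $ c $ m * Gam x m k b))" for c
  proof -
    have "pd k (\<lambda>y. \<Sum>b\<in>UNIV. H y a b * G y $ b $ c) x = pd k (\<lambda>y. if a = c then 1 else 0 :: real) x"
      by (rule pd_cong_open[OF S_open x]) (rule sum_HG)
    then have "0 = pd k (\<lambda>y. \<Sum>b\<in>UNIV. H y a b * G y $ b $ c) x"
      by (simp add: pd_const)
    also have "\<dots> = (\<Sum>b\<in>UNIV. pd k (\<lambda>y. H y a b * G y $ b $ c) x)"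
      by (intro pd_sum differentiable_mult H_diff G_diff x)
    also have "\<dots> = (\<Sum>b\<in>UNIV. D b * G x $ b $ c + H x a b * pd k (\<lambda>y. G y $ b $ c) x)"
      by (simp add: pd_mult H_diff G_diff x D_def)
    also have "\<dots> = (\<Sum>b\<in>UNIV. D b * G x $ b $ c) + (\<Sum>b\<in>UNIV. H x a b * (\<Sum>m\<in>UNIV. G x $ b $ m * Gam x m k c))
        + (\<Sum>b\<in>UNIV. H x a b * (\<Sum>m\<in>UNIV. G x $ c $ m * Gam x m k b))"
      by (simp add: pd_G[OF x] sum.distrib distrib_left)
    finally show ?thesis by (simp add: H_G_cancel[OF x])
  qed
  have KG: "(\<Sum>b\<in>UNIV. K b * G x $ b $ c) = - Gam x a k c - (\<Sum>b\<in>UNIV. H x a b * (\<Sum>m\<in>UNIV. G x $ c $ m * Gam x m k b))" for c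
  proof -
    have "(\<Sum>b\<in>UNIV. (\<Sum>d\<in>UNIV. H x b d * Gam x a k d) * G x $ b $ c)
        = (\<Sum>b\<in>UNIV. G x $ c $ b * (\<Sum>d\<in>UNIV. H x b d * Gam x a k d))"
      by (simp add: G_sym[OF x, of c] mult.commute)
    also have "\<dots> = Gam x a k c" by (rule G_H_cancel[OF x])
    finally have 1: "(\<Sum>b\<in>UNIV. (\<Sum>d\<in>UNIV. H x b d * Gam x a k d) * G x $ b $ c) = Gam x a k c" .
    have 2: "(\<Sum>b\<in>UNIV. (\<Sum>d\<in>UNIV. H x a d * Gam x b k d) * G x $ b $ c)
        = (\<Sum>d\<in>UNIV. H x a d * (\<Sum>m\<in>UNIV. G x $ c $ m * Gam x m k d))"
      by (simp add: sum_distrib_left sum_distrib_right G_sym[OF x, of c] mult.assoc mult.commute[of "christoffel _ _ _ _ _"])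
        (rule sum.swap)
    show ?thesis unfolding K_def by (simp add: left_diff_distrib sum_subtractf sum_negf 1 2)
  qed
  have "D b = K b" for b
  proof -
    have "(\<Sum>c\<in>UNIV. H x b c * (\<Sum>d\<in>UNIV. G x $ c $ d * D d)) = (\<Sum>c\<in>UNIV. H x b c * (\<Sum>d\<in>UNIV. G x $ c $ d * K d))"
      using DG KG by (simp add: G_sym[OF x] mult.commute)
    then show ?thesis by (simp add: H_G_cancel[OF x])
  qed
  then show ?thesis by (simp add: D_def K_def)
qed

text \<open>Both Christoffel sums of \<open>pd_G\<close> contribute the same contraction to Jacobi's
  formula; the resulting factor 2 cancels the one from differentiating the square root.\<close>

lemma pd_sqrt_det:
  assumes x: "x \<in> S"
  shows "pd k (\<lambda>y. sqrt (det (G y))) x = sqrt (det (G x)) * (\<Sum>l\<in>UNIV. Gam x l k l)"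
proof -
  have Gd: "G differentiable (at x)"
    using G_smooth x smooth_on_differentiable by blast
  have dd: "(\<lambda>y. det (G y)) differentiable (at x)"
    using smooth_on_det[OF S_open G_comp_smooth] x smooth_on_differentiable by blast
  have 1: "(\<Sum>a\<in>UNIV. \<Sum>b\<in>UNIV. H x a b * (\<Sum>m\<in>UNIV. G x $ b $ m * Gam x m k a)) = (\<Sum>a\<in>UNIV. Gam x a k a)"
    by (simp add: H_G_cancel[OF x])
  have "(\<Sum>a\<in>UNIV. \<Sum>b\<in>UNIV. H x a b * (\<Sum>m\<in>UNIV. G x $ a $ m * Gam x m k b))
      = (\<Sum>b\<in>UNIV. \<Sum>a\<in>UNIV. H x b a * (\<Sum>m\<in>UNIV. G x $ a $ m * Gam x m k b))"
    by (subst sum.swap) (simp add: H_sym[OF x])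
  also have "\<dots> = (\<Sum>a\<in>UNIV. Gam x a k a)"
    by (simp add: H_G_cancel[OF x])
  finally have 2: "(\<Sum>a\<in>UNIV. \<Sum>b\<in>UNIV. H x a b * (\<Sum>m\<in>UNIV. G x $ a $ m * Gam x m k b)) = (\<Sum>a\<in>UNIV. Gam x a k a)" .
  have "pd k (\<lambda>y. det (G y)) x = det (G x) * (2 * (\<Sum>l\<in>UNIV. Gam x l k l))"
    using det_pos[OF x]
    by (subst pd_det[OF Gd]) (auto simp: pd_G[OF x] distrib_left sum.distrib 1 2)
  moreover have "((\<lambda>y. sqrt (det (G y))) has_derivative
      (\<lambda>h. inverse (sqrt (det (G x))) / 2 * frechet_derivative (\<lambda>y. det (G y)) (at x) h)) (at x)"
    using has_derivative_compose[OF dd[unfolded frechet_derivative_works]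
        DERIV_real_sqrt[OF det_pos[OF x], unfolded has_field_derivative_def]]
    by simp
  then have "pd k (\<lambda>y. sqrt (det (G y))) x = inverse (sqrt (det (G x))) / 2 * pd k (\<lambda>y. det (G y)) x"
    using pd_has_derivative by (fastforce simp: pd_def)
  ultimately have "sqrt (det (G x)) * pd k (\<lambda>y. sqrt (det (G y))) x = det (G x) * (\<Sum>l\<in>UNIV. Gam x l k l)"
    using det_pos[OF x] by (simp add: field_simps)
  also have "\<dots> = sqrt (det (G x)) * (sqrt (det (G x)) * (\<Sum>l\<in>UNIV. Gam x l k l))"
    using det_pos[OF x] by (simp add: mult.assoc[symmetric])
  finally show ?thesis using det_pos[OF x] by simp
qed

text \<open>The \<open>m\<close>-th component of the covariant derivative of the vector field
  \<open>X\<close> in the direction of the \<open>k\<close>-th coordinate; its trace is div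
  X.\<close>

definition nab :: "(real ^ 'n \<Rightarrow> real ^ 'n) \<Rightarrow> real ^ 'n \<Rightarrow> 'n \<Rightarrow> 'n \<Rightarrow> real" where
  "nab X x k m = pd k (\<lambda>y. X y $ m) x + (\<Sum>l\<in>UNIV. Gam x m k l * X x $ l)"

lemma sqrt_det_diff: assumes "x \<in> S" shows "(\<lambda>y. sqrt (det (G y))) differentiable (at x)"
proof -
  have "ck (Suc 0) S (\<lambda>y. sqrt (det (G y)))"
    by (intro ck_sqrt S_open smooth_on_imp_ck[OF smooth_on_det] G_comp_smooth det_pos)
  then show ?thesis using assms ck_differentiable by blast
qed

text \<open>The Voss-Weyl formula: the derivative of the density supplies the contracted Christoffel
  symbol. It lets the divergence theorem in a chart be reduced to partial derivatives on Euclidean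
  space.\<close>

lemma coordinate_divergence:
  assumes x: "x \<in> S" and X: "\<And>k. (\<lambda>y. X y $ k) differentiable (at x)"
  shows "(\<Sum>k\<in>UNIV. pd k (\<lambda>y. sqrt (det (G y)) * X y $ k) x) = sqrt (det (G x)) * (\<Sum>k\<in>UNIV. nab X x k k)"
proof -
  have "(\<Sum>k\<in>UNIV. pd k (\<lambda>y. sqrt (det (G y)) * X y $ k) x)
      = sqrt (det (G x)) * ((\<Sum>k\<in>UNIV. (\<Sum>l\<in>UNIV. Gam x l k l) * X x $ k) + (\<Sum>k\<in>UNIV. pd k (\<lambda>y. X y $ k) x))"
    by (simp add: pd_mult sqrt_det_diff x X pd_sqrt_det sum.distrib[symmetric] mult.assoc distrib_left[symmetric]
        sum_distrib_left[symmetric])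
  moreover have "(\<Sum>k\<in>UNIV. (\<Sum>l\<in>UNIV. Gam x l k l) * X x $ k) = (\<Sum>k\<in>UNIV. \<Sum>l\<in>UNIV. Gam x k k l * X x $ l)"
    unfolding sum_distrib_right by (subst sum.swap) (simp add: Gam_sym[OF x])
  ultimately show ?thesis
    by (simp add: nab_def sum.distrib)
qed

text \<open>By \<open>pd_G\<close>, the derivative of the metric along \<open>V\<close> provides the
  Christoffel terms that complete the partial derivatives of \<open>V\<close> to covariant ones;
  matching them uses the symmetry of the connection.\<close>

lemma lie_metric_nab:
  assumes x: "x \<in> S"
  shows "lie_metric G V x i j = (\<Sum>m\<in>UNIV. G x $ j $ m * nab V x i m) + (\<Sum>m\<in>UNIV. G x $ i $ m * nab V x j m)"
proof -
  have *: "(\<Sum>m\<in>UNIV. G x $ j $ m * (\<Sum>l\<in>UNIV. Gam x m i l * V x $ l)) = (\<Sum>l\<in>UNIV. V x $ l * (\<Sum>m\<in>UNIV. G x $ j $ m * Gam x m l i))" for i j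
    unfolding sum_distrib_left by (subst sum.swap) (simp add: Gam_sym[OF x] mult.left_commute mult.commute)
  show ?thesis
    unfolding lie_metric_def nab_def
    by (simp add: sum.distrib distrib_left * pd_G[OF x] G_sym[OF x, of _ j])
qed

lemma trace_lie_metric:
  assumes x: "x \<in> S"
  shows "metric_trace (G x) (lie_metric G V x) = 2 * (\<Sum>k\<in>UNIV. nab V x k k)"
proof -
  have "(\<Sum>i\<in>UNIV. \<Sum>j\<in>UNIV. H x i j * (\<Sum>m\<in>UNIV. G x $ i $ m * nab V x j m))
     = (\<Sum>j\<in>UNIV. \<Sum>i\<in>UNIV. H x j i * (\<Sum>m\<in>UNIV. G x $ i $ m * nab V x j m))"
    by (subst sum.swap) (simp add: H_sym[OF x])
  then show ?thesis
    by (simp add: metric_trace_def lie_metric_nab[OF x] distrib_left sum.distrib H_G_cancel[OF x])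
qed

text \<open>The inner product <T, L> of bilinear forms induced by the metric: both indices of
  \<open>L\<close> are raised before contraction with \<open>T\<close>.\<close>

definition contract2 :: "real ^ 'n \<Rightarrow> ('n \<Rightarrow> 'n \<Rightarrow> real) \<Rightarrow> ('n \<Rightarrow> 'n \<Rightarrow> real) \<Rightarrow> real" where
  "contract2 x T L = (\<Sum>a\<in>UNIV. \<Sum>b\<in>UNIV. T a b * (\<Sum>i\<in>UNIV. H x a i * (\<Sum>j\<in>UNIV. H x b j * L i j)))"

text \<open>The two halves of the symmetrized covariant derivative in \<open>lie_metric_nab\<close>
  pair equally with a symmetric form, whence the factor 2.\<close>

lemma contract2_lie_metric:
  assumes x: "x \<in> S" and T: "\<And>a b. T a b = T b a"
  shows "contract2 x T (lie_metric G V x) = 2 * (\<Sum>k\<in>UNIV. \<Sum>l\<in>UNIV. H x k l * (\<Sum>m\<in>UNIV. T l m * nab V x k m))"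
proof -
  let ?N = "nab V x"
  have 1: "(\<Sum>i\<in>UNIV. H x a i * (\<Sum>j\<in>UNIV. H x b j * (\<Sum>m\<in>UNIV. G x $ j $ m * ?N i m))) = (\<Sum>i\<in>UNIV. H x a i * ?N i b)" for a b
    by (simp add: H_G_cancel[OF x])
  have "(\<Sum>i\<in>UNIV. H x a i * (\<Sum>j\<in>UNIV. H x b j * (\<Sum>m\<in>UNIV. G x $ i $ m * ?N j m)))
      = (\<Sum>j\<in>UNIV. H x b j * (\<Sum>i\<in>UNIV. H x a i * (\<Sum>m\<in>UNIV. G x $ i $ m * ?N j m)))" for a b
    by (simp add: sum_distrib_left[of "H x a _"] sum_distrib_left[of "H x b _"] mult.left_commute) (rule sum.swap)
  then have 2: "(\<Sum>i\<in>UNIV. H x a i * (\<Sum>j\<in>UNIV. H x b j * (\<Sum>m\<in>UNIV. G x $ i $ m * ?N j m))) = (\<Sum>j\<in>UNIV. H x b j * ?N j a)" for a b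
    by (simp add: H_G_cancel[OF x])
  have "contract2 x T (lie_metric G V x) = (\<Sum>a\<in>UNIV. \<Sum>b\<in>UNIV. T a b * (\<Sum>i\<in>UNIV. H x a i * ?N i b))
      + (\<Sum>a\<in>UNIV. \<Sum>b\<in>UNIV. T a b * (\<Sum>i\<in>UNIV. H x b i * ?N i a))"
    unfolding contract2_def lie_metric_nab[OF x]
    by (simp add: distrib_left sum.distrib 1 2)
  also have "(\<Sum>a\<in>UNIV. \<Sum>b\<in>UNIV. T a b * (\<Sum>i\<in>UNIV. H x b i * ?N i a)) = (\<Sum>a\<in>UNIV. \<Sum>b\<in>UNIV. T a b * (\<Sum>i\<in>UNIV. H x a i * ?N i b))"
    by (subst sum.swap) (simp add: T)
  also have "(\<Sum>a\<in>UNIV. \<Sum>b\<in>UNIV. T a b * (\<Sum>i\<in>UNIV. H x a i * ?N i b)) = (\<Sum>k\<in>UNIV. \<Sum>l\<in>UNIV. H x k l * (\<Sum>m\<in>UNIV. T l m * ?N k m))"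
    unfolding sum_distrib_left
    by (subst (2) sum_rotate3) (auto simp: H_sym[OF x] mult.left_commute intro!: sum.cong)
  finally show ?thesis by simp
qed

text \<open>Raising an index commutes with the connection, traced: of the two sums in
  \<open>pd_H\<close>, the second cancels the connection term of the vector field
  (\<open>2\<close>), and the first becomes the connection term of the covector \<open>U\<close>
  (\<open>1\<close>).\<close>

lemma nab_raise:
  assumes x: "x \<in> S" and U: "\<And>l. (\<lambda>y. U y l) differentiable (at x)"
  shows "(\<Sum>k\<in>UNIV. nab (\<lambda>y. \<chi> k. \<Sum>l\<in>UNIV. H y k l * U y l) x k k)
    = (\<Sum>k\<in>UNIV. \<Sum>l\<in>UNIV. H x k l * (pd k (\<lambda>y. U y l) x - (\<Sum>p\<in>UNIV. Gam x p k l * U x p)))"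
proof -
  have pdX: "pd k (\<lambda>y. \<Sum>l\<in>UNIV. H y k l * U y l) x
      = (\<Sum>l\<in>UNIV. pd k (\<lambda>y. H y k l) x * U x l) + (\<Sum>l\<in>UNIV. H x k l * pd k (\<lambda>y. U y l) x)" for k
    by (simp add: pd_sum pd_mult differentiable_mult H_diff x U sum.distrib)
  have 1: "(\<Sum>l\<in>UNIV. (\<Sum>c\<in>UNIV. H x k c * Gam x l k c) * U x l)
      = (\<Sum>l\<in>UNIV. H x k l * (\<Sum>p\<in>UNIV. Gam x p k l * U x p))" for k
    by (simp add: sum_distrib_left sum_distrib_right mult.assoc) (rule sum.swap)
  have 2: "(\<Sum>l\<in>UNIV. (\<Sum>c\<in>UNIV. H x l c * Gam x k k c) * U x l)
      = (\<Sum>l\<in>UNIV. Gam x k k l * (\<Sum>p\<in>UNIV. H x l p * U x p))" for k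
    unfolding sum_distrib_left sum_distrib_right
    by (subst sum.swap) (simp add: H_sym[OF x] mult.commute mult.left_commute)
  show ?thesis
    unfolding nab_def
    by (simp add: pdX pd_H[OF x] left_diff_distrib right_diff_distrib sum_subtractf sum_negf sum.distrib 1 2)
qed

text \<open>\<open>div (T(V)) = (div T)(V) + (1/2) <T, L_V g>\<close> for symmetric \<open>T\<close>.\<close>

lemma divergence_contracted:
  assumes x: "x \<in> S" and T: "\<And>l m. (\<lambda>y. T y l m) differentiable (at x)" and sym: "\<And>l m. T x l m = T x m l"
    and V: "\<And>m. (\<lambda>y. V y $ m) differentiable (at x)"
  shows "(\<Sum>k\<in>UNIV. pd k (\<lambda>y. sqrt (det (G y)) * (\<chi> k. \<Sum>l\<in>UNIV. H y k l * (\<Sum>m\<in>UNIV. T y l m * V y $ m)) $ k) x)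
    = sqrt (det (G x)) * ((\<Sum>m\<in>UNIV. divergence G T x m * V x $ m) + (1/2) * contract2 x (T x) (lie_metric G V x))"
proof -
  let ?U = "\<lambda>y l. \<Sum>m\<in>UNIV. T y l m * V y $ m"
  have U: "(\<lambda>y. ?U y l) differentiable (at x)" for l
    by (intro differentiable_sumI differentiable_mult T V)
  have cov: "cov G (tensor2 T) x [k, l, m]
      = pd k (\<lambda>y. T y l m) x - (\<Sum>p\<in>UNIV. Gam x p k l * T x p m) - (\<Sum>p\<in>UNIV. Gam x p k m * T x l p)" for k l m
    by (simp add: cov_def tensor2_def)
  \<comment> \<open>The Leibniz rule for the contraction of \<open>T\<close> with \<open>V\<close>:
    the connection term of \<open>T\<close> in its second slot cancels that of \<open>V\<close>, as
    \<open>2\<close> shows.\<close>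
  have "pd k (\<lambda>y. ?U y l) x - (\<Sum>p\<in>UNIV. Gam x p k l * ?U x p)
      = (\<Sum>m\<in>UNIV. cov G (tensor2 T) x [k, l, m] * V x $ m) + (\<Sum>m\<in>UNIV. T x l m * nab V x k m)" for k l
  proof -
    have 1: "(\<Sum>p\<in>UNIV. Gam x p k l * ?U x p) = (\<Sum>m\<in>UNIV. (\<Sum>p\<in>UNIV. Gam x p k l * T x p m) * V x $ m)"
      by (simp add: sum_distrib_left sum_distrib_right mult.assoc) (rule sum.swap)
    have 2: "(\<Sum>m\<in>UNIV. (\<Sum>p\<in>UNIV. Gam x p k m * T x l p) * V x $ m) = (\<Sum>m\<in>UNIV. T x l m * (\<Sum>p\<in>UNIV. Gam x m k p * V x $ p))"
      unfolding sum_distrib_left sum_distrib_right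
      by (subst sum.swap) (simp add: Gam_sym[OF x] mult.commute mult.left_commute)
    show ?thesis
      unfolding cov nab_def
      by (simp add: pd_sum pd_mult differentiable_mult T V left_diff_distrib distrib_left sum_subtractf sum.distrib 1 2)
  qed
  then have "(\<Sum>k\<in>UNIV. nab (\<lambda>y. \<chi> k. \<Sum>l\<in>UNIV. H y k l * ?U y l) x k k)
      = (\<Sum>k\<in>UNIV. \<Sum>l\<in>UNIV. H x k l * (\<Sum>m\<in>UNIV. cov G (tensor2 T) x [k, l, m] * V x $ m))
      + (\<Sum>k\<in>UNIV. \<Sum>l\<in>UNIV. H x k l * (\<Sum>m\<in>UNIV. T x l m * nab V x k m))"
    by (simp add: nab_raise[OF x U] distrib_left sum.distrib)
  also have "(\<Sum>k\<in>UNIV. \<Sum>l\<in>UNIV. H x k l * (\<Sum>m\<in>UNIV. cov G (tensor2 T) x [k, l, m] * V x $ m))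
      = (\<Sum>m\<in>UNIV. divergence G T x m * V x $ m)"
    unfolding divergence_def metric_trace_def sum_distrib_left sum_distrib_right
    by (subst (2) sum_rotate3) (simp add: mult.assoc)
  finally have nabX: "(\<Sum>k\<in>UNIV. nab (\<lambda>y. \<chi> k. \<Sum>l\<in>UNIV. H y k l * ?U y l) x k k)
      = (\<Sum>m\<in>UNIV. divergence G T x m * V x $ m) + (1/2) * contract2 x (T x) (lie_metric G V x)"
    by (simp add: contract2_lie_metric[OF x sym])
  have "(\<lambda>y. (\<chi> k. \<Sum>l\<in>UNIV. H y k l * ?U y l) $ k) differentiable (at x)" for k
    by (simp, intro differentiable_sumI differentiable_mult U H_diff x)
  from coordinate_divergence[OF x this] show ?thesis
    unfolding nabX .
qed

end

section \<open>Trace of the Bach tensor\<close>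

lemma metric_trace_add: "metric_trace g (\<lambda>a b. S a b + T a b) = metric_trace g S + metric_trace g T"
  by (simp add: metric_trace_def distrib_left sum.distrib)

lemma metric_trace_diff: "metric_trace g (\<lambda>a b. S a b - T a b) = metric_trace g S - metric_trace g T"
  by (simp add: metric_trace_def right_diff_distrib sum_subtractf)

lemma metric_trace_cmult: "metric_trace g (\<lambda>a b. c * T a b) = c * metric_trace g T"
  by (simp add: metric_trace_def sum_distrib_left mult.left_commute)

lemma metric_trace_sum: "metric_trace g (\<lambda>a b. \<Sum>m\<in>I. T m a b) = (\<Sum>m\<in>I. metric_trace g (T m))"
  unfolding metric_trace_def sum_distrib_left by (rule sum_rotate3[symmetric])

lemma metric_trace_zero: "metric_trace g (\<lambda>a b. 0) = 0"
  by (simp add: metric_trace_def)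

lemma metric_trace_swap:
  "metric_trace g (\<lambda>a b. metric_trace h (\<lambda>i j. F a b i j)) = metric_trace h (\<lambda>i j. metric_trace g (\<lambda>a b. F a b i j))"
proof -
  have "metric_trace g (\<lambda>a b. metric_trace h (\<lambda>i j. F a b i j))
      = (\<Sum>i\<in>UNIV. \<Sum>j\<in>UNIV. metric_trace g (\<lambda>a b. matrix_inv h $ i $ j * F a b i j))"
    unfolding metric_trace_def[of h] by (simp only: metric_trace_sum)
  then show ?thesis
    by (simp only: metric_trace_cmult metric_trace_def[of h])
qed

lemma smooth_on_divide_const [smooth]:
  fixes f :: "real ^ 'n::finite \<Rightarrow> real"
  shows "open S \<Longrightarrow> smooth_on S f \<Longrightarrow> smooth_on S (\<lambda>x. f x / c)"
  unfolding divide_inverse by (intro smooth)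

context metric_chart
begin

lemma riemann_smooth [smooth]: "smooth_on S (\<lambda>x. riemann G x i j k l)"
  unfolding riemann_def curv_op_def by (intro smooth S_open)

lemma ricci_smooth [smooth]: "smooth_on S (\<lambda>x. ricci G x i j)"
  unfolding ricci_def metric_trace_def by (intro smooth S_open)

lemma scalar_curvature_smooth [smooth]: "smooth_on S (\<lambda>x. scalar_curvature G x)"
  unfolding scalar_curvature_def metric_trace_def by (intro smooth S_open)

lemma weyl_smooth [smooth]: "smooth_on S (\<lambda>x. weyl G x a i j b)"
  unfolding weyl_def kulkarni_nomizu_def Let_def by (intro smooth S_open)

lemma metric_trace_metric:
  assumes "x \<in> S"
  shows "metric_trace (G x) (\<lambda>a b. G x $ a $ b) = real CARD('n)"
proof -
  have "metric_trace (G x) (\<lambda>a b. G x $ a $ b) = (\<Sum>a\<in>UNIV. \<Sum>b\<in>UNIV. H x a b * G x $ b $ a)"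
    unfolding metric_trace_def using G_sym[OF assms] by presburger
  then show ?thesis by (simp add: sum_HG[OF assms])
qed

lemma metric_trace_contract_right:
  assumes "x \<in> S"
  shows "metric_trace (G x) (\<lambda>a b. h a * G x $ i $ b) = h i"
proof -
  have "metric_trace (G x) (\<lambda>a b. h a * G x $ i $ b) = (\<Sum>a\<in>UNIV. h a * (\<Sum>b\<in>UNIV. H x a b * G x $ b $ i))"
    unfolding metric_trace_def sum_distrib_left using G_sym[OF assms, of i] by (simp add: mult.left_commute)
  then show ?thesis by (simp add: sum_HG[OF assms] if_distrib cong: if_cong)
qed

lemma metric_trace_contract_left:
  assumes "x \<in> S"
  shows "metric_trace (G x) (\<lambda>a b. G x $ a $ j * h b) = h j"
proof -
  have "metric_trace (G x) (\<lambda>a b. G x $ a $ j * h b) = (\<Sum>b\<in>UNIV. \<Sum>a\<in>UNIV. H x a b * (G x $ a $ j * h b))"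
    unfolding metric_trace_def by (rule sum.swap)
  also have "\<dots> = (\<Sum>b\<in>UNIV. h b * (\<Sum>a\<in>UNIV. H x b a * G x $ a $ j))"
    unfolding sum_distrib_left using H_sym[OF assms] by (simp add: mult.left_commute mult.commute)
  finally show ?thesis by (simp add: sum_HG[OF assms] if_distrib cong: if_cong)
qed

text \<open>The factor n - 2 arises as n, the trace of the metric, less 1 for each of the two
  products in which one traced slot lies in \<open>h\<close> and the other in the metric.\<close>

lemma metric_trace_kulkarni_nomizu:
  assumes "x \<in> S"
  shows "metric_trace (G x) (\<lambda>a b. kulkarni_nomizu h (\<lambda>i j. G x $ i $ j) a i j b)
    = (1/2) * ((real CARD('n) - 2) * h i j + metric_trace (G x) h * G x $ i $ j)"
proof -
  have "metric_trace (G x) (\<lambda>a b. kulkarni_nomizu h (\<lambda>i j. G x $ i $ j) a i j b)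
      = (1/2) * (h i j * metric_trace (G x) (\<lambda>a b. G x $ a $ b) - metric_trace (G x) (\<lambda>a b. h a j * G x $ i $ b)
        + G x $ i $ j * metric_trace (G x) (\<lambda>a b. h a b) - metric_trace (G x) (\<lambda>a b. G x $ a $ j * h i b))"
    unfolding kulkarni_nomizu_def metric_trace_cmult metric_trace_diff metric_trace_add ..
  also have "\<dots> = (1/2) * (h i j * real CARD('n) - h i j + G x $ i $ j * metric_trace (G x) h - h i j)"
    by (simp only: metric_trace_metric[OF assms] metric_trace_contract_right[OF assms, of "\<lambda>a. h a j"]
        metric_trace_contract_left[OF assms, of j "h i"])
  finally show ?thesis by (simp add: algebra_simps)
qed

text \<open>\<open>ricci\<close> is by definition this trace of \<open>riemann\<close>, and the two
  coefficients in \<open>weyl\<close> are those that cancel it. The outer slots are the ones holding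
  the free arguments of the Bach tensor.\<close>

lemma metric_trace_weyl:
  assumes x: "x \<in> S" and n: "CARD('n) \<ge> 3"
  shows "metric_trace (G x) (\<lambda>a b. weyl G x a i j b) = 0"
proof -
  let ?n = "real CARD('n)" and ?g = "\<lambda>i j. G x $ i $ j"
  have "metric_trace (G x) (\<lambda>a b. weyl G x a i j b) = metric_trace (G x) (\<lambda>a b. riemann G x a i j b)
      - 2 / (?n - 2) * metric_trace (G x) (\<lambda>a b. kulkarni_nomizu (ricci G x) ?g a i j b)
      + scalar_curvature G x / ((?n - 1) * (?n - 2)) * metric_trace (G x) (\<lambda>a b. kulkarni_nomizu ?g ?g a i j b)"
    unfolding weyl_def Let_def metric_trace_cmult metric_trace_diff metric_trace_add ..
  also have "\<dots> = ricci G x i j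
      - 2 / (?n - 2) * ((1/2) * ((?n - 2) * ricci G x i j + scalar_curvature G x * G x $ i $ j))
      + scalar_curvature G x / ((?n - 1) * (?n - 2)) * ((?n - 1) * G x $ i $ j)"
    by (simp add: metric_trace_kulkarni_nomizu[OF x] metric_trace_metric[OF x] ricci_def scalar_curvature_def algebra_simps)
  also have "\<dots> = 0"
  proof -
    have "?n - 2 \<noteq> 0" "?n - 1 \<noteq> 0" using n by auto
    then show ?thesis by (simp add: divide_simps) (simp add: algebra_simps)
  qed
  finally show ?thesis .
qed

text \<open>This is metric compatibility of the Levi-Civita connection.\<close>

lemma metric_trace_nabla:
  assumes x: "x \<in> S" and F: "\<And>a b. (\<lambda>y. F y a b) differentiable (at x)"
    and tr: "\<And>y. y \<in> S \<Longrightarrow> metric_trace (G y) (F y) = 0"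
  shows "metric_trace (G x) (\<lambda>a b. pd k (\<lambda>y. F y a b) x
    - (\<Sum>m\<in>UNIV. Gam x m k a * F x m b) - (\<Sum>m\<in>UNIV. Gam x m k b * F x a m)) = 0"
proof -
  \<comment> \<open>The trace vanishes on all of \<open>S\<close>, so its derivative at
    \<open>x\<close> does too; \<open>pd_H\<close> turns the derivative of the inverse metric into
    the two connection terms.\<close>
  have "pd k (\<lambda>y. \<Sum>a\<in>UNIV. \<Sum>b\<in>UNIV. H y a b * F y a b) x = pd k (\<lambda>y. 0 :: real) x"
    using tr by (intro pd_cong_open[OF S_open x]) (simp add: metric_trace_def)
  then have "0 = pd k (\<lambda>y. \<Sum>a\<in>UNIV. \<Sum>b\<in>UNIV. H y a b * F y a b) x"
    by (simp add: pd_const)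
  also have "\<dots> = (\<Sum>a\<in>UNIV. \<Sum>b\<in>UNIV. pd k (\<lambda>y. H y a b) x * F x a b + H x a b * pd k (\<lambda>y. F y a b) x)"
    by (simp add: pd_sum pd_mult differentiable_sumI differentiable_mult H_diff[OF x] F)
  also have "\<dots> = (\<Sum>a\<in>UNIV. \<Sum>b\<in>UNIV. H x a b * pd k (\<lambda>y. F y a b) x)
      - (\<Sum>a\<in>UNIV. \<Sum>b\<in>UNIV. (\<Sum>c\<in>UNIV. H x a c * Gam x b k c) * F x a b)
      - (\<Sum>a\<in>UNIV. \<Sum>b\<in>UNIV. (\<Sum>c\<in>UNIV. H x b c * Gam x a k c) * F x a b)"
    by (simp add: pd_H[OF x] left_diff_distrib sum_subtractf sum.distrib sum_negf)
  also have "(\<Sum>a\<in>UNIV. \<Sum>b\<in>UNIV. (\<Sum>c\<in>UNIV. H x a c * Gam x b k c) * F x a b)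
      = (\<Sum>a\<in>UNIV. \<Sum>b\<in>UNIV. H x a b * (\<Sum>m\<in>UNIV. Gam x m k b * F x a m))"
    unfolding sum_distrib_left sum_distrib_right
    by (rule sum.cong[OF refl], subst sum.swap) (simp add: mult.assoc)
  also have "(\<Sum>a\<in>UNIV. \<Sum>b\<in>UNIV. (\<Sum>c\<in>UNIV. H x b c * Gam x a k c) * F x a b)
      = (\<Sum>a\<in>UNIV. \<Sum>b\<in>UNIV. H x a b * (\<Sum>m\<in>UNIV. Gam x m k a * F x m b))"
  proof -
    have "(\<Sum>a\<in>UNIV. \<Sum>b\<in>UNIV. (\<Sum>c\<in>UNIV. H x b c * Gam x a k c) * F x a b)
       = (\<Sum>b\<in>UNIV. \<Sum>c\<in>UNIV. \<Sum>a\<in>UNIV. H x b c * Gam x a k c * F x a b)"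
      unfolding sum_distrib_right by (rule sum_rotate3)
    also have "\<dots> = (\<Sum>c\<in>UNIV. \<Sum>b\<in>UNIV. \<Sum>a\<in>UNIV. H x c b * Gam x a k c * F x a b)"
      by (subst sum.swap) (simp only: H_sym[OF x])
    finally show ?thesis by (simp add: sum_distrib_left mult.assoc)
  qed
  finally show ?thesis
    by (simp add: metric_trace_def right_diff_distrib sum_subtractf)
qed

lemma metric_trace_sum_zero:
  "(\<And>m. metric_trace (G x) (T m) = 0) \<Longrightarrow> metric_trace (G x) (\<lambda>a b. \<Sum>m\<in>UNIV. c m * T m a b) = 0"
  by (simp only: metric_trace_sum metric_trace_cmult) simp

lemma cov_weyl_smooth: "smooth_on S (\<lambda>x. cov G (tensor4 (weyl G)) x [k, a, i, j, b])"
  unfolding cov_def tensor4_def by (simp, intro smooth S_open)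

text \<open>The connection terms in the traced slots are handled by
  \<open>metric_trace_nabla\<close>; those in the inner slots are combinations of outer traces of
  the Weyl tensor with coefficients independent of \<open>a\<close> and \<open>b\<close>, so they
  vanish.\<close>

lemma metric_trace_cov_weyl:
  assumes x: "x \<in> S" and n: "CARD('n) \<ge> 3"
  shows "metric_trace (G x) (\<lambda>a b. cov G (tensor4 (weyl G)) x [k, a, i, j, b]) = 0"
proof -
  let ?W = "weyl G"
  have "cov G (tensor4 ?W) x [k, a, i, j, b] =
    (pd k (\<lambda>y. ?W y a i j b) x - (\<Sum>m\<in>UNIV. Gam x m k a * ?W x m i j b) - (\<Sum>m\<in>UNIV. Gam x m k b * ?W x a i j m))
    - (\<Sum>m\<in>UNIV. Gam x m k i * ?W x a m j b) - (\<Sum>m\<in>UNIV. Gam x m k j * ?W x a i m b)" for a b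
    by (simp add: cov_def tensor4_def lessThan_Suc)
  moreover have "metric_trace (G x) (\<lambda>a b. pd k (\<lambda>y. ?W y a i j b) x
      - (\<Sum>m\<in>UNIV. Gam x m k a * ?W x m i j b) - (\<Sum>m\<in>UNIV. Gam x m k b * ?W x a i j m)) = 0"
    using metric_trace_nabla[of x "\<lambda>y a b. ?W y a i j b", OF x smooth_on_differentiable[OF weyl_smooth x]]
      metric_trace_weyl[OF _ n] by blast
  ultimately show ?thesis
    by (simp only: metric_trace_diff metric_trace_sum_zero[OF metric_trace_weyl[OF x n]])
qed

text \<open>The argument for the first derivative is repeated; the slot \<open>k\<close> of the
  inner derivative adds one more connection term, again a combination of vanishing traces.\<close>

lemma metric_trace_cov_cov_weyl:
  assumes x: "x \<in> S" and n: "CARD('n) \<ge> 3"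
  shows "metric_trace (G x) (\<lambda>a b. cov G (cov G (tensor4 (weyl G))) x [l, k, a, i, j, b]) = 0"
proof -
  let ?W = "cov G (tensor4 (weyl G))"
  have "cov G ?W x [l, k, a, i, j, b] =
    (pd l (\<lambda>y. ?W y [k, a, i, j, b]) x - (\<Sum>m\<in>UNIV. Gam x m l a * ?W x [k, m, i, j, b])
      - (\<Sum>m\<in>UNIV. Gam x m l b * ?W x [k, a, i, j, m]))
    - (\<Sum>m\<in>UNIV. Gam x m l i * ?W x [k, a, m, j, b]) - (\<Sum>m\<in>UNIV. Gam x m l j * ?W x [k, a, i, m, b])
    - (\<Sum>m\<in>UNIV. Gam x m l k * ?W x [m, a, i, j, b])" for a b
    by (simp add: cov_def[of G ?W] lessThan_Suc)
  moreover have "metric_trace (G x) (\<lambda>a b. pd l (\<lambda>y. ?W y [k, a, i, j, b]) x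
      - (\<Sum>m\<in>UNIV. Gam x m l a * ?W x [k, m, i, j, b]) - (\<Sum>m\<in>UNIV. Gam x m l b * ?W x [k, a, i, j, m])) = 0"
    using metric_trace_nabla[of x "\<lambda>y a b. ?W y [k, a, i, j, b]", OF x smooth_on_differentiable[OF cov_weyl_smooth x]]
      metric_trace_cov_weyl[OF _ n] by blast
  ultimately show ?thesis
    by (simp only: metric_trace_diff metric_trace_sum_zero[OF metric_trace_cov_weyl[OF x n]])
qed

lemma metric_trace_bach:
  assumes x: "x \<in> S" and n: "CARD('n) \<ge> 3"
  shows "metric_trace (G x) (bach G x) = 0"
proof -
  \<comment> \<open>The trace over the free arguments is moved inside the two frame traces, where it
    meets the second derivative of the Weyl tensor directly.\<close>
  have 1: "metric_trace (G x) (\<lambda>a b. metric_trace (G x) (\<lambda>i i'. metric_trace (G x) (\<lambda>j j'.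
         cov G (cov G (tensor4 (weyl G))) x [i, j, a, i', j', b]))) = 0"
    by (simp only: metric_trace_swap[of "G x" "G x" "\<lambda>a b i i'. metric_trace _ (_ a b i i')"]
        metric_trace_swap[of "G x" "G x" "\<lambda>a b j j'. cov _ _ _ [_, j, a, _, j', b]"]
        metric_trace_cov_cov_weyl[OF x n] metric_trace_zero)
  have 2: "metric_trace (G x) (\<lambda>a b. metric_trace (G x) (\<lambda>i i'. metric_trace (G x) (\<lambda>j j'.
         ricci G x i j * weyl G x a i' j' b))) = 0"
    by (simp only: metric_trace_swap[of "G x" "G x" "\<lambda>a b i i'. metric_trace _ (_ a b i i')"]
        metric_trace_swap[of "G x" "G x" "\<lambda>a b j j'. ricci _ _ _ j * weyl _ _ a _ j' b"]
        metric_trace_cmult metric_trace_weyl[OF x n] metric_trace_zero mult_zero_right)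
  have "metric_trace (G x) (bach G x) = metric_trace (G x) (\<lambda>a b. bach G x a b)" by simp
  then show ?thesis
    by (simp only: bach_def metric_trace_add metric_trace_cmult 1 2)
qed

end

section \<open>Positivity of the squared norm of a tensor\<close>

text \<open>A Cholesky-type decomposition by symmetric elimination. \<open>I\<close> contains the
  indices of all rows that may be nonzero, so each elimination step removes one index.\<close>

lemma psd_sum_of_squares:
  fixes Q :: "real ^ 'n ^ 'n::finite"
  assumes "finite I" "transpose Q = Q" "\<And>v. v \<bullet> (Q *v v) \<ge> 0"
    and "\<And>i j. i \<notin> I \<Longrightarrow> Q $ i $ j = 0"
  shows "\<exists>E :: 'n \<Rightarrow> 'n \<Rightarrow> real. \<forall>i j. Q $ i $ j = (\<Sum>p\<in>I. E p i * E p j)"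
  using assms
proof (induction I arbitrary: Q rule: finite_induct)
  case empty
  then show ?case by auto
next
  case (insert s I)
  have sym: "Q $ i $ j = Q $ j $ i" for i j
    using transpose_nth[of Q j i] insert.prems(1) by simp
  have Qs: "(Q *v v) $ s = (\<Sum>j\<in>UNIV. Q $ j $ s * v $ j)" for v
    unfolding matrix_vector_mult_def by (simp, intro sum.cong refl arg_cong2[where f = "(*)", OF sym])
  have shift: "(v + c *\<^sub>R axis s 1) \<bullet> (Q *v (v + c *\<^sub>R axis s 1))
      = v \<bullet> (Q *v v) + 2 * c * (Q *v v) $ s + c\<^sup>2 * Q $ s $ s" for v c
  proof -
    have "v \<bullet> (Q *v axis s 1) = (Q *v v) $ s"
      unfolding matrix_vector_mult_basis
      by (simp add: column_def inner_vec_def Qs mult.commute)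
    moreover have "axis s 1 \<bullet> (Q *v axis s 1) = Q $ s $ s"
      by (simp add: inner_axis' matrix_vector_mult_basis column_def)
    moreover have "axis s 1 \<bullet> (Q *v v) = (Q *v v) $ s"
      by (simp add: inner_axis')
    ultimately show ?thesis
      by (simp add: matrix_vector_right_distrib inner_add_left inner_add_right
          matrix_vector_mult_scaleR power2_eq_square algebra_simps)
  qed
  have ss: "Q $ s $ s \<ge> 0"
    using insert.prems(2)[of "axis s 1"] by (simp add: inner_axis' matrix_vector_mult_basis column_def)
  show ?case
  proof (cases "Q $ s $ s = 0")
    case True
    have "Q $ s $ j = 0" for j
    proof (rule ccontr)
      assume ne: "Q $ s $ j \<noteq> 0"
      \<comment> \<open>With a zero pivot the form is affine in \<open>c\<close> along the line
        through \<open>axis j 1\<close> in direction \<open>axis s 1\<close>; this \<open>c\<close>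
        would make its value -1.\<close>
      define c where "c = - (Q $ j $ j + 1) / (2 * Q $ s $ j)"
      have "(Q *v axis j 1) $ s = Q $ s $ j" "axis j 1 \<bullet> (Q *v axis j 1) = Q $ j $ j"
        by (simp_all add: inner_axis' matrix_vector_mult_basis column_def)
      then have "Q $ j $ j + 2 * c * Q $ s $ j \<ge> 0"
        using insert.prems(2)[of "axis j 1 + c *\<^sub>R axis s 1"] shift[of "axis j 1" c] True by simp
      moreover have "2 * c * Q $ s $ j = - (Q $ j $ j + 1)"
        using ne by (simp add: c_def)
      ultimately show False by simp
    qed
    then have "\<And>i j. i \<notin> I \<Longrightarrow> Q $ i $ j = 0"
      using insert.prems(3) by (metis insert_iff)
    then obtain E :: "'n \<Rightarrow> 'n \<Rightarrow> real" where E: "\<forall>i j. Q $ i $ j = (\<Sum>p\<in>I. E p i * E p j)"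
      using insert.IH[OF insert.prems(1,2)] by blast
    have "Q $ i $ j = (\<Sum>p\<in>insert s I. (E(s := (\<lambda>_. 0))) p i * (E(s := (\<lambda>_. 0))) p j)" for i j
      using insert.hyps E by (auto intro!: sum.cong)
    then show ?thesis by blast
  next
    case False
    then have pos: "Q $ s $ s > 0" using ss by simp
    \<comment> \<open>The Schur complement of the pivot: subtracting the square that belongs to
      \<open>s\<close> clears row and column \<open>s\<close>.\<close>
    define Q' :: "real ^ 'n ^ 'n" where "Q' = (\<chi> i j. Q $ i $ j - Q $ i $ s * Q $ j $ s / Q $ s $ s)"
    have "transpose Q' = Q'"
      unfolding vec_eq_iff transpose_nth
    proof (intro allI)
      fix i j show "Q' $ j $ i = Q' $ i $ j"
        using sym[of i j] by (simp add: Q'_def mult.commute)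
    qed
    moreover have "v \<bullet> (Q' *v v) \<ge> 0" for v
    proof -
      \<comment> \<open>The minimizer of the form of \<open>Q\<close> on the line through
        \<open>v\<close> in direction \<open>axis s 1\<close>; the minimum is the value of
        \<open>Q'\<close> at \<open>v\<close>, hence nonnegative.\<close>
      define c where "c = - (Q *v v) $ s / Q $ s $ s"
      have "(Q' *v v) $ i = (Q *v v) $ i + c * Q $ i $ s" for i
      proof -
        have "(\<Sum>j\<in>UNIV. Q $ i $ s * Q $ j $ s / Q $ s $ s * v $ j) = Q $ i $ s * (Q *v v) $ s / Q $ s $ s"
          by (simp add: Qs sum_distrib_left sum_divide_distrib mult.assoc)
        moreover have "(Q' *v v) $ i = (Q *v v) $ i - (\<Sum>j\<in>UNIV. Q $ i $ s * Q $ j $ s / Q $ s $ s * v $ j)"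
          by (simp only: Q'_def matrix_vector_mult_def vec_lambda_beta left_diff_distrib sum_subtractf)
        ultimately show ?thesis by (simp add: c_def)
      qed
      then have "v \<bullet> (Q' *v v) = v \<bullet> (Q *v v) + c * (\<Sum>i\<in>UNIV. v $ i * Q $ i $ s)"
        by (simp add: inner_vec_def distrib_left sum.distrib sum_distrib_left mult.left_commute)
      also have "(\<Sum>i\<in>UNIV. v $ i * Q $ i $ s) = (Q *v v) $ s"
        by (simp add: Qs mult.commute)
      also have "v \<bullet> (Q *v v) + c * (Q *v v) $ s = (v + c *\<^sub>R axis s 1) \<bullet> (Q *v (v + c *\<^sub>R axis s 1))"
        using pos unfolding shift by (simp add: c_def power2_eq_square field_simps)
      finally show ?thesis using insert.prems(2) by simp
    qed
    moreover have "Q' $ i $ j = 0" if "i \<notin> I" for i j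
      using that insert.prems(3)[of i] pos sym[of s j] by (cases "i = s") (auto simp: Q'_def)
    ultimately obtain E :: "'n \<Rightarrow> 'n \<Rightarrow> real" where E: "\<forall>i j. Q' $ i $ j = (\<Sum>p\<in>I. E p i * E p j)"
      using insert.IH by blast
    let ?E = "E(s := (\<lambda>i. Q $ i $ s / sqrt (Q $ s $ s)))"
    have "Q $ i $ j = (\<Sum>p\<in>insert s I. ?E p i * ?E p j)" for i j
    proof -
      have "(\<Sum>p\<in>insert s I. ?E p i * ?E p j) = ?E s i * ?E s j + (\<Sum>p\<in>I. ?E p i * ?E p j)"
        using insert.hyps by simp
      also have "(\<Sum>p\<in>I. ?E p i * ?E p j) = (\<Sum>p\<in>I. E p i * E p j)"
        using insert.hyps by (intro sum.cong) auto
      also have "\<dots> = Q $ i $ j - Q $ i $ s * Q $ j $ s / Q $ s $ s"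
        using E by (simp add: Q'_def)
      finally show ?thesis using pos by simp
    qed
    then show ?thesis by blast
  qed
qed

context metric_chart
begin

text \<open>The inverse metric is positive semidefinite because its form at \<open>v\<close> is that
  of the metric at the raised vector. The vectors \<open>E p\<close> form an orthonormal frame at
  \<open>x\<close>.\<close>

lemma H_sum_of_squares:
  assumes x: "x \<in> S"
  obtains E :: "'n \<Rightarrow> 'n \<Rightarrow> real" where "\<And>i j. H x i j = (\<Sum>p\<in>UNIV. E p i * E p j)"
proof -
  let ?H = "matrix_inv (G x)"
  have "transpose ?H = ?H"
    using H_sym[OF x] by (simp add: vec_eq_iff transpose_nth)
  moreover have "v \<bullet> (?H *v v) \<ge> 0" for v
  proof -
    have "v = G x *v (?H *v v)"
      by (simp add: matrix_vector_mul_assoc GH[OF x])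
    then have "v \<bullet> (?H *v v) = (?H *v v) \<bullet> (G x *v (?H *v v))"
      by (metis inner_commute)
    then show ?thesis
      using G_posdef[OF x, of "?H *v v"] by (cases "?H *v v = 0") auto
  qed
  ultimately obtain E :: "'n \<Rightarrow> 'n \<Rightarrow> real" where "\<forall>i j. H x i j = (\<Sum>p\<in>UNIV. E p i * E p j)"
    using psd_sum_of_squares[of UNIV ?H] by auto
  then show ?thesis using that[of E] by simp
qed

text \<open>The expansion of the raised form in the frame \<open>E\<close>, with coefficients T(E_p,
  E_q).\<close>

lemma raise_both:
  assumes E: "\<And>i j. H x i j = (\<Sum>p\<in>UNIV. E p i * E p j)"
  shows "(\<Sum>i\<in>UNIV. H x a i * (\<Sum>j\<in>UNIV. H x b j * T i j))
    = (\<Sum>p\<in>UNIV. \<Sum>q\<in>UNIV. E p a * E q b * (\<Sum>i\<in>UNIV. \<Sum>j\<in>UNIV. T i j * (E p i * E q j)))"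
proof -
  have "(\<Sum>i\<in>UNIV. H x a i * (\<Sum>j\<in>UNIV. H x b j * T i j))
      = (\<Sum>i\<in>UNIV. \<Sum>j\<in>UNIV. \<Sum>p\<in>UNIV. \<Sum>q\<in>UNIV. E p a * E q b * (T i j * (E p i * E q j)))"
    unfolding E sum_distrib_left sum_distrib_right
    by (rule sum.cong[OF refl], rule sum.cong[OF refl], subst sum.swap, simp add: mult_ac)
  also have "\<dots> = (\<Sum>i\<in>UNIV. \<Sum>p\<in>UNIV. \<Sum>q\<in>UNIV. \<Sum>j\<in>UNIV. E p a * E q b * (T i j * (E p i * E q j)))"
    by (intro sum.cong[OF refl] sum_rotate3)
  also have "\<dots> = (\<Sum>p\<in>UNIV. \<Sum>q\<in>UNIV. \<Sum>i\<in>UNIV. \<Sum>j\<in>UNIV. E p a * E q b * (T i j * (E p i * E q j)))"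
    by (rule sum_rotate3)
  finally show ?thesis by (simp add: sum_distrib_left)
qed

lemma contract2_squares:
  assumes E: "\<And>i j. H x i j = (\<Sum>p\<in>UNIV. E p i * E p j)"
  shows "contract2 x T T = (\<Sum>p\<in>UNIV. \<Sum>q\<in>UNIV. (\<Sum>a\<in>UNIV. \<Sum>b\<in>UNIV. T a b * (E p a * E q b))\<^sup>2)"
proof -
  let ?t = "\<lambda>p q. \<Sum>i\<in>UNIV. \<Sum>j\<in>UNIV. T i j * (E p i * E q j)"
  note raise_both[OF E, of _ _ T]
  then have "contract2 x T T = (\<Sum>a\<in>UNIV. \<Sum>b\<in>UNIV. \<Sum>p\<in>UNIV. \<Sum>q\<in>UNIV. (T a b * (E p a * E q b)) * ?t p q)"
    unfolding contract2_def by (simp only: sum_distrib_left mult.assoc)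
  also have "\<dots> = (\<Sum>a\<in>UNIV. \<Sum>p\<in>UNIV. \<Sum>q\<in>UNIV. \<Sum>b\<in>UNIV. (T a b * (E p a * E q b)) * ?t p q)"
    by (intro sum.cong[OF refl] sum_rotate3)
  also have "\<dots> = (\<Sum>p\<in>UNIV. \<Sum>q\<in>UNIV. \<Sum>a\<in>UNIV. \<Sum>b\<in>UNIV. (T a b * (E p a * E q b)) * ?t p q)"
    by (rule sum_rotate3)
  also have "\<dots> = (\<Sum>p\<in>UNIV. \<Sum>q\<in>UNIV. ?t p q * ?t p q)"
    by (simp only: sum_distrib_right)
  finally show ?thesis by (simp only: power2_eq_square)
qed

lemma contract2_nonneg:
  assumes "x \<in> S"
  shows "contract2 x T T \<ge> 0"
proof -
  obtain E :: "'n \<Rightarrow> 'n \<Rightarrow> real" where E: "\<And>i j. H x i j = (\<Sum>p\<in>UNIV. E p i * E p j)"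
    by (rule H_sum_of_squares[OF assms]) blast
  show ?thesis unfolding contract2_squares[OF E] by (intro sum_nonneg zero_le_power2)
qed

text \<open>All frame components T(E_p, E_q) vanish as their squares sum to zero; so the raised form
  vanishes, and lowering both indices recovers \<open>T\<close>.\<close>

lemma contract2_eq_0:
  assumes x: "x \<in> S" and zero: "contract2 x T T = 0"
  shows "T a b = 0"
proof -
  obtain E :: "'n \<Rightarrow> 'n \<Rightarrow> real" where E: "\<And>i j. H x i j = (\<Sum>p\<in>UNIV. E p i * E p j)"
    by (rule H_sum_of_squares[OF x]) blast
  have t: "(\<Sum>i\<in>UNIV. \<Sum>j\<in>UNIV. T i j * (E p i * E q j)) = 0" for p q
    using zero unfolding contract2_squares[OF E]
    by (simp add: sum_nonneg_eq_0_iff sum_nonneg)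
  have "(\<Sum>i\<in>UNIV. H x c i * (\<Sum>j\<in>UNIV. H x d j * T i j)) = 0" for c d
    by (simp only: raise_both[OF E] t mult_zero_right sum.neutral_const)
  then have "(\<Sum>j\<in>UNIV. H x d j * T a j) = 0" for d
    using G_H_cancel[OF x, of a "\<lambda>i. \<Sum>j\<in>UNIV. H x d j * T i j"] by simp
  then show ?thesis
    using G_H_cancel[OF x, of b "T a"] by simp
qed

end

lemma sum_mult_rotate3:
  fixes v :: "'a \<Rightarrow> real"
  shows "(\<Sum>k\<in>K. v k * (\<Sum>a\<in>A. \<Sum>b\<in>B. f k a b)) = (\<Sum>a\<in>A. \<Sum>b\<in>B. \<Sum>k\<in>K. v k * f k a b)"
  unfolding sum_distrib_left by (rule sum_rotate3)

section \<open>Naturality of the Lie derivative\<close>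

text \<open>The pullback by \<open>\<phi>\<close> intertwines the Lie derivatives along
  \<open>\<phi>\<close>-related fields. The obstacle is the second derivatives of
  \<open>\<phi>\<close> that arise from differentiating the pulled-back metric; together with the
  derivatives of \<open>V\<close> they form derivatives of \<open>V'\<close> along
  \<open>\<phi>\<close>.\<close>

lemma lie_metric_pullback:
  fixes \<phi> :: "real ^ 'n::finite \<Rightarrow> real ^ 'n" and G G' :: "real ^ 'n \<Rightarrow> real ^ 'n ^ 'n"
  defines "J \<equiv> \<lambda>y a i. pd i (\<lambda>y. \<phi> y $ a) y"
  assumes S: "open S" "x \<in> S" and \<phi>: "smooth_on S \<phi>"
    and dG': "\<And>a b. (\<lambda>y. G' y $ a $ b) differentiable (at (\<phi> x))"
    and dV: "\<And>a. (\<lambda>y. V y $ a) differentiable (at x)"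
    and dV': "\<And>a. (\<lambda>y. V' y $ a) differentiable (at (\<phi> x))"
    and G: "\<And>y i j. y \<in> S \<Longrightarrow> G y $ i $ j = (\<Sum>a\<in>UNIV. \<Sum>b\<in>UNIV. J y a i * (J y b j * G' (\<phi> y) $ a $ b))"
    and V: "\<And>y a. y \<in> S \<Longrightarrow> V' (\<phi> y) $ a = (\<Sum>i\<in>UNIV. J y a i * V y $ i)"
  shows "lie_metric G V x i j = (\<Sum>a\<in>UNIV. \<Sum>b\<in>UNIV. J x a i * (J x b j * lie_metric G' V' (\<phi> x) a b))"
proof -
  let ?y = "\<phi> x"
  have d\<phi>: "\<phi> differentiable (at x)" using \<phi> S(2) smooth_on_differentiable by blast
  have Jsm: "smooth_on S (\<lambda>y. J y a i)" for a i
    unfolding J_def by (intro smooth S(1) \<phi>)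
  have dJ: "(\<lambda>y. J y a i) differentiable (at x)" for a i
    using Jsm S(2) smooth_on_differentiable by blast
  have Jsym: "pd k (\<lambda>y. J y a i) x = pd i (\<lambda>y. J y a k) x" for a i k
    unfolding J_def by (rule pd_commute[OF S]) (intro smooth_on_imp_ck smooth S(1) \<phi>)
  have dGc: "(\<lambda>y. G' (\<phi> y) $ a $ b) differentiable (at x)" for a b
    using differentiable_chain_at[OF d\<phi> dG'[of a b]] by (simp add: comp_def)
  have pdGc: "pd k (\<lambda>y. G' (\<phi> y) $ a $ b) x = (\<Sum>c\<in>UNIV. J x c k * pd c (\<lambda>y. G' y $ a $ b) ?y)" for a b k
    using pd_chain[OF dG'[of a b] d\<phi>] by (simp add: J_def)
  have pdG: "pd k (\<lambda>y. G y $ i $ j) x = (\<Sum>a\<in>UNIV. \<Sum>b\<in>UNIV.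
      pd k (\<lambda>y. J y a i) x * (J x b j * G' ?y $ a $ b) + J x a i * (pd k (\<lambda>y. J y b j) x * G' ?y $ a $ b)
      + J x a i * (J x b j * (\<Sum>c\<in>UNIV. J x c k * pd c (\<lambda>y. G' y $ a $ b) ?y)))" for k
    by (subst pd_cong_open[OF S G])
      (simp_all add: pd_sum pd_mult differentiable_sumI differentiable_mult dJ dGc pdGc distrib_left add.assoc)
  \<comment> \<open>This differentiates the relation between \<open>V\<close> and \<open>V'\<close>.
    The symmetry \<open>Jsym\<close> of second derivatives brings the terms into the form in which
    they occur when the pulled-back metric is differentiated along \<open>V\<close>.\<close>
  have nV: "(\<Sum>k\<in>UNIV. V x $ k * pd k (\<lambda>y. J y a i) x + J x a k * pd i (\<lambda>y. V y $ k) x)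
      = (\<Sum>c\<in>UNIV. J x c i * pd c (\<lambda>y. V' y $ a) ?y)" for a i
  proof -
    have "(\<Sum>c\<in>UNIV. J x c i * pd c (\<lambda>y. V' y $ a) ?y) = pd i (\<lambda>y. V' (\<phi> y) $ a) x"
      using pd_chain[OF dV'[of a] d\<phi>] by (simp add: J_def)
    also have "\<dots> = pd i (\<lambda>y. \<Sum>k\<in>UNIV. J y a k * V y $ k) x"
      by (rule pd_cong_open[OF S V])
    also have "\<dots> = (\<Sum>k\<in>UNIV. pd i (\<lambda>y. J y a k) x * V x $ k + J x a k * pd i (\<lambda>y. V y $ k) x)"
      by (simp add: pd_sum pd_mult differentiable_mult dJ dV)
    finally show ?thesis by (simp add: Jsym[of i] mult.commute)
  qed
  have T0: "lie_metric G V x i j = (\<Sum>k\<in>UNIV. V x $ k * pd k (\<lambda>y. G y $ i $ j) x)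
      + (\<Sum>k\<in>UNIV. G x $ k $ j * pd i (\<lambda>y. V y $ k) x) + (\<Sum>k\<in>UNIV. G x $ i $ k * pd j (\<lambda>y. V y $ k) x)"
    by (simp add: lie_metric_def sum.distrib)
  have T1: "(\<Sum>k\<in>UNIV. V x $ k * pd k (\<lambda>y. G y $ i $ j) x)
    = (\<Sum>a\<in>UNIV. \<Sum>b\<in>UNIV. \<Sum>k\<in>UNIV. V x $ k * (pd k (\<lambda>y. J y a i) x * (J x b j * G' ?y $ a $ b)))
    + (\<Sum>a\<in>UNIV. \<Sum>b\<in>UNIV. \<Sum>k\<in>UNIV. V x $ k * (J x a i * (pd k (\<lambda>y. J y b j) x * G' ?y $ a $ b)))
    + (\<Sum>a\<in>UNIV. \<Sum>b\<in>UNIV. \<Sum>k\<in>UNIV. V x $ k * (J x a i * (J x b j * (\<Sum>c\<in>UNIV. J x c k * pd c (\<lambda>y. G' y $ a $ b) ?y))))"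
    (is "_ = ?A1 + ?A2 + ?A3")
    unfolding pdG sum_mult_rotate3 by (simp add: distrib_left sum.distrib)
  have T2: "(\<Sum>a\<in>UNIV. \<Sum>b\<in>UNIV. \<Sum>k\<in>UNIV. V x $ k * (J x a i * (J x b j * (\<Sum>c\<in>UNIV. J x c k * pd c (\<lambda>y. G' y $ a $ b) ?y))))
    = (\<Sum>a\<in>UNIV. \<Sum>b\<in>UNIV. J x a i * (J x b j * (\<Sum>c\<in>UNIV. V' ?y $ c * pd c (\<lambda>y. G' y $ a $ b) ?y)))"
  proof -
    have "(\<Sum>k\<in>UNIV. V x $ k * (u * (v * (\<Sum>c\<in>UNIV. J x c k * p c)))) = u * (v * (\<Sum>c\<in>UNIV. V' ?y $ c * p c))"
      for u v :: real and p
      unfolding V[OF S(2)] sum_distrib_left sum_distrib_right by (subst sum.swap) (simp add: mult_ac)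
    then show ?thesis by simp
  qed
  have T3: "(\<Sum>k\<in>UNIV. G x $ k $ j * pd i (\<lambda>y. V y $ k) x)
    = (\<Sum>a\<in>UNIV. \<Sum>b\<in>UNIV. \<Sum>k\<in>UNIV. J x a k * (J x b j * G' ?y $ a $ b) * pd i (\<lambda>y. V y $ k) x)"
    (is "_ = ?B1")
    unfolding G[OF S(2)] sum_distrib_right by (rule sum_rotate3)
  have T4: "(\<Sum>k\<in>UNIV. G x $ i $ k * pd j (\<lambda>y. V y $ k) x)
    = (\<Sum>a\<in>UNIV. \<Sum>b\<in>UNIV. \<Sum>k\<in>UNIV. J x a i * (J x b k * G' ?y $ a $ b) * pd j (\<lambda>y. V y $ k) x)"
    (is "_ = ?B2")
    unfolding G[OF S(2)] sum_distrib_right by (rule sum_rotate3)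
  \<comment> \<open>The regrouping pairs each second-derivative term of \<open>T1\<close> with the
    term of \<open>T3\<close> or \<open>T4\<close> that completes it to an instance of
    \<open>nV\<close>.\<close>
  have L: "lie_metric G V x i j
    = (\<Sum>a\<in>UNIV. \<Sum>b\<in>UNIV. J x b j * G' ?y $ a $ b * (\<Sum>k\<in>UNIV. V x $ k * pd k (\<lambda>y. J y a i) x + J x a k * pd i (\<lambda>y. V y $ k) x))
    + (\<Sum>a\<in>UNIV. \<Sum>b\<in>UNIV. J x a i * G' ?y $ a $ b * (\<Sum>k\<in>UNIV. V x $ k * pd k (\<lambda>y. J y b j) x + J x b k * pd j (\<lambda>y. V y $ k) x))
    + (\<Sum>a\<in>UNIV. \<Sum>b\<in>UNIV. J x a i * (J x b j * (\<Sum>c\<in>UNIV. V' ?y $ c * pd c (\<lambda>y. G' y $ a $ b) ?y)))"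
    (is "_ = ?C1 + ?C2 + _")
  proof -
    have 1: "(\<Sum>k\<in>UNIV. V x $ k * (pd k (\<lambda>y. J y a i) x * w) + J x a k * w * pd i (\<lambda>y. V y $ k) x)
        = w * (\<Sum>k\<in>UNIV. V x $ k * pd k (\<lambda>y. J y a i) x + J x a k * pd i (\<lambda>y. V y $ k) x)" for a w
      unfolding sum_distrib_left by (intro sum.cong refl) (simp add: algebra_simps)
    have 2: "(\<Sum>k\<in>UNIV. V x $ k * (u * (pd k (\<lambda>y. J y a j) x * w)) + u * (J x a k * w) * pd j (\<lambda>y. V y $ k) x)
        = u * w * (\<Sum>k\<in>UNIV. V x $ k * pd k (\<lambda>y. J y a j) x + J x a k * pd j (\<lambda>y. V y $ k) x)" for a u w
      unfolding sum_distrib_left by (intro sum.cong refl) (simp add: algebra_simps)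
    have "?C1 = ?A1 + ?B1" "?C2 = ?A2 + ?B2"
      unfolding 1[symmetric] 2[symmetric] unfolding sum.distrib by (rule refl)+
    then show ?thesis unfolding T0 T1 T2 T3 T4 by simp
  qed
  have 1: "(\<Sum>a\<in>UNIV. \<Sum>b\<in>UNIV. J x b j * G' ?y $ a $ b * (\<Sum>c\<in>UNIV. J x c i * pd c (\<lambda>y. V' y $ a) ?y))
      = (\<Sum>a\<in>UNIV. \<Sum>b\<in>UNIV. J x a i * (J x b j * (\<Sum>c\<in>UNIV. G' ?y $ c $ b * pd a (\<lambda>y. V' y $ c) ?y)))"
  proof -
    have "(\<Sum>a\<in>UNIV. \<Sum>b\<in>UNIV. J x b j * G' ?y $ a $ b * (\<Sum>c\<in>UNIV. J x c i * pd c (\<lambda>y. V' y $ a) ?y))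
      = (\<Sum>b\<in>UNIV. \<Sum>c\<in>UNIV. \<Sum>a\<in>UNIV. J x b j * G' ?y $ a $ b * (J x c i * pd c (\<lambda>y. V' y $ a) ?y))"
      unfolding sum_distrib_left by (rule sum_rotate3)
    also have "\<dots> = (\<Sum>c\<in>UNIV. \<Sum>b\<in>UNIV. \<Sum>a\<in>UNIV. J x b j * G' ?y $ a $ b * (J x c i * pd c (\<lambda>y. V' y $ a) ?y))"
      by (rule sum.swap)
    finally show ?thesis by (simp add: sum_distrib_left mult_ac)
  qed
  have 2: "(\<Sum>a\<in>UNIV. \<Sum>b\<in>UNIV. J x a i * G' ?y $ a $ b * (\<Sum>c\<in>UNIV. J x c j * pd c (\<lambda>y. V' y $ b) ?y))
      = (\<Sum>a\<in>UNIV. \<Sum>b\<in>UNIV. J x a i * (J x b j * (\<Sum>c\<in>UNIV. G' ?y $ a $ c * pd b (\<lambda>y. V' y $ c) ?y)))"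
    unfolding sum_distrib_left
    by (rule sum.cong[OF refl], subst sum.swap) (simp add: mult_ac)
  show ?thesis
    unfolding L unfolding nV 1 2 lie_metric_def
    by (simp add: sum.distrib distrib_left)
qed

section \<open>Change of variables for arbitrary finite index types\<close>

text \<open>The change of variables theorem of the library is stated for vectors indexed by a
  well-ordered type. It is transferred to any finite index type along the following copy.\<close>

typedef (overloaded) 'a ranked = "{..<CARD('a::finite)}"
  by (intro exI[of _ 0]) (simp add: card_gt_0_iff)

instance ranked :: (finite) finite
proof
  have "(UNIV :: 'a ranked set) = Abs_ranked ` {..<CARD('a)}"
    using type_definition.Abs_image[OF type_definition_ranked] by auto
  then show "finite (UNIV :: 'a ranked set)" by (metis finite_imageI finite_lessThan)
qed

instantiation ranked :: (finite) wellorder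
begin

definition "a \<le> b \<longleftrightarrow> Rep_ranked a \<le> Rep_ranked b"
definition "a < b \<longleftrightarrow> Rep_ranked a < Rep_ranked b"

instance
proof
  fix P :: "'a ranked \<Rightarrow> bool" and a
  assume step: "\<And>x. (\<And>y. y < x \<Longrightarrow> P y) \<Longrightarrow> P x"
  show "P a"
    by (induction a rule: measure_induct_rule[of Rep_ranked]) (use step in \<open>auto simp: less_ranked_def\<close>)
qed (auto simp: less_eq_ranked_def less_ranked_def Rep_ranked_inject)

end

lemma ranked_bij: "\<exists>\<tau> :: 'a::finite ranked \<Rightarrow> 'a. bij \<tau>"
proof -
  have "CARD('a ranked) = CARD('a)"
    using type_definition.card[OF type_definition_ranked] by simp
  then show ?thesis
    using finite_same_card_bij[of "UNIV :: 'a ranked set" "UNIV :: 'a set"] by auto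
qed

text \<open>Conjugation by \<open>\<tau>\<close> is a sign-preserving bijection between the
  permutations of the two index types, and it matches the products in the Leibniz formula.\<close>

lemma det_reindex:
  fixes M :: "real ^ 'n ^ 'n::finite" and \<tau> :: "'m::finite \<Rightarrow> 'n"
  assumes \<tau>: "bij \<tau>"
  shows "det (\<chi> i j. M $ \<tau> i $ \<tau> j :: real ^ 'm ^ 'm) = det M"
proof -
  let ?\<sigma> = "inv \<tau>"
  have inv: "\<tau> (?\<sigma> x) = x" "?\<sigma> (\<tau> y) = y" for x y
    using \<tau> by (simp_all add: bij_is_surj surj_f_inv_f bij_is_inj)
  have sgn: "sign (\<tau> \<circ> p \<circ> ?\<sigma>) = sign p" if "p permutes UNIV" for p
  proof -
    \<comment> \<open>On the whole index type, \<open>map_permutation\<close> is conjugation, so its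
      sign rule applies.\<close>
    have "map_permutation UNIV \<tau> p = \<tau> \<circ> p \<circ> ?\<sigma>"
      using \<tau> by (auto simp: map_permutation_def restrict_id_def bij_is_surj fun_eq_iff)
    then show ?thesis
      using sign_map_permutation[of \<tau> UNIV p] \<tau> that by (simp add: bij_is_inj)
  qed
  have perm: "\<tau> \<circ> p \<circ> ?\<sigma> permutes UNIV" if "p permutes UNIV" for p
    using \<tau> permutes_bij[OF that] by (intro bij_imp_permutes) (auto intro!: bij_comp bij_imp_bij_inv simp del: o_apply)
  have perm': "?\<sigma> \<circ> q \<circ> \<tau> permutes UNIV" if "q permutes UNIV" for q
    using \<tau> permutes_bij[OF that] by (intro bij_imp_permutes) (auto intro!: bij_comp bij_imp_bij_inv simp del: o_apply)
  have conj: "\<tau> \<circ> (?\<sigma> \<circ> q \<circ> \<tau>) \<circ> ?\<sigma> = q" for q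
    by (simp add: fun_eq_iff inv)
  have "det M = (\<Sum>q | q permutes UNIV. of_int (sign q) * (\<Prod>i\<in>UNIV. M $ i $ q i))"
    by (simp add: det_def)
  also have "\<dots> = (\<Sum>p | p permutes UNIV. of_int (sign (\<tau> \<circ> p \<circ> ?\<sigma>)) * (\<Prod>i\<in>UNIV. M $ i $ (\<tau> \<circ> p \<circ> ?\<sigma>) i))"
    by (rule sum.reindex_bij_witness[of _ "\<lambda>p. \<tau> \<circ> p \<circ> ?\<sigma>" "\<lambda>q. ?\<sigma> \<circ> q \<circ> \<tau>"])
      (auto simp: perm perm' conj, auto simp: fun_eq_iff inv)
  also have "\<dots> = (\<Sum>p | p permutes UNIV. of_int (sign p) * (\<Prod>i\<in>UNIV. M $ \<tau> i $ \<tau> (p i)))"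
  proof (intro sum.cong refl)
    fix p :: "'m \<Rightarrow> 'm" assume "p \<in> {p. p permutes UNIV}"
    moreover have "(\<Prod>i\<in>UNIV. M $ i $ (\<tau> \<circ> p \<circ> ?\<sigma>) i) = (\<Prod>i\<in>UNIV. M $ \<tau> i $ (\<tau> \<circ> p \<circ> ?\<sigma>) (\<tau> i))"
      by (rule prod.reindex_bij_betw[symmetric]) (use \<tau> in simp)
    ultimately show "of_int (sign (\<tau> \<circ> p \<circ> ?\<sigma>)) * (\<Prod>i\<in>UNIV. M $ i $ (\<tau> \<circ> p \<circ> ?\<sigma>) i)
        = of_int (sign p) * (\<Prod>i\<in>UNIV. M $ \<tau> i $ \<tau> (p i))"
      by (simp add: sgn inv)
  qed
  finally show ?thesis by (simp add: det_def)
qed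

lemma Basis_cart: "(Basis :: (real ^ 'n::finite) set) = range (\<lambda>i. axis i 1)"
  by (auto simp: Basis_vec_def)

lemma prod_Basis_cart: "prod f (Basis :: (real ^ 'n::finite) set) = (\<Prod>i\<in>UNIV. f (axis i 1))"
  unfolding Basis_cart by (subst prod.reindex) (auto simp: inj_on_def axis_eq_axis)

text \<open>Lebesgue measure is characterized by the volumes of boxes, and relabelling coordinates
  turns a box into one with the same side lengths.\<close>

lemma distr_lborel_reindex:
  fixes \<sigma> :: "'n::finite \<Rightarrow> 'm::finite"
  assumes \<sigma>: "bij \<sigma>"
  shows "distr lborel borel (\<lambda>y :: real ^ 'm. (\<chi> j. y $ \<sigma> j) :: real ^ 'n) = lborel"
proof (rule sym, rule lborel_eqI)
  let ?M = "\<lambda>y :: real ^ 'm. (\<chi> j. y $ \<sigma> j) :: real ^ 'n"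
  have meas: "?M \<in> borel_measurable borel"
    by (intro borel_measurable_continuous_onI continuous_intros)
  fix l u :: "real ^ 'n"
  assume le: "\<And>b. b \<in> Basis \<Longrightarrow> l \<bullet> b \<le> u \<bullet> b"
  have le': "l $ i \<le> u $ i" for i
    using le[of "axis i 1"] by (simp add: inner_axis axis_in_Basis_iff)
  let ?L = "\<lambda>x :: real ^ 'n. (\<chi> i. x $ inv \<sigma> i) :: real ^ 'm"
  have inv: "\<sigma> (inv \<sigma> x) = x" "inv \<sigma> (\<sigma> y) = y" for x y
    using \<sigma> by (simp_all add: bij_is_surj surj_f_inv_f bij_is_inj)
  have "?M -` box l u = box (?L l) (?L u)"
    by (auto simp: mem_box_cart) (metis inv)+
  then have "emeasure (distr lborel borel ?M) (box l u) = emeasure lborel (box (?L l) (?L u))"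
    using meas by (simp add: emeasure_distr)
  also have "\<dots> = (\<Prod>i\<in>UNIV. (?L u - ?L l) $ i)"
  proof (subst emeasure_lborel_box)
    show "?L l \<bullet> b \<le> ?L u \<bullet> b" if "b \<in> Basis" for b
      using that le' by (auto simp: Basis_cart inner_axis)
  qed (simp add: prod_Basis_cart inner_axis)
  also have "(\<Prod>i\<in>UNIV. (?L u - ?L l) $ i) = (\<Prod>j\<in>UNIV. (?L u - ?L l) $ \<sigma> j)"
    by (rule prod.reindex_bij_betw[symmetric]) (use \<sigma> in simp)
  also have "\<dots> = (\<Prod>b\<in>Basis. (u - l) \<bullet> b)"
    by (simp add: inv prod_Basis_cart inner_axis)
  finally show "emeasure (distr lborel borel ?M) (box l u) = (\<Prod>b\<in>Basis. (u - l) \<bullet> b)" .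
qed simp

text \<open>The theorem on absolutely integrable vector-valued maps is applied with values in
  \<open>real ^ 1\<close>, then translated to nonnegative integrals, for which no integrability has
  to be known beforehand.\<close>

lemma nn_integral_change_of_variables_wellorder:
  fixes \<phi> :: "real ^ 'm::{finite,wellorder} \<Rightarrow> real ^ 'm::_" and f :: "real ^ 'm::_ \<Rightarrow> real"
  assumes D: "D \<in> sets borel" and der: "\<And>x. x \<in> D \<Longrightarrow> (\<phi> has_derivative \<phi>' x) (at x)"
    and inj: "inj_on \<phi> D" and nn: "\<And>y. y \<in> \<phi> ` D \<Longrightarrow> f y \<ge> 0"
    and mw: "(\<lambda>x. indicator D x * (\<bar>det (matrix (\<phi>' x))\<bar> * f (\<phi> x))) \<in> borel_measurable borel" (is "?w \<in> _")
    and mu: "(\<lambda>y. indicator (\<phi> ` D) y * f y) \<in> borel_measurable borel" (is "?u \<in> _")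
  shows "(\<integral>\<^sup>+x. ennreal (indicator D x * (\<bar>det (matrix (\<phi>' x))\<bar> * f (\<phi> x))) \<partial>lborel)
    = (\<integral>\<^sup>+y. ennreal (indicator (\<phi> ` D) y * f y) \<partial>lborel)"
proof -
  let ?h = "\<lambda>x. \<bar>det (matrix (\<phi>' x))\<bar> * f (\<phi> x)"
  have cov: "(?h absolutely_integrable_on D \<and> integral D ?h = b)
      \<longleftrightarrow> (f absolutely_integrable_on \<phi> ` D \<and> integral (\<phi> ` D) f = b)" for b
  proof -
    have "(\<lambda>x. \<bar>det (matrix (\<phi>' x))\<bar> *\<^sub>R vec (f (\<phi> x)) :: real ^ 1) absolutely_integrable_on D
          \<and> integral D (\<lambda>x. \<bar>det (matrix (\<phi>' x))\<bar> *\<^sub>R vec (f (\<phi> x)) :: real ^ 1) = vec b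
        \<longleftrightarrow> (\<lambda>y. vec (f y) :: real ^ 1) absolutely_integrable_on (\<phi> ` D) \<and> integral (\<phi> ` D) (\<lambda>y. vec (f y) :: real ^ 1) = vec b"
    proof (rule has_absolute_integral_change_of_variables[OF _ _ inj])
      show "D \<in> sets lebesgue" using D by simp
      show "(\<phi> has_derivative \<phi>' x) (at x within D)" if "x \<in> D" for x
        by (rule has_derivative_at_withinI[OF der[OF that]])
    qed
    then show ?thesis
      by (simp add: absolutely_integrable_on_1_iff integral_on_1_eq)
  qed
  have int: "k absolutely_integrable_on E \<longleftrightarrow> integrable lborel (\<lambda>x. indicator E x * k x)"
    and integ: "k absolutely_integrable_on E \<Longrightarrow> integral E k = (\<integral>x. indicator E x * k x \<partial>lborel)"
    if "(\<lambda>x. indicator E x * k x) \<in> borel_measurable borel" for k :: "real ^ 'm::_ \<Rightarrow> real" and E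
  proof -
    have m: "(\<lambda>x. indicator E x * k x) \<in> lborel \<rightarrow>\<^sub>M borel" using that by simp
    show "k absolutely_integrable_on E \<longleftrightarrow> integrable lborel (\<lambda>x. indicator E x * k x)"
      using integrable_completion[OF m] by (simp add: set_integrable_def)
    show "integral E k = (\<integral>x. indicator E x * k x \<partial>lborel)" if "k absolutely_integrable_on E"
      using set_lebesgue_integral_eq_integral(2)[OF that] integral_completion[OF m]
      by (simp add: set_lebesgue_integral_def)
  qed
  have w0: "?w x \<ge> 0" and u0: "?u y \<ge> 0" for x y
    using nn by (auto simp: indicator_def)
  show ?thesis
  proof (cases "integrable lborel ?w")
    case True
    then have "f absolutely_integrable_on \<phi> ` D \<and> integral (\<phi> ` D) f = integral D ?h"
      using cov int[OF mw] by blast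
    then have "integrable lborel ?u" "(\<integral>y. ?u y \<partial>lborel) = (\<integral>x. ?w x \<partial>lborel)"
      using int[OF mu] integ[OF mu] integ[OF mw] int[OF mw] True by auto
    then show ?thesis
      using True w0 u0 by (subst (1 2) nn_integral_eq_integral) auto
  next
    case False
    \<comment> \<open>Integrability of either side implies that of the other, so in this case both
      nonnegative integrals are infinite.\<close>
    then have "\<not> integrable lborel ?u"
      using cov int[OF mu] int[OF mw] by blast
    then have "(\<integral>\<^sup>+y. ennreal (?u y) \<partial>lborel) = \<infinity>"
      using integrableI_nonneg[of ?u lborel] mu u0 by (auto simp: less_top[symmetric])
    moreover have "(\<integral>\<^sup>+x. ennreal (?w x) \<partial>lborel) = \<infinity>"
      using integrableI_nonneg[of ?w lborel] False mw w0 by (auto simp: less_top[symmetric])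
    ultimately show ?thesis by simp
  qed
qed

text \<open>\<open>\<phi>\<close> is conjugated by the relabelling \<open>M\<close> with inverse
  \<open>L\<close>, which preserves Lebesgue measure and the Jacobian determinant.\<close>

lemma nn_integral_change_of_variables:
  fixes \<phi> :: "real ^ 'n::finite \<Rightarrow> real ^ 'n" and f :: "real ^ 'n \<Rightarrow> real"
  assumes D: "D \<in> sets borel" and der: "\<And>x. x \<in> D \<Longrightarrow> (\<phi> has_derivative \<phi>' x) (at x)"
    and inj: "inj_on \<phi> D" and nn: "\<And>y. y \<in> \<phi> ` D \<Longrightarrow> f y \<ge> 0"
    and mw: "(\<lambda>x. indicator D x * (\<bar>det (matrix (\<phi>' x))\<bar> * f (\<phi> x))) \<in> borel_measurable borel"
    and mu: "(\<lambda>y. indicator (\<phi> ` D) y * f y) \<in> borel_measurable borel"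
  shows "(\<integral>\<^sup>+x. ennreal (indicator D x * (\<bar>det (matrix (\<phi>' x))\<bar> * f (\<phi> x))) \<partial>lborel)
    = (\<integral>\<^sup>+y. ennreal (indicator (\<phi> ` D) y * f y) \<partial>lborel)"
proof -
  obtain \<tau> :: "'n ranked \<Rightarrow> 'n" where \<tau>: "bij \<tau>" using ranked_bij by blast
  define \<sigma> where "\<sigma> = inv \<tau>"
  have \<sigma>: "bij \<sigma>" and inv: "\<And>x. \<tau> (\<sigma> x) = x" "\<And>y. \<sigma> (\<tau> y) = y"
    unfolding \<sigma>_def using \<tau> by (simp_all add: bij_is_surj surj_f_inv_f bij_is_inj bij_imp_bij_inv)
  define M where "M = (\<lambda>y :: real ^ 'n ranked. (\<chi> j. y $ \<sigma> j) :: real ^ 'n)"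
  define L where "L = (\<lambda>x :: real ^ 'n. (\<chi> i. x $ \<tau> i) :: real ^ 'n ranked)"
  have LM: "L (M y) = y" "M (L x) = x" for x y
    by (simp_all add: L_def M_def inv vec_eq_iff)
  have Mm [measurable]: "M \<in> borel_measurable borel" and Lm: "L \<in> borel_measurable borel"
    unfolding M_def L_def by (intro borel_measurable_continuous_onI continuous_intros)+
  have M_L: "bounded_linear M" "bounded_linear L"
    unfolding M_def L_def linear_conv_bounded_linear[symmetric]
    by (auto intro!: linearI simp: vec_eq_iff)
  have lb: "lborel = distr lborel borel M"
    unfolding M_def using distr_lborel_reindex[OF \<sigma>] by simp
  have nni: "(\<integral>\<^sup>+x. ennreal (h x) \<partial>lborel) = (\<integral>\<^sup>+y. ennreal (h (M y)) \<partial>lborel)"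
    if "h \<in> borel_measurable borel" for h :: "real ^ 'n \<Rightarrow> real"
    by (subst lb, subst nn_integral_distr) (use that in auto)
  define \<psi> where "\<psi> y = L (\<phi> (M y))" for y
  define \<psi>' where "\<psi>' y = (\<lambda>h. L (\<phi>' (M y) (M h)))" for y
  have img: "L ` D = M -` D" "\<psi> ` (L ` D) = M -` (\<phi> ` D)"
    using LM by (auto simp: \<psi>_def image_iff) metis+
  have det: "det (matrix (\<psi>' y)) = det (matrix (\<phi>' (M y)))" for y
  proof -
    have Max: "M (axis j 1) = axis (\<tau> j) 1" for j
      by (auto simp: M_def vec_eq_iff axis_def inv)
    have "matrix (\<psi>' y) = (\<chi> i j. matrix (\<phi>' (M y)) $ \<tau> i $ \<tau> j)"
      by (simp add: matrix_def \<psi>'_def L_def Max)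
    then show ?thesis using det_reindex[OF \<tau>] by simp
  qed
  have w: "indicator (L ` D) y * (\<bar>det (matrix (\<psi>' y))\<bar> * f (M (\<psi> y)))
      = indicator D (M y) * (\<bar>det (matrix (\<phi>' (M y)))\<bar> * f (\<phi> (M y)))" for y
    by (simp add: img(1) det \<psi>_def LM indicator_vimage)
  have u: "indicator (\<psi> ` (L ` D)) y * f (M y) = indicator (\<phi> ` D) (M y) * f (M y)" for y
    by (simp add: img(2) indicator_vimage)
  have "(\<integral>\<^sup>+y. ennreal (indicator (L ` D) y * (\<bar>det (matrix (\<psi>' y))\<bar> * f (M (\<psi> y)))) \<partial>lborel)
    = (\<integral>\<^sup>+y. ennreal (indicator (\<psi> ` (L ` D)) y * f (M y)) \<partial>lborel)"
  proof (rule nn_integral_change_of_variables_wellorder)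
    show "L ` D \<in> sets borel"
      unfolding img using measurable_sets[OF Mm D] by simp
    show "(\<psi> has_derivative \<psi>' y) (at y)" if "y \<in> L ` D" for y
    proof -
      have "M y \<in> D" using that img by auto
      then have "((\<lambda>y. \<phi> (M y)) has_derivative (\<lambda>h. \<phi>' (M y) (M h))) (at y)"
        by (rule has_derivative_compose[OF bounded_linear_imp_has_derivative[OF M_L(1)] der])
      then show ?thesis
        unfolding \<psi>_def \<psi>'_def by (rule bounded_linear.has_derivative[OF M_L(2)])
    qed
    show "inj_on \<psi> (L ` D)"
    proof (rule inj_onI)
      fix y z assume yz: "y \<in> L ` D" "z \<in> L ` D" "\<psi> y = \<psi> z"
      have "M y \<in> D" "M z \<in> D"
        using img(1) yz(1,2) by auto
      moreover have "\<phi> (M y) = \<phi> (M z)"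
        using arg_cong[OF yz(3), of M] by (simp only: \<psi>_def LM)
      ultimately have "M y = M z"
        using inj by (simp only: inj_on_def)
      then have "L (M y) = L (M z)" by (rule arg_cong)
      then show "y = z" by (simp only: LM)
    qed
    show "f (M y) \<ge> 0" if "y \<in> \<psi> ` (L ` D)" for y
    proof -
      have "M y \<in> \<phi> ` D" using that img(2) by blast
      then show ?thesis by (rule nn)
    qed
    show "(\<lambda>y. indicator (L ` D) y * (\<bar>det (matrix (\<psi>' y))\<bar> * f (M (\<psi> y)))) \<in> borel_measurable borel"
      unfolding w using measurable_compose[OF Mm mw] by simp
    show "(\<lambda>y. indicator (\<psi> ` (L ` D)) y * f (M y)) \<in> borel_measurable borel"
      unfolding u using measurable_compose[OF Mm mu] by simp
  qed
  then show ?thesis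
    unfolding w u using nni[OF mw] nni[OF mu] by simp
qed

section \<open>Compactly supported partial derivatives integrate to zero\<close>

text \<open>Integrals are translation invariant, so the difference quotients of \<open>F\<close> integrate to zero;
  they converge boundedly to the partial derivative.\<close>

lemma integral_pd_eq_0:
  fixes F :: "real ^ 'n::finite \<Rightarrow> real"
  assumes F: "\<And>x. F differentiable (at x)" and supp: "\<And>x. x \<notin> cball 0 r \<Longrightarrow> F x = 0"
    and bnd: "\<And>x. \<bar>pd i F x\<bar> \<le> C"
  shows "integrable lborel (pd i F)" "(\<integral>x. pd i F x \<partial>lborel) = 0"
proof -
  let ?e = "axis i (1::real) :: real ^ 'n"
  define q where "q m x = (F (x + inverse (real (Suc m)) *\<^sub>R ?e) - F x) * real (Suc m)" for m x
  have cont: "continuous_on UNIV F"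
    using F by (auto intro!: continuous_at_imp_continuous_on differentiable_imp_continuous_within)
  then have Fm [measurable]: "F \<in> borel_measurable borel"
    by (rule borel_measurable_continuous_onI)
  have Fint: "integrable lborel F"
  proof -
    have "integrable lborel (\<lambda>x. indicator (cball 0 r) x *\<^sub>R F x)"
      using borel_integrable_compact[of "cball (0 :: real ^ 'n) r" F] continuous_on_subset[OF cont]
      by (simp add: set_integrable_def)
    moreover have "(\<lambda>x. indicator (cball 0 r) x *\<^sub>R F x) = F"
      using supp by (auto simp: fun_eq_iff indicator_def)
    ultimately show ?thesis by (simp only:)
  qed
  have line: "((\<lambda>t. F (x + t *\<^sub>R ?e)) has_real_derivative pd i F (x + t *\<^sub>R ?e)) (at t)" for x t
    by (rule pd_line[OF F])
  have lim: "(\<lambda>m. q m x) \<longlonglongrightarrow> pd i F x" for x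
  proof -
    have "((\<lambda>h. (F (x + h *\<^sub>R ?e) - F x) / h) \<longlongrightarrow> pd i F x) (at 0)"
      using line[of x 0] by (simp add: DERIV_def)
    moreover have "filterlim (\<lambda>m. inverse (real (Suc m))) (at 0) sequentially"
      using LIMSEQ_inverse_real_of_nat by (auto simp: filterlim_at)
    ultimately have "((\<lambda>m. (F (x + inverse (real (Suc m)) *\<^sub>R ?e) - F x) / inverse (real (Suc m))) \<longlongrightarrow> pd i F x) sequentially"
      by (rule filterlim_compose)
    then show ?thesis
      by (simp add: q_def divide_inverse)
  qed
  have qm [measurable]: "q m \<in> borel_measurable borel" for m
    unfolding q_def[abs_def] by measurable
  \<comment> \<open>All increments have length at most 1, so every quotient vanishes outside the
    ball of radius \<open>r + 1\<close>; inside it, the mean value theorem gives the bound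
    \<open>C\<close>.\<close>
  have bound: "\<bar>q m x\<bar> \<le> C * indicator (cball 0 (r + 1)) x" for m x
  proof (cases "x \<in> cball 0 (r + 1)")
    case True
    define t where "t = inverse (real (Suc m))"
    have "t > 0" by (simp add: t_def)
    obtain s where "F (x + t *\<^sub>R ?e) - F (x + 0 *\<^sub>R ?e) = (t - 0) * pd i F (x + s *\<^sub>R ?e)"
      using MVT2[OF \<open>t > 0\<close>, of "\<lambda>t. F (x + t *\<^sub>R ?e)" "\<lambda>t. pd i F (x + t *\<^sub>R ?e)"] line by blast
    then have "q m x = pd i F (x + s *\<^sub>R ?e)"
      by (simp add: q_def t_def divide_simps)
    then show ?thesis using bnd True by simp
  next
    case False
    define v where "v = inverse (real (Suc m)) *\<^sub>R ?e"
    have "norm v \<le> 1"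
      by (simp add: v_def inverse_le_1_iff)
    moreover have "norm x \<le> norm (x + v) + norm v"
      using norm_triangle_ineq4[of "x + v" v] by simp
    moreover have "norm x > r + 1"
      using False by simp
    ultimately have "x + v \<notin> cball 0 r" "x \<notin> cball 0 r"
      by auto
    then have "q m x = 0" unfolding q_def v_def[symmetric] using supp by simp
    then show ?thesis using False by simp
  qed
  have Cint: "integrable lborel (\<lambda>x :: real ^ 'n. C * indicator (cball 0 (r + 1)) x)"
    by (intro integrable_mult_right integrable_real_indicator emeasure_bounded_finite) auto
  have qint0: "(\<integral>x. q m x \<partial>lborel) = 0" for m
  proof -
    have tr: "lborel = distr lborel borel (\<lambda>x. x + v)" for v :: "real ^ 'n"
      unfolding add.commute[of _ v] using lborel_distr_plus[of v] by simp
    have "integrable (distr lborel borel (\<lambda>x. x + v)) F" for v :: "real ^ 'n"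
      using Fint tr[of v] by simp
    then have i: "integrable lborel (\<lambda>x. F (x + v))" for v
      by (subst (asm) integrable_distr_eq) auto
    have e: "(\<integral>x. F (x + v) \<partial>lborel) = (\<integral>x. F x \<partial>lborel)" for v
      by (subst (2) tr[of v], subst integral_distr) auto
    show ?thesis
      unfolding q_def by (simp add: Bochner_Integration.integral_diff[OF i Fint] e)
  qed
  have mpd: "pd i F \<in> borel_measurable lborel"
    by (rule borel_measurable_LIMSEQ_real[OF lim]) simp
  show "integrable lborel (pd i F)"
    by (rule integrable_dominated_convergence[OF mpd _ Cint, of q]) (use lim bound in auto)
  have "(\<lambda>m. \<integral>x. q m x \<partial>lborel) \<longlonglongrightarrow> (\<integral>x. pd i F x \<partial>lborel)"
    by (rule integral_dominated_convergence[OF mpd _ Cint, of q]) (use lim bound in auto)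
  then show "(\<integral>x. pd i F x \<partial>lborel) = 0"
    using LIMSEQ_unique[of "\<lambda>m. \<integral>x. q m x \<partial>lborel" _ 0] by (simp add: qint0)
qed

section \<open>Charts and tensor transformation laws\<close>

lemma transpose_inner: "v \<bullet> (transpose J *v w) = (J *v v) \<bullet> w" for v w :: "real ^ 'n::finite"
  by (metis dot_lmul_matrix inner_commute transpose_matrix_vector)

lemma congruence_nth:
  "(transpose J ** M ** J) $ i $ j = (\<Sum>a\<in>UNIV. \<Sum>b\<in>UNIV. J $ a $ i * (J $ b $ j * M $ a $ b))"
  for J M :: "real ^ 'n ^ 'n::finite"
proof -
  have "(transpose J ** M ** J) $ i $ j = (\<Sum>b\<in>UNIV. \<Sum>a\<in>UNIV. J $ a $ i * (J $ b $ j * M $ a $ b))"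
    by (simp add: matrix_matrix_mult_def transpose_def sum_distrib_right sum_distrib_left mult_ac)
  then show ?thesis by (subst sum.swap)
qed

lemma open_Collect_preimage:
  assumes "continuous_on S f" "open S" "open U"
  shows "open {x \<in> S. f x \<in> U}"
proof -
  have "{x \<in> S. f x \<in> U} = S \<inter> f -` U" by auto
  then show ?thesis using continuous_open_preimage[OF assms] by simp
qed

lemma borel_Collect_preimage:
  assumes "continuous_on S f" "open S" "E \<in> sets borel"
  shows "{x \<in> S. f x \<in> E} \<in> sets borel"
proof -
  have "{x \<in> S. f x \<in> E} = f -` E \<inter> space (restrict_space borel S)"
    by (auto simp: space_restrict_space)
  moreover have "f -` E \<inter> space (restrict_space borel S) \<in> sets (restrict_space borel S)"
    by (rule measurable_sets[OF borel_measurable_continuous_on_restrict[OF assms(1)] assms(3)])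
  ultimately show ?thesis
    using assms(2) by (simp add: sets_restrict_space_iff)
qed

locale riemannian_manifold =
  fixes A :: "('m::{t2_space, second_countable_topology}, 'n::finite) chart set"
    and g :: "('m, 'n) metric"
  assumes atlas: "smooth_atlas A" and metric: "riemannian_metric A g"
    and compact_M: "compact (UNIV :: 'm set)"
begin

lemma chart_facts:
  assumes "c \<in> A"
  shows "open (fst c)" "open (coord_image c)" "continuous_on (fst c) (snd c)"
    "continuous_on (coord_image c) (coord_inv c)"
    "\<And>p. p \<in> fst c \<Longrightarrow> coord_inv c (snd c p) = p"
    "\<And>x. x \<in> coord_image c \<Longrightarrow> snd c (coord_inv c x) = x"
    "\<And>x. x \<in> coord_image c \<Longrightarrow> coord_inv c x \<in> fst c"
    "\<And>p. p \<in> fst c \<Longrightarrow> snd c p \<in> coord_image c"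
  using assms atlas unfolding smooth_atlas_def is_chart_def homeomorphism_def by blast+

lemma chart_at_facts: "chart_at A p \<in> A" "p \<in> fst (chart_at A p)"
proof -
  have "\<exists>c. c \<in> A \<and> p \<in> fst c"
    using atlas unfolding smooth_atlas_def by blast
  then have "chart_at A p \<in> A \<and> p \<in> fst (chart_at A p)"
    unfolding chart_at_def by (rule someI_ex)
  then show "chart_at A p \<in> A" "p \<in> fst (chart_at A p)" by auto
qed

lemma overlap_eq:
  assumes "c \<in> A"
  shows "overlap c c' = {x \<in> coord_image c. coord_inv c x \<in> fst c'}"
proof (intro set_eqI iffI)
  fix x assume "x \<in> overlap c c'"
  then show "x \<in> {x \<in> coord_image c. coord_inv c x \<in> fst c'}"
    using chart_facts[OF assms] unfolding overlap_def by auto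
next
  fix x assume x: "x \<in> {x \<in> coord_image c. coord_inv c x \<in> fst c'}"
  then have "x = snd c (coord_inv c x)" "coord_inv c x \<in> fst c \<inter> fst c'"
    using chart_facts[OF assms] by auto
  then show "x \<in> overlap c c'"
    unfolding overlap_def by (rule image_eqI)
qed

lemma overlap_subset: "c \<in> A \<Longrightarrow> overlap c c' \<subseteq> coord_image c"
  by (auto simp: overlap_eq)

lemma overlap_open: "c \<in> A \<Longrightarrow> c' \<in> A \<Longrightarrow> open (overlap c c')"
  unfolding overlap_eq by (intro open_Collect_preimage chart_facts)

lemma transition_facts:
  assumes "c \<in> A" "c' \<in> A" "x \<in> overlap c c'"
  shows "transition c c' x \<in> overlap c' c" "transition c c' x \<in> coord_image c'"
    "transition c' c (transition c c' x) = x" "coord_inv c' (transition c c' x) = coord_inv c x"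
proof -
  have p: "coord_inv c x \<in> fst c'" "x \<in> coord_image c" using assms overlap_eq by auto
  show 1: "coord_inv c' (transition c c' x) = coord_inv c x"
    using chart_facts(5)[OF assms(2) p(1)] by (simp add: transition_def)
  show 2: "transition c c' x \<in> coord_image c'"
    using chart_facts(8)[OF assms(2) p(1)] by (simp add: transition_def)
  show "transition c c' x \<in> overlap c' c"
    using 1 2 chart_facts(7)[OF assms(1) p(2)] by (simp add: overlap_eq[OF assms(2)])
  show "transition c' c (transition c c' x) = x"
    using 1 chart_facts(6)[OF assms(1) p(2)] by (simp add: transition_def)
qed

lemma transition_smooth: "c \<in> A \<Longrightarrow> c' \<in> A \<Longrightarrow> smooth_on (overlap c c') (transition c c')"
  using atlas unfolding smooth_atlas_def by blast

lemma transition_differentiable: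
  "c \<in> A \<Longrightarrow> c' \<in> A \<Longrightarrow> x \<in> overlap c c' \<Longrightarrow> transition c c' differentiable (at x)"
  using transition_smooth smooth_on_differentiable by blast

lemma transition_comp_differentiable:
  assumes "c \<in> A" "c' \<in> A" "x \<in> overlap c c'"
  shows "(\<lambda>y. transition c c' y $ a) differentiable (at x)"
  using smooth_on_component[OF overlap_open transition_smooth] assms smooth_on_differentiable by blast

lemma jacobian_inverse:
  assumes "c \<in> A" "c' \<in> A" "x \<in> overlap c c'"
  shows "jacobian c' c (transition c c' x) ** jacobian c c' x = mat 1"
proof -
  have "(jacobian c' c (transition c c' x) ** jacobian c c' x) $ a $ i = (mat 1 :: real ^ 'n ^ 'n) $ a $ i" for a i
  proof -
    have "(jacobian c' c (transition c c' x) ** jacobian c c' x) $ a $ i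
        = pd i (\<lambda>y. transition c' c (transition c c' y) $ a) x"
      using pd_chain[OF transition_comp_differentiable[OF assms(2,1) transition_facts(1)[OF assms]]
          transition_differentiable[OF assms], of i a]
      by (simp add: matrix_matrix_mult_def jacobian_def mult.commute)
    also have "\<dots> = pd i (\<lambda>y. y $ a) x"
      by (rule pd_cong_open[OF overlap_open[OF assms(1,2)] assms(3)])
        (simp add: transition_facts(3)[OF assms(1,2)])
    also have "\<dots> = axis i 1 $ a"
      by (rule pd_has_derivative) (intro bounded_linear_imp_has_derivative bounded_linear_vec_nth)
    finally show ?thesis by (simp add: mat_def axis_def)
  qed
  then show ?thesis by (simp add: vec_eq_iff)
qed

lemma metric_transform:
  "c \<in> A \<Longrightarrow> c' \<in> A \<Longrightarrow> x \<in> overlap c c' \<Longrightarrow>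
    g c x = transpose (jacobian c c' x) ** g c' (transition c c' x) ** jacobian c c' x"
  using metric unfolding riemannian_metric_def by blast

lemma chart_metric: "c \<in> A \<Longrightarrow> metric_chart (coord_image c) (g c)"
  using metric chart_facts(2) unfolding riemannian_metric_def metric_chart_def by blast

lemma vector_field_transform:
  "smooth_vector_field A V \<Longrightarrow> c \<in> A \<Longrightarrow> c' \<in> A \<Longrightarrow> x \<in> overlap c c' \<Longrightarrow>
    V c' (transition c c' x) = jacobian c c' x *v V c x"
  unfolding smooth_vector_field_def by blast

abbreviation vol_density :: "('m, 'n) chart \<Rightarrow> real ^ 'n \<Rightarrow> real" where
  "vol_density c x \<equiv> sqrt (det (g c x))"

lemma vol_density_pos: "c \<in> A \<Longrightarrow> x \<in> coord_image c \<Longrightarrow> vol_density c x > 0"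
  using metric_chart.det_pos[OF chart_metric] by simp

lemma vol_density_transform:
  assumes "c \<in> A" "c' \<in> A" "x \<in> overlap c c'"
  shows "vol_density c x = \<bar>det (jacobian c c' x)\<bar> * vol_density c' (transition c c' x)"
proof -
  have "det (g c x) = (det (jacobian c c' x))\<^sup>2 * det (g c' (transition c c' x))"
    by (simp add: metric_transform[OF assms] det_mul power2_eq_square)
  then show ?thesis by (simp add: real_sqrt_mult)
qed

lemma vol_density_ck:
  assumes "c \<in> A"
  shows "ck (Suc 0) (coord_image c) (vol_density c)"
proof -
  interpret metric_chart "coord_image c" "g c" by (rule chart_metric[OF assms])
  show ?thesis
    by (intro ck_sqrt S_open smooth_on_imp_ck[OF smooth_on_det] G_comp_smooth det_pos)
qed

lemma vol_density_continuous: "c \<in> A \<Longrightarrow> continuous_on (coord_image c) (vol_density c)"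
  using ck_imp_continuous_on[OF vol_density_ck] .

section \<open>The Riemannian measure\<close>

lemma borel_chart_preimage:
  "c \<in> A \<Longrightarrow> E \<in> sets borel \<Longrightarrow> {x \<in> coord_image c. coord_inv c x \<in> E} \<in> sets borel"
  by (intro borel_Collect_preimage chart_facts)

lemma borel_chart_image:
  "c \<in> A \<Longrightarrow> D \<in> sets borel \<Longrightarrow> {p \<in> fst c. snd c p \<in> D} \<in> sets borel"
  by (intro borel_Collect_preimage chart_facts)

lemma density_measurable:
  assumes "c \<in> A" "D \<in> sets borel" "D \<subseteq> coord_image c"
  shows "(\<lambda>x. indicator D x * vol_density c x) \<in> borel_measurable borel"
proof -
  have "(\<lambda>x. indicator (coord_image c) x *\<^sub>R vol_density c x) \<in> borel_measurable borel"
    using borel_measurable_continuous_on_indicator[OF _ vol_density_continuous[OF assms(1)]] chart_facts(2)[OF assms(1)]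
    by auto
  then have "(\<lambda>x. indicator D x * (indicator (coord_image c) x *\<^sub>R vol_density c x)) \<in> borel_measurable borel"
    using assms(2) by (intro borel_measurable_times borel_measurable_indicator) auto
  moreover have "indicator D x * (indicator (coord_image c) x *\<^sub>R vol_density c x) = indicator D x * vol_density c x" for x
    using assms(3) by (auto simp: indicator_def)
  ultimately show ?thesis by (simp only:)
qed

text \<open>The inverse chart made total with a constant value, so that it is Borel measurable on
  all of Euclidean space; in \<open>chart_measure\<close> the density is zero where the constant is
  used.\<close>

definition chart_point :: "('m, 'n) chart \<Rightarrow> real ^ 'n \<Rightarrow> 'm" where
  "chart_point c x = (if x \<in> coord_image c then coord_inv c x else undefined)"

text \<open>The part of the Riemannian measure carried by the domain of \<open>c\<close>, considered
  as a measure on the whole manifold.\<close>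

definition chart_measure :: "('m, 'n) chart \<Rightarrow> 'm measure" where
  "chart_measure c = distr (density lborel (\<lambda>x. ennreal (indicator (coord_image c) x * vol_density c x)))
     borel (chart_point c)"

lemma chart_point_measurable:
  assumes "c \<in> A"
  shows "chart_point c \<in> borel_measurable borel"
proof (rule borel_measurableI)
  fix U :: "'m set" assume "open U"
  then have "{x \<in> coord_image c. coord_inv c x \<in> U} \<in> sets borel"
    using borel_chart_preimage[OF assms] by simp
  moreover have "chart_point c -` U \<inter> space borel =
      {x \<in> coord_image c. coord_inv c x \<in> U} \<union> (if undefined \<in> U then - coord_image c else {})"
    by (auto simp: chart_point_def split: if_splits)
  ultimately show "chart_point c -` U \<inter> space borel \<in> sets borel"
    using chart_facts(2)[OF assms] by auto
qed

lemma sets_chart_measure [simp]: "sets (chart_measure c) = sets borel"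
  by (simp add: chart_measure_def)

lemma emeasure_chart_measure:
  assumes "c \<in> A" "E \<in> sets borel"
  shows "emeasure (chart_measure c) E
    = (\<integral>\<^sup>+x. ennreal (indicator {x \<in> coord_image c. coord_inv c x \<in> E} x * vol_density c x) \<partial>lborel)"
proof -
  have dm: "(\<lambda>x. ennreal (indicator (coord_image c) x * vol_density c x)) \<in> borel_measurable borel"
    using density_measurable[OF assms(1) _ order_refl] chart_facts(2)[OF assms(1)] by simp
  have "emeasure (chart_measure c) E
      = emeasure (density lborel (\<lambda>x. ennreal (indicator (coord_image c) x * vol_density c x))) (chart_point c -` E)"
    unfolding chart_measure_def using assms chart_point_measurable by (subst emeasure_distr) auto
  also have "\<dots> = (\<integral>\<^sup>+x. ennreal (indicator (coord_image c) x * vol_density c x) * indicator (chart_point c -` E) x \<partial>lborel)"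
    using measurable_sets[OF chart_point_measurable[OF assms(1)] assms(2)] dm by (subst emeasure_density) auto
  also have "\<dots> = (\<integral>\<^sup>+x. ennreal (indicator {x \<in> coord_image c. coord_inv c x \<in> E} x * vol_density c x) \<partial>lborel)"
    by (intro nn_integral_cong) (auto simp: indicator_def chart_point_def)
  finally show ?thesis .
qed

text \<open>The change of variables along the transition map: the volume densities in two charts
  differ by the absolute Jacobian determinant.\<close>

lemma chart_measure_eq:
  assumes c: "c \<in> A" "c' \<in> A" and E: "E \<in> sets borel" "E \<subseteq> fst c \<inter> fst c'"
  shows "emeasure (chart_measure c) E = emeasure (chart_measure c') E"
proof -
  let ?D = "{x \<in> coord_image c. coord_inv c x \<in> E}" and ?D' = "{x \<in> coord_image c'. coord_inv c' x \<in> E}"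
  have DO: "?D \<subseteq> overlap c c'" using E by (auto simp: overlap_eq[OF c(1)])
  have img: "transition c c' ` ?D = ?D'"
  proof (intro set_eqI iffI)
    fix y assume "y \<in> transition c c' ` ?D"
    then obtain x where "x \<in> ?D" "y = transition c c' x" by blast
    then show "y \<in> ?D'" using transition_facts[OF c, of x] DO by auto
  next
    fix y assume y: "y \<in> ?D'"
    then have "y \<in> overlap c' c" using E by (auto simp: overlap_eq[OF c(2)])
    note t = transition_facts[OF c(2,1) this]
    have "transition c' c y \<in> ?D" using t y by simp
    then show "y \<in> transition c c' ` ?D" by (rule image_eqI[of y "transition c c'", OF t(3)[symmetric]])
  qed
  have w: "indicator ?D x * (\<bar>det (matrix (\<lambda>h. jacobian c c' x *v h))\<bar> * vol_density c' (transition c c' x))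
      = indicator ?D x * vol_density c x" for x
  proof (cases "x \<in> ?D")
    case True
    then show ?thesis using vol_density_transform[OF c, of x] DO by (auto simp: matrix_of_matrix_vector_mul)
  next
    case False
    then have "indicator ?D x = (0 :: real)" by (rule indicator_simps(2))
    then show ?thesis by (simp only: mult_zero_left)
  qed
  have "(\<integral>\<^sup>+x. ennreal (indicator ?D x * (\<bar>det (matrix (\<lambda>h. jacobian c c' x *v h))\<bar> * vol_density c' (transition c c' x))) \<partial>lborel)
    = (\<integral>\<^sup>+y. ennreal (indicator (transition c c' ` ?D) y * vol_density c' y) \<partial>lborel)"
  proof (rule nn_integral_change_of_variables)
    show "?D \<in> sets borel" by (rule borel_chart_preimage[OF c(1) E(1)])
    show "(transition c c' has_derivative (\<lambda>h. jacobian c c' x *v h)) (at x)" if "x \<in> ?D" for x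
    proof -
      have x: "x \<in> overlap c c'" using that DO by blast
      note d = transition_differentiable[OF c x]
      have "(\<lambda>h. \<Sum>i\<in>UNIV. h $ i *\<^sub>R pd i (transition c c') x) = (\<lambda>h. jacobian c c' x *v h)"
        by (simp add: fun_eq_iff vec_eq_iff jacobian_def matrix_vector_mult_def pd_component[OF d] mult.commute)
      then show ?thesis using has_derivative_pd[OF d] by simp
    qed
    show "inj_on (transition c c') ?D"
      using transition_facts(3)[OF c] DO by (intro inj_on_inverseI[of _ "transition c' c"]) blast
    show "vol_density c' y \<ge> 0" if "y \<in> transition c c' ` ?D" for y
      using that vol_density_pos[OF c(2), of y] unfolding img by auto
    show "(\<lambda>x. indicator ?D x * (\<bar>det (matrix (\<lambda>h. jacobian c c' x *v h))\<bar> * vol_density c' (transition c c' x))) \<in> borel_measurable borel"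
      unfolding w by (rule density_measurable[OF c(1) borel_chart_preimage[OF c(1) E(1)]]) auto
    show "(\<lambda>y. indicator (transition c c' ` ?D) y * vol_density c' y) \<in> borel_measurable borel"
      unfolding img by (rule density_measurable[OF c(2) borel_chart_preimage[OF c(2) E(1)]]) auto
  qed
  then show ?thesis
    unfolding w img emeasure_chart_measure[OF c(1) E(1)] emeasure_chart_measure[OF c(2) E(1)] .
qed

lemma finite_chart_cover: "\<exists>cs :: ('m, 'n) chart list. set cs \<subseteq> A \<and> (\<Union>c\<in>set cs. fst c) = UNIV"
proof -
  have "\<exists>C'\<subseteq>A. finite C' \<and> UNIV \<subseteq> (\<Union>c\<in>C'. fst c)"
  proof (rule compactE_image[OF compact_M, of A fst])
    show "open (fst c)" if "c \<in> A" for c by (rule chart_facts(1)[OF that])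
    show "UNIV \<subseteq> (\<Union>c\<in>A. fst c)"
      using UN_I[where B = fst, OF chart_at_facts] by blast
  qed blast
  then obtain C' where "C' \<subseteq> A" "finite C'" "UNIV \<subseteq> (\<Union>c\<in>C'. fst c)" by blast
  then show ?thesis using finite_list[of C'] by auto
qed

text \<open>Compactness gives finitely many charts, whose domains are cut into disjoint Borel pieces
  \<open>U k\<close>; the measure is the sum of the chart measures on these pieces. By
  \<open>chart_measure_eq\<close> it has the right density in every chart, since on each piece the
  measure of that chart may be used instead.\<close>

lemma riemannian_measure_exists: "\<exists>\<mu>. is_riemannian_measure A g \<mu>"
proof -
  obtain cs :: "('m, 'n) chart list" where cs: "set cs \<subseteq> A" "(\<Union>c\<in>set cs. fst c) = UNIV"
    using finite_chart_cover by blast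
  define N where "N = length cs"
  define U where "U k = fst (cs ! k) - (\<Union>j<k. fst (cs ! j))" for k
  have csA: "cs ! k \<in> A" if "k < N" for k
    using that cs(1) by (auto simp: N_def)
  have Ub: "U k \<in> sets borel" if "k < N" for k
    unfolding U_def using that chart_facts(1)[OF csA] by (intro sets.Diff sets.finite_UN) auto
  have Usub: "U k \<subseteq> fst (cs ! k)" for k by (auto simp: U_def)
  have disj: "disjoint_family_on U {..<N}"
  proof (unfold disjoint_family_on_def, intro ballI impI)
    fix j k :: nat assume "j \<noteq> k"
    then show "U j \<inter> U k = {}"
      by (cases j k rule: linorder_cases) (auto simp: U_def)
  qed
  have cover: "(\<Union>k<N. U k) = UNIV"
  proof (rule equalityI[OF subset_UNIV], rule subsetI)
    fix p :: 'm
    obtain i where i: "i < N" "p \<in> fst (cs ! i)"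
      using cs(2) unfolding N_def by (metis UNIV_I UN_E in_set_conv_nth)
    define k where "k = (LEAST k. p \<in> fst (cs ! k))"
    have "p \<in> fst (cs ! k)" unfolding k_def using i(2) by (rule LeastI)
    moreover have "p \<notin> fst (cs ! j)" if "j < k" for j
      using that not_less_Least unfolding k_def by blast
    moreover have "k < N" using i Least_le[of "\<lambda>k. p \<in> fst (cs ! k)" i] by (simp add: k_def)
    ultimately show "p \<in> (\<Union>k<N. U k)" unfolding U_def by blast
  qed
  define f where "f E = (\<Sum>k<N. emeasure (chart_measure (cs ! k)) (E \<inter> U k))" for E
  define \<mu> where "\<mu> = measure_of UNIV (sets borel) f"
  have sets: "sets \<mu> = sets borel"
    unfolding \<mu>_def using sets.sigma_sets_eq[of "borel :: 'm measure"]
    by (subst sets_measure_of) auto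
  have em: "emeasure \<mu> E = f E" if "E \<in> sets borel" for E
  proof (rule emeasure_measure_of[OF \<mu>_def])
    show "sets borel \<subseteq> Pow (UNIV :: 'm set)" by simp
    show "E \<in> sets \<mu>" using that sets by simp
    show "positive (sets \<mu>) f" by (simp add: positive_def f_def)
    show "countably_additive (sets \<mu>) f"
    proof (rule countably_additiveI)
      fix X :: "nat \<Rightarrow> 'm set"
      assume X: "range X \<subseteq> sets \<mu>" "disjoint_family X" "(\<Union>i. X i) \<in> sets \<mu>"
      have "(\<Sum>i. f (X i)) = (\<Sum>k<N. \<Sum>i. emeasure (chart_measure (cs ! k)) (X i \<inter> U k))"
        unfolding f_def by (rule suminf_sum) auto
      also have "\<dots> = (\<Sum>k<N. emeasure (chart_measure (cs ! k)) (\<Union>i. X i \<inter> U k))"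
      proof (rule sum.cong[OF refl])
        fix k assume "k \<in> {..<N}"
        then show "(\<Sum>i. emeasure (chart_measure (cs ! k)) (X i \<inter> U k)) = emeasure (chart_measure (cs ! k)) (\<Union>i. X i \<inter> U k)"
          using X sets Ub[of k] by (intro suminf_emeasure) (auto simp: disjoint_family_on_def)
      qed
      finally show "(\<Sum>i. f (X i)) = f (\<Union>i. X i)"
        by (simp add: f_def)
    qed
  qed
  have "is_riemannian_measure A g \<mu>"
    unfolding is_riemannian_measure_def
  proof (intro conjI ballI impI)
    show "sets \<mu> = sets borel" by (rule sets)
    fix c D assume c: "c \<in> A" and D: "D \<in> sets borel" "D \<subseteq> coord_image c"
    let ?E = "{p \<in> fst c. snd c p \<in> D}"
    have E: "?E \<in> sets borel" by (rule borel_chart_image[OF c D(1)])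
    have "emeasure \<mu> ?E = (\<Sum>k<N. emeasure (chart_measure (cs ! k)) (?E \<inter> U k))"
      by (simp add: em[OF E] f_def)
    also have "\<dots> = (\<Sum>k<N. emeasure (chart_measure c) (?E \<inter> U k))"
      using csA Ub E Usub c by (intro sum.cong refl chart_measure_eq) auto
    also have "\<dots> = emeasure (chart_measure c) (\<Union>k<N. ?E \<inter> U k)"
      using E Ub disj by (intro sum_emeasure) (auto simp: disjoint_family_on_def)
    also have "(\<Union>k<N. ?E \<inter> U k) = ?E"
      using cover by blast
    also have "emeasure (chart_measure c) ?E = (\<integral>\<^sup>+x. ennreal (indicator {x \<in> coord_image c. coord_inv c x \<in> ?E} x * vol_density c x) \<partial>lborel)"
      by (rule emeasure_chart_measure[OF c E])
    also have "{x \<in> coord_image c. coord_inv c x \<in> ?E} = D"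
      using D chart_facts[OF c] by auto
    also have "(\<integral>\<^sup>+x. ennreal (indicator D x * vol_density c x) \<partial>lborel) = (\<integral>\<^sup>+x\<in>D. ennreal (vol_density c x) \<partial>lborel)"
      by (intro nn_integral_cong) (auto simp: indicator_def)
    finally show "emeasure \<mu> ?E = (\<integral>\<^sup>+x\<in>D. ennreal (vol_density c x) \<partial>lborel)" .
  qed
  then show ?thesis by blast
qed

lemma dVol: "is_riemannian_measure A g (dVol A g)"
  unfolding dVol_def by (rule someI_ex[OF riemannian_measure_exists])

lemma sets_dVol [simp, measurable_cong]: "sets (dVol A g) = sets borel"
  using dVol unfolding is_riemannian_measure_def by blast

lemma space_dVol [simp]: "space (dVol A g) = UNIV"
  using sets_eq_imp_space_eq[OF sets_dVol] by simp

lemma emeasure_dVol_chart: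
  assumes c: "c \<in> A" and E: "E \<in> sets borel"
  shows "emeasure (dVol A g) (E \<inter> fst c) = emeasure (chart_measure c) E"
proof -
  let ?D = "{x \<in> coord_image c. coord_inv c x \<in> E}"
  have "E \<inter> fst c = {p \<in> fst c. snd c p \<in> ?D}"
    using chart_facts[OF c] by auto
  moreover have "?D \<subseteq> coord_image c" by blast
  then have "emeasure (dVol A g) {p \<in> fst c. snd c p \<in> ?D} = (\<integral>\<^sup>+x\<in>?D. ennreal (vol_density c x) \<partial>lborel)"
    using dVol borel_chart_preimage[OF c E] c unfolding is_riemannian_measure_def by blast
  ultimately have "emeasure (dVol A g) (E \<inter> fst c) = (\<integral>\<^sup>+x\<in>?D. ennreal (vol_density c x) \<partial>lborel)"
    by (simp only:)
  also have "\<dots> = (\<integral>\<^sup>+x. ennreal (indicator ?D x * vol_density c x) \<partial>lborel)"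
    by (intro nn_integral_cong) (auto simp: indicator_def)
  finally show ?thesis by (simp add: emeasure_chart_measure[OF c E])
qed

text \<open>Restricted to the domain of \<open>c\<close>, \<open>dVol\<close> is
  \<open>chart_measure c\<close>, an image measure; the integral of a function supported there is
  transferred along it.\<close>

lemma integral_in_chart:
  fixes f :: "'m \<Rightarrow> real"
  assumes c: "c \<in> A" and f: "f \<in> borel_measurable borel" and supp: "\<And>p. p \<notin> fst c \<Longrightarrow> f p = 0"
  shows "(\<integral>p. f p \<partial>dVol A g) = (\<integral>x. indicator (coord_image c) x * vol_density c x * f (coord_inv c x) \<partial>lborel)"
proof -
  have fc: "fst c \<in> sets borel" using chart_facts(1)[OF c] by simp
  have eq: "density (dVol A g) (\<lambda>p. ennreal (indicator (fst c) p)) = chart_measure c"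
  proof (rule measure_eqI)
    fix E assume "E \<in> sets (density (dVol A g) (\<lambda>p. ennreal (indicator (fst c) p)))"
    then have E: "E \<in> sets borel" by simp
    have "emeasure (density (dVol A g) (\<lambda>p. ennreal (indicator (fst c) p))) E
        = (\<integral>\<^sup>+p. ennreal (indicator (fst c) p) * indicator E p \<partial>dVol A g)"
      using E fc by (subst emeasure_density) auto
    also have "\<dots> = (\<integral>\<^sup>+p. indicator (E \<inter> fst c) p \<partial>dVol A g)"
      by (intro nn_integral_cong) (auto simp: indicator_def)
    also have "\<dots> = emeasure (dVol A g) (E \<inter> fst c)"
      using E fc by (intro nn_integral_indicator) auto
    finally show "emeasure (density (dVol A g) (\<lambda>p. ennreal (indicator (fst c) p))) E = emeasure (chart_measure c) E"
      by (simp add: emeasure_dVol_chart[OF c E])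
  qed simp
  have dm: "(\<lambda>x. indicator (coord_image c) x * vol_density c x) \<in> borel_measurable borel"
    using density_measurable[OF c _ order_refl] chart_facts(2)[OF c] by simp
  have "(\<integral>p. f p \<partial>dVol A g) = (\<integral>p. indicator (fst c) p *\<^sub>R f p \<partial>dVol A g)"
    using supp by (intro Bochner_Integration.integral_cong) (auto simp: indicator_def)
  also have "\<dots> = (\<integral>p. f p \<partial>density (dVol A g) (\<lambda>p. ennreal (indicator (fst c) p)))"
    using f fc by (subst integral_density) auto
  also have "\<dots> = (\<integral>x. f (chart_point c x) \<partial>density lborel (\<lambda>x. ennreal (indicator (coord_image c) x * vol_density c x)))"
    unfolding eq chart_measure_def using f chart_point_measurable[OF c] by (subst integral_distr) auto
  also have "\<dots> = (\<integral>x. (indicator (coord_image c) x * vol_density c x) *\<^sub>R f (chart_point c x) \<partial>lborel)"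
  proof (subst integral_density)
    show "(\<lambda>x. f (chart_point c x)) \<in> borel_measurable lborel"
      using measurable_compose[OF chart_point_measurable[OF c] f] by simp
    show "(\<lambda>x. indicator (coord_image c) x * vol_density c x) \<in> borel_measurable lborel"
      using dm by simp
    show "AE x in lborel. 0 \<le> indicator (coord_image c) x * vol_density c x"
      using vol_density_pos[OF c] by (intro AE_I2) (auto simp: indicator_def less_imp_le)
  qed simp
  also have "\<dots> = (\<integral>x. indicator (coord_image c) x * vol_density c x * f (coord_inv c x) \<partial>lborel)"
    by (intro Bochner_Integration.integral_cong) (auto simp: indicator_def chart_point_def)
  finally show ?thesis .
qed

section \<open>Coordinate balls, finiteness of the volume, and continuous integrands\<close>

lemma chart_ball:
  assumes "c \<in> A" "p \<in> fst c"
  obtains r where "r > 0" "cball (snd c p) r \<subseteq> coord_image c"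
  using chart_facts(2,8)[OF assms(1)] assms(2) open_contains_cball by blast

lemma chart_at_ball:
  "\<exists>r. \<forall>p. r p > 0 \<and> cball (snd (chart_at A p) p) (r p) \<subseteq> coord_image (chart_at A p)"
proof (rule choice, rule allI)
  fix p
  show "\<exists>r>0. cball (snd (chart_at A p) p) r \<subseteq> coord_image (chart_at A p)"
    by (rule chart_ball[OF chart_at_facts[of p]]) blast
qed

lemma chart_ball_open:
  assumes "c \<in> A"
  shows "open {q \<in> fst c. snd c q \<in> ball x r}"
  by (intro open_Collect_preimage chart_facts assms open_ball)

text \<open>Finite covers by coordinate balls serve twice: to bound the total volume and to carry
  the partition of unity.\<close>

lemma chart_ball_cover:
  assumes r: "\<And>p. r p > 0"
  obtains I where "finite I" "\<And>q. \<exists>p\<in>I. q \<in> fst (chart_at A p) \<and> snd (chart_at A p) q \<in> ball (snd (chart_at A p) p) (r p)"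
proof -
  let ?U = "\<lambda>p. {q \<in> fst (chart_at A p). snd (chart_at A p) q \<in> ball (snd (chart_at A p) p) (r p)}"
  have "\<exists>I\<subseteq>UNIV. finite I \<and> UNIV \<subseteq> (\<Union>p\<in>I. ?U p)"
  proof (rule compactE_image[OF compact_M, of UNIV ?U])
    show "open (?U p)" for p by (rule chart_ball_open[OF chart_at_facts(1)])
    have "p \<in> ?U p" for p using r chart_at_facts by simp
    then show "UNIV \<subseteq> (\<Union>p\<in>UNIV. ?U p)" by blast
  qed blast
  then obtain I where "finite I" "UNIV \<subseteq> (\<Union>p\<in>I. ?U p)" by blast
  then show ?thesis by (intro that[of I]) auto
qed

text \<open>The density is bounded on a closed coordinate ball, though it need not be on the whole
  coordinate image; hence the cover by balls.\<close>

lemma finite_measure_dVol: "finite_measure (dVol A g)"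
proof -
  let ?c = "chart_at A"
  obtain r where r: "\<And>p. r p > 0 \<and> cball (snd (?c p) p) (r p) \<subseteq> coord_image (?c p)"
    using chart_at_ball by blast
  let ?B = "\<lambda>p. ball (snd (?c p) p) (r p)"
  let ?U = "\<lambda>p. {q \<in> fst (?c p). snd (?c p) q \<in> ?B p}"
  obtain I where I: "finite I" "\<And>q. \<exists>p\<in>I. q \<in> fst (?c p) \<and> snd (?c p) q \<in> ?B p"
    using chart_ball_cover[of r] r by metis
  have fin: "emeasure (dVol A g) (?U p) < \<infinity>" for p
  proof -
    have "continuous_on (cball (snd (?c p) p) (r p)) (vol_density (?c p))"
      using vol_density_continuous[OF chart_at_facts(1)] r continuous_on_subset by blast
    then have "compact (vol_density (?c p) ` cball (snd (?c p) p) (r p))"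
      by (rule compact_continuous_image) simp
    then obtain C where C: "\<And>x. x \<in> cball (snd (?c p) p) (r p) \<Longrightarrow> \<bar>vol_density (?c p) x\<bar> \<le> C"
      using compact_imp_bounded bounded_iff by (metis imageI real_norm_def)
    have "?B p \<subseteq> coord_image (?c p)"
      using r[of p] ball_subset_cball by blast
    then have "emeasure (dVol A g) (?U p) = (\<integral>\<^sup>+x\<in>?B p. ennreal (vol_density (?c p) x) \<partial>lborel)"
      using dVol chart_at_facts(1)[of p] borel_open[OF open_ball] unfolding is_riemannian_measure_def by blast
    also have "\<dots> \<le> (\<integral>\<^sup>+x. ennreal C * indicator (?B p) x \<partial>lborel)"
      using C ball_subset_cball by (intro nn_integral_mono) (fastforce simp: indicator_def intro!: ennreal_leI dest: abs_le_D1)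
    also have "\<dots> = ennreal C * emeasure lborel (?B p)"
      by (rule nn_integral_cmult_indicator) simp
    also have "\<dots> < \<infinity>"
      using emeasure_bounded_finite[OF bounded_ball[of "snd (?c p) p" "r p"]] by (simp add: ennreal_mult_less_top)
    finally show ?thesis .
  qed
  have Ub: "?U p \<in> sets borel" for p
    using chart_ball_open[OF chart_at_facts(1)] by simp
  have "UNIV = (\<Union>p\<in>I. ?U p)" using I(2) by blast
  then have "emeasure (dVol A g) UNIV \<le> (\<Sum>p\<in>I. emeasure (dVol A g) (?U p))"
    using emeasure_subadditive_finite[OF I(1), of ?U "dVol A g"] Ub by auto
  also have "\<dots> < \<infinity>" using fin I(1) by (simp add: less_top)
  finally show ?thesis by (intro finite_measureI) simp
qed

lemma continuous_integrable:
  fixes f :: "'m \<Rightarrow> real"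
  assumes "continuous_on UNIV f"
  shows "f \<in> borel_measurable borel" "integrable (dVol A g) f"
proof -
  interpret finite_measure "dVol A g" by (rule finite_measure_dVol)
  show m: "f \<in> borel_measurable borel" using assms by (rule borel_measurable_continuous_onI)
  obtain C where "\<And>p. norm (f p) \<le> C"
    using compact_imp_bounded[OF compact_continuous_image[OF assms compact_M]] bounded_iff by (metis UNIV_I imageI)
  then show "integrable (dVol A g) f"
    using m by (intro integrable_const_bound[of f C]) auto
qed

lemma continuous_from_charts:
  assumes "\<And>c. c \<in> A \<Longrightarrow> continuous_on (coord_image c) (\<lambda>x. f (coord_inv c x))"
  shows "continuous_on UNIV f"
proof -
  have "continuous_on (\<Union>(fst ` A)) f"
  proof (rule continuous_on_open_Union)
    show "open s" if "s \<in> fst ` A" for s using that chart_facts(1) by blast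
    show "continuous_on s f" if s: "s \<in> fst ` A" for s
    proof -
      obtain c where c: "c \<in> A" "s = fst c" using s by blast
      have "continuous_on (fst c) (\<lambda>p. f (coord_inv c (snd c p)))"
        by (rule continuous_on_compose2[OF assms[OF c(1)] chart_facts(3)[OF c(1)]]) (use chart_facts(8)[OF c(1)] in auto)
      then show ?thesis
        unfolding c(2) by (rule continuous_on_eq) (simp add: chart_facts(5)[OF c(1)])
    qed
  qed
  moreover have "\<Union>(fst ` A) = UNIV"
    using chart_at_facts by blast
  ultimately show ?thesis by simp
qed

text \<open>If \<open>f\<close> were nonzero somewhere, the set where it is nonzero would be a
  nonempty open null set; in a chart, where the density is positive, this would give a nonempty open
  set of Lebesgue measure zero.\<close>

lemma integral_eq_0_imp_zero:
  fixes f :: "'m \<Rightarrow> real"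
  assumes cont: "continuous_on UNIV f" and nn: "\<And>p. f p \<ge> 0" and le: "(\<integral>p. f p \<partial>dVol A g) \<le> 0"
  shows "f p = 0"
proof (rule ccontr)
  assume "f p \<noteq> 0"
  note ci = continuous_integrable[OF cont]
  have "(\<integral>p. f p \<partial>dVol A g) = 0"
    using le nn by (intro antisym integral_nonneg) auto
  then have "AE p in dVol A g. f p = 0"
    using integral_nonneg_eq_0_iff_AE[OF ci(2)] nn by auto
  let ?N = "{p. f p \<noteq> 0}"
  have "?N \<in> sets borel"
    using ci(1) by measurable
  then have N0: "emeasure (dVol A g) ?N = 0"
    using \<open>AE p in dVol A g. f p = 0\<close> by (subst (asm) AE_iff_measurable[of ?N]) auto
  let ?c = "chart_at A p"
  let ?D = "{x \<in> coord_image ?c. coord_inv ?c x \<in> ?N}"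
  have "open ?N"
    by (intro open_Collect_neq cont continuous_on_const)
  then have "open ?D"
    by (intro open_Collect_preimage chart_facts chart_at_facts)
  moreover have "snd ?c p \<in> ?D"
    using chart_facts(5,8)[OF chart_at_facts(1) chart_at_facts(2)[of p]] \<open>f p \<noteq> 0\<close> by simp
  ultimately have "?D \<notin> null_sets lborel"
    using open_not_negligible[of ?D] null_sets_completionI[of ?D lborel] by (auto simp: negligible_iff_null_sets)
  have "emeasure (chart_measure ?c) ?N \<le> emeasure (dVol A g) ?N"
    unfolding emeasure_dVol_chart[OF chart_at_facts(1) \<open>?N \<in> sets borel\<close>, symmetric]
    using \<open>?N \<in> sets borel\<close> by (intro emeasure_mono) auto
  then have "(\<integral>\<^sup>+x. ennreal (indicator ?D x * vol_density ?c x) \<partial>lborel) = 0"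
    using N0 emeasure_chart_measure[OF chart_at_facts(1) \<open>?N \<in> sets borel\<close>] by simp
  then have "AE x in lborel. ennreal (indicator ?D x * vol_density ?c x) = 0"
    using density_measurable[OF chart_at_facts(1) borel_chart_preimage[OF chart_at_facts(1) \<open>?N \<in> sets borel\<close>]]
    by (subst (asm) nn_integral_0_iff_AE) auto
  then have "AE x in lborel. x \<notin> ?D"
  proof eventually_elim
    case (elim x)
    show ?case
    proof
      assume "x \<in> ?D"
      then show False using elim vol_density_pos[OF chart_at_facts(1), of x p] by (simp add: ennreal_eq_0_iff)
    qed
  qed
  then have "?D \<in> null_sets lborel"
    using borel_chart_preimage[OF chart_at_facts(1) \<open>?N \<in> sets borel\<close>] by (subst (asm) AE_iff_null_sets[symmetric]) auto
  then show False using \<open>?D \<notin> null_sets lborel\<close> by blast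
qed

end

section \<open>The divergence theorem\<close>

lemma ck_Un:
  assumes "open S" "open T" "ck k S f" "ck k T f"
  shows "ck k (S \<union> T) f"
  using assms(3,4)
  by (induction k arbitrary: f) (auto intro: continuous_on_open_Un assms(1,2))

lemma DERIV_max_0_square: "((\<lambda>t. (max 0 t)\<^sup>2) has_real_derivative 2 * max 0 t) (at t)"
proof (cases t "0 :: real" rule: linorder_cases)
  case less
  have "((\<lambda>_. 0) has_real_derivative 2 * max 0 t) (at t)"
    using less by (auto intro!: derivative_eq_intros)
  then show ?thesis
    by (rule has_field_derivative_transform_within_open[of _ _ _ "{..<0}"]) (use less in auto)
next
  case greater
  have "((\<lambda>t. t\<^sup>2) has_real_derivative 2 * max 0 t) (at t)"
    using greater by (auto intro!: derivative_eq_intros)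
  then show ?thesis
    by (rule has_field_derivative_transform_within_open[of _ _ _ "{0<..}"]) (use greater in auto)
next
  case equal
  have "((\<lambda>h :: real. (max 0 h)\<^sup>2 / h) \<longlongrightarrow> 0) (at 0)"
  proof (rule Lim_null_comparison)
    show "\<forall>\<^sub>F h :: real in at 0. norm ((max 0 h)\<^sup>2 / h) \<le> \<bar>h\<bar>"
      by (intro always_eventually allI) (auto simp: max_def power2_eq_square)
    show "((\<lambda>h :: real. \<bar>h\<bar>) \<longlongrightarrow> 0) (at 0)"
      by (rule tendsto_rabs_zero) (rule tendsto_ident_at)
  qed
  then show ?thesis using equal by (simp add: DERIV_def)
qed

text \<open>For \<open>r > 0\<close> this is positive exactly on the open ball. Squaring the
  positive part makes it of class C^1, which is enough because cutoffs are differentiated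
  once.\<close>

definition bump :: "real ^ 'n::finite \<Rightarrow> real \<Rightarrow> real ^ 'n \<Rightarrow> real" where
  "bump x r y = (max 0 (r\<^sup>2 - (y - x) \<bullet> (y - x)))\<^sup>2"

lemma bump_nonneg: "bump x r y \<ge> 0"
  by (simp add: bump_def)

lemma bump_pos: "y \<in> ball x r \<Longrightarrow> bump x r y > 0"
proof -
  assume "y \<in> ball x r"
  then have "norm (y - x) < r" by (simp add: dist_norm norm_minus_commute)
  then have "(norm (y - x))\<^sup>2 < r\<^sup>2" by (intro power_strict_mono) auto
  then show ?thesis by (simp add: bump_def dot_square_norm)
qed

lemma bump_zero: "r > 0 \<Longrightarrow> y \<notin> cball x r \<Longrightarrow> bump x r y = 0"
proof -
  assume "r > 0" "y \<notin> cball x r"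
  then have "r\<^sup>2 \<le> (norm (y - x))\<^sup>2"
    by (intro power_mono) (auto simp: dist_norm norm_minus_commute)
  then show ?thesis by (simp add: bump_def dot_square_norm)
qed

lemma bump_ck: "ck (Suc 0) UNIV (bump x r)"
proof (rule ck_SucI[OF open_UNIV])
  fix y
  have "((\<lambda>y. r\<^sup>2 - (y - x) \<bullet> (y - x)) has_derivative (\<lambda>h. - 2 * ((y - x) \<bullet> h))) (at y)"
    by (auto intro!: derivative_eq_intros simp: inner_commute)
  from has_derivative_compose[OF this DERIV_max_0_square[unfolded has_field_derivative_def]]
  show "(bump x r has_derivative (\<lambda>h. 2 * max 0 (r\<^sup>2 - (y - x) \<bullet> (y - x)) * (- 2 * ((y - x) \<bullet> h)))) (at y)"
    unfolding bump_def[abs_def] .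
next
  fix i
  show "ck 0 UNIV (\<lambda>y. 2 * max 0 (r\<^sup>2 - (y - x) \<bullet> (y - x)) * (- 2 * ((y - x) \<bullet> axis i 1)))"
    by (auto intro!: continuous_intros)
qed

context riemannian_manifold
begin

definition C1 :: "('m \<Rightarrow> real) \<Rightarrow> bool" where
  "C1 f \<longleftrightarrow> (\<forall>c\<in>A. ck (Suc 0) (coord_image c) (\<lambda>x. f (coord_inv c x)))"

lemma C1_continuous: "C1 f \<Longrightarrow> continuous_on UNIV f"
  by (rule continuous_from_charts) (auto simp: C1_def intro: ck_imp_continuous_on simp del: ck.simps)

lemma C1_differentiable:
  "C1 f \<Longrightarrow> c \<in> A \<Longrightarrow> x \<in> coord_image c \<Longrightarrow> (\<lambda>x. f (coord_inv c x)) differentiable (at x)"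
  unfolding C1_def using ck_differentiable by blast

text \<open>\<open>vf_deriv\<close> is evaluated in the chart selected by \<open>chart_at\<close>;
  the chain rule and the transformation law of \<open>X\<close> carry the value over to
  \<open>c\<close>.\<close>

lemma vf_deriv_chart:
  assumes X: "smooth_vector_field A X" and f: "C1 f" and c: "c \<in> A" "x \<in> coord_image c"
  shows "vf_deriv A X f (coord_inv c x) = (\<Sum>i\<in>UNIV. X c x $ i * pd i (\<lambda>y. f (coord_inv c y)) x)"
proof -
  let ?p = "coord_inv c x"
  let ?c = "chart_at A ?p"
  note c' = chart_at_facts[of ?p]
  have x: "x \<in> overlap c ?c" using c c' by (simp add: overlap_eq)
  let ?y = "transition c ?c x"
  have snd: "snd ?c ?p = ?y" by (simp add: transition_def)
  have "pd i (\<lambda>y. f (coord_inv c y)) x = (\<Sum>j\<in>UNIV. jacobian c ?c x $ j $ i * pd j (\<lambda>y. f (coord_inv ?c y)) ?y)" for i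
  proof -
    have "pd i (\<lambda>y. f (coord_inv c y)) x = pd i (\<lambda>y. f (coord_inv ?c (transition c ?c y))) x"
      by (rule pd_cong_open[OF overlap_open[OF c(1) c'(1)] x]) (simp add: transition_facts(4)[OF c(1) c'(1)])
    also have "\<dots> = (\<Sum>j\<in>UNIV. pd i (\<lambda>y. transition c ?c y $ j) x *\<^sub>R pd j (\<lambda>y. f (coord_inv ?c y)) ?y)"
      by (rule pd_chain[OF C1_differentiable[OF f c'(1) transition_facts(2)[OF c(1) c'(1) x]]
          transition_differentiable[OF c(1) c'(1) x]])
    finally show ?thesis by (simp add: jacobian_def)
  qed
  then have "(\<Sum>i\<in>UNIV. X c x $ i * pd i (\<lambda>y. f (coord_inv c y)) x)
      = (\<Sum>j\<in>UNIV. (\<Sum>i\<in>UNIV. jacobian c ?c x $ j $ i * X c x $ i) * pd j (\<lambda>y. f (coord_inv ?c y)) ?y)"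
    unfolding sum_distrib_left sum_distrib_right
    by (subst sum.swap) (simp add: sum_distrib_left mult_ac)
  also have "\<dots> = (\<Sum>j\<in>UNIV. X ?c ?y $ j * pd j (\<lambda>y. f (coord_inv ?c y)) ?y)"
    by (simp add: vector_field_transform[OF X c(1) c'(1) x] matrix_vector_mult_def)
  finally show ?thesis
    by (simp add: vf_deriv_def Let_def snd comp_def)
qed

lemma vector_field_ck: "smooth_vector_field A X \<Longrightarrow> c \<in> A \<Longrightarrow> ck k (coord_image c) (\<lambda>x. X c x $ i)"
  by (intro smooth_on_imp_ck smooth_on_component chart_facts) (auto simp: smooth_vector_field_def)

lemma vf_deriv_continuous:
  assumes X: "smooth_vector_field A X" and f: "C1 f"
  shows "continuous_on UNIV (vf_deriv A X f)"
proof (rule continuous_from_charts)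
  fix c assume c: "c \<in> A"
  have "continuous_on (coord_image c) (pd i (\<lambda>y. f (coord_inv c y)))" for i
    using f c by (auto simp: C1_def)
  then have "continuous_on (coord_image c) (\<lambda>x. \<Sum>i\<in>UNIV. X c x $ i * pd i (\<lambda>y. f (coord_inv c y)) x)"
    using ck_imp_continuous_on[OF vector_field_ck[OF X c, of 0]] by (intro continuous_on_sum continuous_on_mult) auto
  then show "continuous_on (coord_image c) (\<lambda>x. vf_deriv A X f (coord_inv c x))"
    by (rule continuous_on_eq) (simp add: vf_deriv_chart[OF X f c])
qed

lemma coord_inv_image_compact:
  assumes "c \<in> A" "compact K" "K \<subseteq> coord_image c"
  shows "compact (coord_inv c ` K)"
  using assms chart_facts(4) continuous_on_subset by (blast intro: compact_continuous_image)

text \<open>\<open>D\<close> is div X, so the integrand is the divergence of \<rho> X. In the chart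
  it becomes a sum of partial derivatives of compactly supported functions, each of integral
  zero.\<close>

lemma local_divergence:
  assumes X: "smooth_vector_field A X" and c: "c \<in> A"
    and D: "\<And>x. x \<in> coord_image c \<Longrightarrow>
      (\<Sum>k\<in>UNIV. pd k (\<lambda>y. vol_density c y * X c y $ k) x) = vol_density c x * D (coord_inv c x)"
    and Dc: "continuous_on UNIV D"
    and \<rho>: "C1 \<rho>" and K: "compact K" "K \<subseteq> coord_image c" and supp: "\<And>p. p \<notin> coord_inv c ` K \<Longrightarrow> \<rho> p = 0"
  shows "(\<integral>p. \<rho> p * D p + vf_deriv A X \<rho> p \<partial>dVol A g) = 0"
proof -
  let ?S = "coord_image c"
  define h where "h p = \<rho> p * D p + vf_deriv A X \<rho> p" for p
  define r where "r x = \<rho> (coord_inv c x)" for x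
  \<comment> \<open>The components of \<rho> X times the volume density, extended by zero beyond the
    chart.\<close>
  define F where "F k x = (if x \<in> ?S then vol_density c x * X c x $ k * r x else 0)" for k x
  have S: "open ?S" by (rule chart_facts(2)[OF c])
  have Kc: "closed K" using K(1) compact_imp_closed by blast
  have rK: "r x = 0" if "x \<in> ?S" "x \<notin> K" for x
  proof -
    have "coord_inv c x \<notin> coord_inv c ` K"
    proof
      assume "coord_inv c x \<in> coord_inv c ` K"
      then obtain y where y: "y \<in> K" "coord_inv c x = coord_inv c y" by blast
      have "x = y"
        using arg_cong[OF y(2), of "snd c"] chart_facts(6)[OF c] that(1) y(1) K(2) by auto
      then show False using y(1) that(2) by simp
    qed
    then show ?thesis by (simp add: r_def supp)
  qed
  have F0: "F k x = 0" if "x \<notin> K" for k x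
    using rK that by (simp add: F_def)
  have ckF: "ck (Suc 0) ?S (F k)" for k
  proof -
    have "ck (Suc 0) ?S r"
      using \<rho> c unfolding C1_def r_def[abs_def] by blast
    then have "ck (Suc 0) ?S (\<lambda>x. vol_density c x * X c x $ k * r x)"
      by (intro ck_mult S vol_density_ck[OF c] vector_field_ck[OF X c])
    then show ?thesis
      by (subst ck_cong[OF S, of "F k" "\<lambda>x. vol_density c x * X c x $ k * r x"]) (auto simp: F_def simp del: ck.simps)
  qed
  \<comment> \<open>The extension is of class C^1 on the coordinate image, and it is zero on the
    complement of \<open>K\<close>; these two open sets cover the space.\<close>
  have ckF': "ck (Suc 0) UNIV (F k)" for k
  proof -
    have "ck (Suc 0) (- K) (F k)"
      using ck_cong[of "- K" "F k" "\<lambda>_. 0" "Suc 0"] Kc F0 ck_const[of "Suc 0" "- K"] by (simp add: open_Compl del: ck.simps)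
    then have "ck (Suc 0) (?S \<union> - K) (F k)"
      using Kc by (intro ck_Un S ckF) (auto simp: open_Compl)
    moreover have "?S \<union> - K = UNIV" using K(2) by blast
    ultimately show ?thesis by (simp only:)
  qed
  have pdF0: "pd k (F k) x = 0" if "x \<notin> K" for k x
    using pd_cong_open[of "- K" x "F k" "\<lambda>_. 0" k] that Kc F0 by (simp add: open_Compl pd_const)
  obtain R where "\<forall>y\<in>K. dist 0 y \<le> R"
    using compact_imp_bounded[OF K(1)] bounded_any_center[of K 0] by blast
  then have R: "K \<subseteq> cball 0 R" by auto
  have int0: "integrable lborel (pd k (F k)) \<and> (\<integral>x. pd k (F k) x \<partial>lborel) = 0" for k
  proof -
    have "continuous_on UNIV (pd k (F k))"
      using ckF'[of k] by simp
    then have "continuous_on K (pd k (F k))"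
      by (rule continuous_on_subset) simp
    then obtain C where C: "\<And>x. x \<in> K \<Longrightarrow> norm (pd k (F k) x) \<le> C"
      using compact_imp_bounded[OF compact_continuous_image[OF _ K(1)]] bounded_iff by (metis imageI)
    \<comment> \<open>The maximum covers the points outside \<open>K\<close>, and the case of empty
      \<open>K\<close>, where \<open>C\<close> may be negative.\<close>
    have "\<bar>pd k (F k) x\<bar> \<le> max C 0" for x
      using C[of x] pdF0[of x k] by (cases "x \<in> K") auto
    moreover have "F k differentiable (at x)" for x
      using ckF'[of k] by simp
    moreover have "F k x = 0" if "x \<notin> cball 0 R" for x
      using F0 R that by blast
    ultimately show ?thesis
      using integral_pd_eq_0[of "F k" R k "max C 0"] by blast
  qed
  \<comment> \<open>Outside the domain \<open>vf_deriv\<close> is computed in another chart; its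
    value is zero because \<open>\<rho>\<close> vanishes on a neighbourhood of \<open>p\<close>, the
    image of \<open>K\<close> being closed in a Hausdorff space.\<close>
  have hsupp: "h p = 0" if "p \<notin> fst c" for p
  proof -
    let ?U = "- coord_inv c ` K"
    have U: "open ?U"
      using compact_imp_closed[OF coord_inv_image_compact[OF c K]] by (simp add: open_Compl)
    have pU: "p \<in> ?U" using that K(2) chart_facts(7)[OF c] by blast
    let ?c = "chart_at A p"
    note c' = chart_at_facts[of p]
    let ?V = "{x \<in> coord_image ?c. coord_inv ?c x \<in> ?U}"
    have V: "open ?V" by (intro open_Collect_preimage chart_facts c' U)
    have x: "snd ?c p \<in> ?V" using chart_facts(5,8)[OF c'] pU by simp
    have "pd i (\<lambda>y. \<rho> (coord_inv ?c y)) (snd ?c p) = 0" for i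
      using pd_cong_open[OF V x, of "\<lambda>y. \<rho> (coord_inv ?c y)" "\<lambda>_. 0" i] supp by (simp add: pd_const)
    then have "vf_deriv A X \<rho> p = 0"
      by (simp add: vf_deriv_def Let_def comp_def)
    moreover have "\<rho> p = 0" using pU supp by blast
    ultimately show ?thesis by (simp add: h_def)
  qed
  have hc: "continuous_on UNIV h"
    unfolding h_def using C1_continuous[OF \<rho>] Dc vf_deriv_continuous[OF X \<rho>] by (intro continuous_intros)
  have eq: "indicator ?S x * vol_density c x * h (coord_inv c x) = (\<Sum>k\<in>UNIV. pd k (F k) x)" for x
  proof (cases "x \<in> ?S")
    case True
    have dr: "r differentiable (at x)"
      unfolding r_def[abs_def] by (rule C1_differentiable[OF \<rho> c True])
    have dv: "(\<lambda>y. vol_density c y * X c y $ k) differentiable (at x)" for k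
      using ck_differentiable[OF ck_mult[OF S vol_density_ck[OF c] vector_field_ck[OF X c]] True] .
    have "pd k (F k) x = pd k (\<lambda>y. vol_density c y * X c y $ k) x * r x + vol_density c x * X c x $ k * pd k r x" for k
    proof -
      have "pd k (F k) x = pd k (\<lambda>y. vol_density c y * X c y $ k * r y) x"
        by (rule pd_cong_open[OF S True]) (simp add: F_def)
      then show ?thesis by (simp add: pd_mult[OF dv dr])
    qed
    then have "(\<Sum>k\<in>UNIV. pd k (F k) x) = (\<Sum>k\<in>UNIV. pd k (\<lambda>y. vol_density c y * X c y $ k) x) * r x
        + vol_density c x * (\<Sum>k\<in>UNIV. X c x $ k * pd k r x)"
      by (simp add: sum.distrib sum_distrib_left sum_distrib_right mult.assoc)
    also have "(\<Sum>k\<in>UNIV. X c x $ k * pd k r x) = vf_deriv A X \<rho> (coord_inv c x)"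
      unfolding vf_deriv_chart[OF X \<rho> c True] r_def[abs_def] ..
    also note D[OF True]
    finally show ?thesis
      using True by (simp add: h_def r_def algebra_simps)
  next
    case False
    then have "x \<notin> K" using K(2) by blast
    then show ?thesis using False pdF0 by simp
  qed
  have "(\<integral>p. h p \<partial>dVol A g) = (\<integral>x. indicator ?S x * vol_density c x * h (coord_inv c x) \<partial>lborel)"
    by (rule integral_in_chart[OF c continuous_integrable(1)[OF hc] hsupp])
  also have "\<dots> = (\<Sum>k\<in>UNIV. \<integral>x. pd k (F k) x \<partial>lborel)"
    unfolding eq using int0 by (subst Bochner_Integration.integral_sum) auto
  also have "\<dots> = 0" using int0 by simp
  finally show ?thesis by (simp add: h_def)
qed

text \<open>In another chart the function is \<open>bump\<close> composed with a transition map on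
  the overlap, and zero off the image of the closed ball. That image is compact, hence closed, so
  these are two open sets; they cover because the closed ball lies inside the chart.\<close>

lemma C1_bump:
  assumes c: "c \<in> A" and r: "r > 0" "cball x r \<subseteq> coord_image c"
  shows "C1 (\<lambda>q. if q \<in> fst c then bump x r (snd c q) else 0)" (is "C1 ?b")
    and "q \<notin> coord_inv c ` cball x r \<Longrightarrow> (if q \<in> fst c then bump x r (snd c q) else 0) = 0"
proof -
  let ?K = "coord_inv c ` cball x r"
  show zero: "?b q = 0" if "q \<notin> ?K" for q
  proof (cases "q \<in> fst c")
    case True
    have "snd c q \<notin> cball x r"
    proof
      assume "snd c q \<in> cball x r"
      then have "coord_inv c (snd c q) \<in> ?K" by blast
      then show False using that chart_facts(5)[OF c True] by simp
    qed
    then have "bump x r (snd c q) = 0" by (rule bump_zero[OF r(1)])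
    then show ?thesis by simp
  qed simp
  have U: "open (- ?K)"
    using compact_imp_closed[OF coord_inv_image_compact[OF c compact_cball r(2)]] by (simp add: open_Compl)
  show "C1 ?b"
    unfolding C1_def
  proof
    fix c' assume c': "c' \<in> A"
    let ?V = "{y \<in> coord_image c'. coord_inv c' y \<in> - ?K}"
    have V: "open ?V" by (intro open_Collect_preimage chart_facts c' U)
    have O: "open (overlap c' c)" by (rule overlap_open[OF c' c])
    have "ck (Suc 0) ?V (\<lambda>y. ?b (coord_inv c' y))"
      by (subst ck_cong[OF V, of _ "\<lambda>_. 0"]) (use zero ck_const in \<open>auto simp del: ck.simps\<close>)
    moreover have "ck (Suc 0) (overlap c' c) (\<lambda>y. ?b (coord_inv c' y))"
    proof -
      have "ck (Suc 0) (overlap c' c) (\<lambda>y. bump x r (transition c' c y))"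
        by (rule ck_compose[OF O bump_ck smooth_on_imp_ck[OF transition_smooth[OF c' c]]]) simp
      moreover have "?b (coord_inv c' y) = bump x r (transition c' c y)" if "y \<in> overlap c' c" for y
        using that by (simp add: overlap_eq[OF c'] transition_def)
      ultimately show ?thesis
        by (subst ck_cong[OF O, of _ "\<lambda>y. bump x r (transition c' c y)"]) auto
    qed
    ultimately have "ck (Suc 0) (?V \<union> overlap c' c) (\<lambda>y. ?b (coord_inv c' y))"
      by (rule ck_Un[OF V O])
    moreover have "coord_image c' \<subseteq> ?V \<union> overlap c' c"
      using r(2) chart_facts(7)[OF c] by (auto simp: overlap_eq[OF c'])
    ultimately show "ck (Suc 0) (coord_image c') (\<lambda>y. ?b (coord_inv c' y))"
      by (rule ck_subset)
  qed
qed

text \<open>The local statement is summed over the partition of unity obtained by dividing the bumps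
  by their sum, which is positive since the open balls cover.\<close>

theorem divergence_theorem:
  assumes X: "smooth_vector_field A X"
    and D: "\<And>c x. c \<in> A \<Longrightarrow> x \<in> coord_image c \<Longrightarrow>
      (\<Sum>k\<in>UNIV. pd k (\<lambda>y. vol_density c y * X c y $ k) x) = vol_density c x * D (coord_inv c x)"
    and Dc: "continuous_on UNIV D"
  shows "(\<integral>p. D p \<partial>dVol A g) = 0"
proof -
  let ?c = "chart_at A"
  obtain r where r: "\<And>p. r p > 0 \<and> cball (snd (?c p) p) (r p) \<subseteq> coord_image (?c p)"
    using chart_at_ball by blast
  obtain I where I: "finite I" "\<And>q. \<exists>p\<in>I. q \<in> fst (?c p) \<and> snd (?c p) q \<in> ball (snd (?c p) p) (r p)"
    using chart_ball_cover[of r] r by blast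
  define b where "b p q = (if q \<in> fst (?c p) then bump (snd (?c p) p) (r p) (snd (?c p) q) else 0)" for p q
  define s where "s q = (\<Sum>p\<in>I. b p q)" for q
  define \<rho> where "\<rho> p q = b p q * inverse (s q)" for p q
  have b: "C1 (b p)" "q \<notin> coord_inv (?c p) ` cball (snd (?c p) p) (r p) \<Longrightarrow> b p q = 0" for p q
    unfolding b_def[abs_def] using C1_bump[OF chart_at_facts(1)] r by blast+
  have s_pos: "s q > 0" for q
  proof -
    have "b p q \<ge> 0" for p by (simp add: b_def bump_nonneg)
    moreover obtain p where p: "p \<in> I" "q \<in> fst (?c p)" "snd (?c p) q \<in> ball (snd (?c p) p) (r p)"
      using I(2)[of q] by blast
    moreover have "b p q > 0"
      using p(2) bump_pos[OF p(3)] by (simp add: b_def)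
    ultimately show ?thesis
      unfolding s_def using I(1) by (intro sum_pos2[of I p]) auto
  qed
  have \<rho>C1: "C1 (\<rho> p)" for p
    unfolding C1_def
  proof
    fix c assume c: "c \<in> A"
    have S: "open (coord_image c)" by (rule chart_facts(2)[OF c])
    have bc: "ck (Suc 0) (coord_image c) (\<lambda>x. b p (coord_inv c x))" for p
      using b(1) c unfolding C1_def by blast
    have "s q \<noteq> 0" for q using s_pos[of q] by simp
    then show "ck (Suc 0) (coord_image c) (\<lambda>x. \<rho> p (coord_inv c x))"
      unfolding \<rho>_def s_def by (intro ck_mult ck_inverse ck_sum S bc) auto
  qed
  have \<rho>1: "(\<Sum>p\<in>I. \<rho> p q) = 1" for q
    using s_pos[of q] by (simp add: \<rho>_def sum_distrib_right[symmetric] s_def[symmetric])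
  have loc: "(\<integral>q. \<rho> p q * D q + vf_deriv A X (\<rho> p) q \<partial>dVol A g) = 0" for p
  proof (rule local_divergence[OF X chart_at_facts(1) D[OF chart_at_facts(1)] Dc \<rho>C1 compact_cball])
    show "cball (snd (?c p) p) (r p) \<subseteq> coord_image (?c p)" using r by blast
    show "\<rho> p q = 0" if "q \<notin> coord_inv (?c p) ` cball (snd (?c p) p) (r p)" for q
      using b(2)[OF that] by (simp add: \<rho>_def)
  qed
  \<comment> \<open>The functions \<open>\<rho> p\<close> sum to the constant 1, whose derivative
    along \<open>X\<close> is zero.\<close>
  have vf0: "(\<Sum>p\<in>I. vf_deriv A X (\<rho> p) q) = 0" for q
  proof -
    let ?d = "?c q" and ?x = "snd (?c q) q"
    note x = chart_facts(8)[OF chart_at_facts(1) chart_at_facts(2), of q]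
    have "(\<Sum>p\<in>I. vf_deriv A X (\<rho> p) q) = (\<Sum>i\<in>UNIV. X ?d ?x $ i * (\<Sum>p\<in>I. pd i (\<lambda>y. \<rho> p (coord_inv ?d y)) ?x))"
      unfolding vf_deriv_def Let_def comp_def sum_distrib_left by (rule sum.swap)
    also have "\<dots> = (\<Sum>i\<in>UNIV. X ?d ?x $ i * pd i (\<lambda>y. \<Sum>p\<in>I. \<rho> p (coord_inv ?d y)) ?x)"
      by (subst pd_sum) (auto intro!: C1_differentiable[OF \<rho>C1 chart_at_facts(1) x])
    finally show ?thesis by (simp add: \<rho>1 pd_const)
  qed
  have i: "integrable (dVol A g) (\<lambda>q. \<rho> p q * D q + vf_deriv A X (\<rho> p) q)" for p
    by (intro continuous_integrable(2) continuous_intros Dc C1_continuous[OF \<rho>C1] vf_deriv_continuous[OF X \<rho>C1])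
  have "D q = (\<Sum>p\<in>I. \<rho> p q * D q + vf_deriv A X (\<rho> p) q)" for q
    by (simp add: sum.distrib vf0 sum_distrib_right[symmetric] \<rho>1)
  then have "(\<integral>q. D q \<partial>dVol A g) = (\<integral>q. (\<Sum>p\<in>I. \<rho> p q * D q + vf_deriv A X (\<rho> p) q) \<partial>dVol A g)"
    by simp
  also have "\<dots> = 0"
    by (subst Bochner_Integration.integral_sum[OF i]) (simp add: loc)
  finally show ?thesis .
qed

end

section \<open>Solitons\<close>

context metric_chart
begin

lemma metric_trace_lower_square:
  assumes x: "x \<in> S"
  shows "metric_trace (G x) (\<lambda>i j. lower G P x i * lower G P x j) = P x \<bullet> (G x *v P x)"
proof -
  have "metric_trace (G x) (\<lambda>i j. lower G P x i * lower G P x j)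
      = (\<Sum>i\<in>UNIV. lower G P x i * (\<Sum>j\<in>UNIV. H x i j * lower G P x j))"
    by (simp add: metric_trace_def sum_distrib_left mult.left_commute)
  also have "\<dots> = (\<Sum>i\<in>UNIV. lower G P x i * P x $ i)"
    unfolding lower_def by (simp add: H_G_cancel[OF x])
  finally show ?thesis
    by (simp add: lower_def inner_vec_def matrix_vector_mult_def mult.commute)
qed

lemma contract2_metric:
  assumes x: "x \<in> S"
  shows "contract2 x T (\<lambda>i j. G x $ i $ j) = metric_trace (G x) T"
proof -
  have "(\<Sum>j\<in>UNIV. H x b j * G x $ i $ j) = (if b = i then 1 else 0)" for b i
    using sum_HG[OF x, of b i] G_sym[OF x, of i] by simp
  then show ?thesis
    unfolding contract2_def metric_trace_def by (simp only:) (simp add: mult.commute if_distrib cong: if_cong)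
qed

lemma contract2_lincomb:
  "contract2 x T (\<lambda>i j. u * L i j - v * M i j) = u * contract2 x T L - v * contract2 x T M"
  unfolding contract2_def sum_distrib_left
  by (simp add: algebra_simps sum_subtractf sum_distrib_left)

lemma lie_metric_sym: "x \<in> S \<Longrightarrow> lie_metric G V x i j = lie_metric G V x j i"
  by (simp add: lie_metric_nab)

lemma lie_metric_smooth: "smooth_on S V \<Longrightarrow> smooth_on S (\<lambda>x. lie_metric G V x i j)"
  unfolding lie_metric_def by (intro smooth S_open)

lemma contract2_continuous:
  assumes "\<And>i j. continuous_on S (\<lambda>x. T x i j)"
  shows "continuous_on S (\<lambda>x. contract2 x (T x) (T x))"
  unfolding contract2_def
  by (intro continuous_on_sum continuous_on_mult assms ck_imp_continuous_on[of 0] smooth_on_imp_ck H_smooth)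

end

context riemannian_manifold
begin

lemma norm_sq_chart:
  assumes P: "smooth_vector_field A P" and c: "c \<in> A" "x \<in> coord_image c"
  shows "norm_sq A g P (coord_inv c x) = P c x \<bullet> (g c x *v P c x)"
proof -
  let ?c = "chart_at A (coord_inv c x)"
  note c' = chart_at_facts[of "coord_inv c x"]
  have x: "x \<in> overlap c ?c" using c c' by (simp add: overlap_eq)
  have "P c x \<bullet> (g c x *v P c x) = P ?c (transition c ?c x) \<bullet> (g ?c (transition c ?c x) *v P ?c (transition c ?c x))"
    unfolding metric_transform[OF c(1) c'(1) x] vector_field_transform[OF P c(1) c'(1) x]
    unfolding matrix_vector_mul_assoc[symmetric] transpose_inner ..
  then show ?thesis
    by (simp add: norm_sq_def Let_def transition_def)
qed

lemma norm_sq_smooth: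
  assumes P: "smooth_vector_field A P" and c: "c \<in> A"
  shows "smooth_on (coord_image c) (\<lambda>x. norm_sq A g P (coord_inv c x))"
proof -
  interpret metric_chart "coord_image c" "g c" by (rule chart_metric[OF c])
  have "smooth_on (coord_image c) (P c)" using P c unfolding smooth_vector_field_def by blast
  then have "smooth_on (coord_image c) (\<lambda>x. \<Sum>i\<in>UNIV. P c x $ i * (\<Sum>j\<in>UNIV. g c x $ i $ j * P c x $ j))"
    by (intro smooth S_open)
  then show ?thesis
    by (subst smooth_on_cong[OF S_open norm_sq_chart[OF P c]])
      (simp_all add: inner_vec_def matrix_vector_mult_def)
qed

lemma norm_sq_C1: "smooth_vector_field A P \<Longrightarrow> C1 (norm_sq A g P)"
  unfolding C1_def using norm_sq_smooth smooth_on_imp_ck by blast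

text \<open>Naturality along a transition map. Together with the law for the metric it makes the
  soliton tensor transform correctly.\<close>

lemma lie_metric_transform:
  assumes V: "smooth_vector_field A V" and c: "c \<in> A" "c' \<in> A" "x \<in> overlap c c'"
  shows "lie_metric (g c) (V c) x i j = (\<Sum>a\<in>UNIV. \<Sum>b\<in>UNIV. jacobian c c' x $ a $ i *
    (jacobian c c' x $ b $ j * lie_metric (g c') (V c') (transition c c' x) a b))"
proof -
  interpret c: metric_chart "coord_image c" "g c" by (rule chart_metric[OF c(1)])
  interpret c': metric_chart "coord_image c'" "g c'" by (rule chart_metric[OF c(2)])
  have x: "x \<in> coord_image c" and y: "transition c c' x \<in> coord_image c'"
    using c overlap_subset transition_facts(2) by blast+
  have vd: "(\<lambda>y. V d y $ a) differentiable (at z)" if "d \<in> A" "z \<in> coord_image d" for d z a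
    using vector_field_ck[OF V that(1), of "Suc 0"] that(2) ck_differentiable by blast
  show ?thesis
    unfolding jacobian_def vec_lambda_beta
  proof (rule lie_metric_pullback[OF overlap_open[OF c(1,2)] c(3) transition_smooth[OF c(1,2)]])
    show "(\<lambda>y. g c' y $ a $ b) differentiable (at (transition c c' x))" for a b
      by (rule c'.G_diff[OF y])
    show "(\<lambda>y. V c y $ a) differentiable (at x)" for a by (rule vd[OF c(1) x])
    show "(\<lambda>y. V c' y $ a) differentiable (at (transition c c' x))" for a by (rule vd[OF c(2) y])
    show "g c y $ i $ j = (\<Sum>a\<in>UNIV. \<Sum>b\<in>UNIV. pd i (\<lambda>y. transition c c' y $ a) y *
        (pd j (\<lambda>y. transition c c' y $ b) y * g c' (transition c c' y) $ a $ b))" if "y \<in> overlap c c'" for y i j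
      unfolding metric_transform[OF c(1,2) that] congruence_nth by (simp add: jacobian_def)
    show "V c' (transition c c' y) $ a = (\<Sum>i\<in>UNIV. pd i (\<lambda>y. transition c c' y $ a) y * V c y $ i)"
      if "y \<in> overlap c c'" for y a
      unfolding vector_field_transform[OF V c(1,2) that] by (simp add: jacobian_def matrix_vector_mult_def)
  qed
qed

lemma inverse_metric_transform:
  assumes c: "c \<in> A" "c' \<in> A" "x \<in> overlap c c'"
  shows "matrix_inv (g c' (transition c c' x)) = jacobian c c' x ** matrix_inv (g c x) ** transpose (jacobian c c' x)"
proof -
  interpret c: metric_chart "coord_image c" "g c" by (rule chart_metric[OF c(1)])
  interpret c': metric_chart "coord_image c'" "g c'" by (rule chart_metric[OF c(2)])
  let ?J = "jacobian c c' x" and ?K = "jacobian c' c (transition c c' x)"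
  let ?g' = "g c' (transition c c' x)" and ?H = "matrix_inv (g c x)" and ?H' = "matrix_inv (g c' (transition c c' x))"
  have x: "x \<in> coord_image c" and y: "transition c c' x \<in> coord_image c'"
    using c overlap_subset transition_facts(2) by blast+
  have KJ: "?K ** ?J = mat 1" by (rule jacobian_inverse[OF c])
  then have JK: "?J ** ?K = mat 1" by (simp add: matrix_left_right_inverse)
  have "transpose ?K ** g c x = (transpose ?K ** transpose ?J) ** (?g' ** ?J)"
    unfolding metric_transform[OF c] by (simp add: matrix_mul_assoc)
  also have "transpose ?K ** transpose ?J = mat 1"
    using arg_cong[OF JK, of transpose] by (simp add: matrix_transpose_mul)
  \<comment> \<open>The law for the metric with the left Jacobian factor moved across; it allows the
    candidate to be verified as a right inverse of the metric in the second chart.\<close>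
  finally have 1: "transpose ?K ** g c x = ?g' ** ?J" by simp
  have "?g' ** (?J ** ?H ** transpose ?J) = (?g' ** ?J) ** ?H ** transpose ?J"
    by (simp add: matrix_mul_assoc)
  also have "\<dots> = transpose ?K ** (g c x ** ?H) ** transpose ?J"
    unfolding 1[symmetric] by (simp add: matrix_mul_assoc)
  also have "\<dots> = mat 1"
    using arg_cong[OF JK, of transpose] by (simp add: c.GH[OF x] matrix_transpose_mul)
  finally have "?H' ** (?g' ** (?J ** ?H ** transpose ?J)) = ?H'" by simp
  then show ?thesis
    by (simp add: matrix_mul_assoc c'.HG[OF y])
qed

text \<open>The divergence theorem for the field |P|^2 V. Half the trace of the Lie derivative of
  the metric is div V, so \<open>D\<close> stands for div V.\<close>

lemma integral_divergence_of_scaled_field: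
  assumes V: "smooth_vector_field A V" and P: "smooth_vector_field A P"
    and Dc: "continuous_on UNIV D"
    and D: "\<And>c x. c \<in> A \<Longrightarrow> x \<in> coord_image c \<Longrightarrow> (1/2) * metric_trace (g c x) (lie_metric (g c) (V c) x) = D (coord_inv c x)"
  shows "(\<integral>p. vf_deriv A V (norm_sq A g P) p + norm_sq A g P p * D p \<partial>dVol A g) = 0"
proof (rule divergence_theorem)
  let ?f = "norm_sq A g P"
  let ?X = "\<lambda>c x. ?f (coord_inv c x) *\<^sub>R V c x"
  show "smooth_vector_field A ?X"
    unfolding smooth_vector_field_def
  proof (intro conjI ballI)
    fix c assume c: "c \<in> A"
    have S: "open (coord_image c)" by (rule chart_facts(2)[OF c])
    have "smooth_on (coord_image c) (V c)" using V c unfolding smooth_vector_field_def by blast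
    then have "smooth_on (coord_image c) (\<lambda>x. \<chi> i. ?f (coord_inv c x) * V c x $ i)"
      by (intro smooth_on_vec smooth S norm_sq_smooth[OF P c])
    moreover have "(\<chi> i. ?f (coord_inv c x) * V c x $ i) = ?X c x" for x
      by (simp add: vec_eq_iff)
    ultimately show "smooth_on (coord_image c) (?X c)" by (simp only:)
  next
    fix c c' x assume c: "c \<in> A" "c' \<in> A" "x \<in> overlap c c'"
    show "?X c' (transition c c' x) = jacobian c c' x *v ?X c x"
      by (simp add: transition_facts(4)[OF c] vector_field_transform[OF V c] matrix_vector_mult_scaleR)
  qed
  show "continuous_on UNIV (\<lambda>p. vf_deriv A V ?f p + ?f p * D p)"
    by (intro continuous_intros vf_deriv_continuous[OF V] norm_sq_C1[OF P] C1_continuous[OF norm_sq_C1[OF P]] Dc)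
  fix c x assume c: "c \<in> A" "x \<in> coord_image c"
  interpret metric_chart "coord_image c" "g c" by (rule chart_metric[OF c(1)])
  have df: "(\<lambda>y. ?f (coord_inv c y)) differentiable (at x)"
    by (rule C1_differentiable[OF norm_sq_C1[OF P] c])
  have dV: "(\<lambda>y. V c y $ k) differentiable (at x)" for k
    using vector_field_ck[OF V c(1), of "Suc 0"] c(2) ck_differentiable by blast
  have dsV: "(\<lambda>y. vol_density c y * V c y $ k) differentiable (at x)" for k
    by (intro differentiable_mult dV sqrt_det_diff c(2))
  have "pd k (\<lambda>y. vol_density c y * ?X c y $ k) x
      = pd k (\<lambda>y. vol_density c y * V c y $ k) x * ?f (coord_inv c x)
        + vol_density c x * (V c x $ k * pd k (\<lambda>y. ?f (coord_inv c y)) x)" for k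
    using pd_mult[OF dsV df, of k k] by (simp add: mult_ac)
  then have "(\<Sum>k\<in>UNIV. pd k (\<lambda>y. vol_density c y * ?X c y $ k) x)
      = (\<Sum>k\<in>UNIV. pd k (\<lambda>y. vol_density c y * V c y $ k) x) * ?f (coord_inv c x)
        + vol_density c x * vf_deriv A V ?f (coord_inv c x)"
    by (simp add: vf_deriv_chart[OF V norm_sq_C1[OF P] c] sum.distrib sum_distrib_left sum_distrib_right)
  also have "(\<Sum>k\<in>UNIV. pd k (\<lambda>y. vol_density c y * V c y $ k) x) = vol_density c x * D (coord_inv c x)"
    using coordinate_divergence[OF c(2) dV] D[OF c] trace_lie_metric[OF c(2), of "V c"] by simp
  finally show "(\<Sum>k\<in>UNIV. pd k (\<lambda>y. vol_density c y * ?X c y $ k) x)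
      = vol_density c x * (vf_deriv A V ?f (coord_inv c x) + ?f (coord_inv c x) * D (coord_inv c x))"
    by (simp add: algebra_simps)
qed

section \<open>Symmetric tensors, their contraction with a field, and their squared norm\<close>

definition smooth_sym_tensor :: "(('m, 'n) chart \<Rightarrow> real ^ 'n \<Rightarrow> 'n \<Rightarrow> 'n \<Rightarrow> real) \<Rightarrow> bool" where
  "smooth_sym_tensor T \<longleftrightarrow>
     (\<forall>c\<in>A. \<forall>i j. smooth_on (coord_image c) (\<lambda>x. T c x i j)) \<and>
     (\<forall>c\<in>A. \<forall>x\<in>coord_image c. \<forall>i j. T c x i j = T c x j i) \<and>
     (\<forall>c\<in>A. \<forall>c'\<in>A. \<forall>x\<in>overlap c c'. \<forall>i j. T c x i j =
        (\<Sum>a\<in>UNIV. \<Sum>b\<in>UNIV. jacobian c c' x $ a $ i * (jacobian c c' x $ b $ j * T c' (transition c c' x) a b)))"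

text \<open>This is T(V) with its index raised. In matrix form the field is inverse metric times
  \<open>T\<close> times \<open>V\<close>, and the transformation law is the composition of the laws
  of the three factors.\<close>

lemma contracted_field:
  assumes T: "smooth_sym_tensor T" and V: "smooth_vector_field A V"
  shows "smooth_vector_field A (\<lambda>c x. \<chi> k. \<Sum>l\<in>UNIV. matrix_inv (g c x) $ k $ l * (\<Sum>m\<in>UNIV. T c x l m * V c x $ m))"
  unfolding smooth_vector_field_def
proof (intro conjI ballI)
  fix c assume c: "c \<in> A"
  interpret metric_chart "coord_image c" "g c" by (rule chart_metric[OF c])
  have "smooth_on (coord_image c) (V c)" using V c unfolding smooth_vector_field_def by blast
  moreover have "smooth_on (coord_image c) (\<lambda>x. T c x i j)" for i j
    using T c unfolding smooth_sym_tensor_def by blast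
  ultimately show "smooth_on (coord_image c) (\<lambda>x. \<chi> k. \<Sum>l\<in>UNIV. matrix_inv (g c x) $ k $ l * (\<Sum>m\<in>UNIV. T c x l m * V c x $ m))"
    by (intro smooth_on_vec smooth_on_sum smooth_on_mult smooth_on_component S_open H_smooth)
next
  fix c c' x assume c: "c \<in> A" "c' \<in> A" "x \<in> overlap c c'"
  let ?y = "transition c c' x" and ?J = "jacobian c c' x" and ?v = "V c x"
  define M where "M d z = (\<chi> l m. T d z l m)" for d z
  have X: "(\<chi> k. \<Sum>l\<in>UNIV. matrix_inv (g d z) $ k $ l * (\<Sum>m\<in>UNIV. T d z l m * V d z $ m))
      = matrix_inv (g d z) *v (M d z *v V d z)" for d z
    by (simp add: matrix_vector_mult_def M_def)
  have M: "M c x = transpose ?J ** M c' ?y ** ?J"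
    using T c unfolding smooth_sym_tensor_def vec_eq_iff congruence_nth M_def by simp
  show "(\<chi> k. \<Sum>l\<in>UNIV. matrix_inv (g c' ?y) $ k $ l * (\<Sum>m\<in>UNIV. T c' ?y l m * V c' ?y $ m))
      = ?J *v (\<chi> k. \<Sum>l\<in>UNIV. matrix_inv (g c x) $ k $ l * (\<Sum>m\<in>UNIV. T c x l m * V c x $ m))"
    unfolding X unfolding inverse_metric_transform[OF c] M vector_field_transform[OF V c]
    by (simp add: matrix_vector_mul_assoc matrix_mul_assoc)
qed

text \<open>With matrices M for \<open>T\<close> and H for the inverse metric, the squared norm is
  the trace of M H M^T H^T; cyclic invariance of the trace collects the Jacobians around H, where
  they give the inverse metric of the other chart.\<close>

lemma contract2_transform:
  assumes T: "smooth_sym_tensor T" and c: "c \<in> A" "c' \<in> A" "x \<in> overlap c c'"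
  shows "metric_chart.contract2 (g c) x (T c x) (T c x)
    = metric_chart.contract2 (g c') (transition c c' x) (T c' (transition c c' x)) (T c' (transition c c' x))"
proof -
  interpret c: metric_chart "coord_image c" "g c" by (rule chart_metric[OF c(1)])
  interpret c': metric_chart "coord_image c'" "g c'" by (rule chart_metric[OF c(2)])
  let ?y = "transition c c' x" and ?J = "jacobian c c' x" and ?tr = "\<lambda>B :: real ^ 'n ^ 'n. \<Sum>i\<in>UNIV. B $ i $ i"
  let ?H = "matrix_inv (g c x)" and ?H' = "matrix_inv (g c' ?y)"
  define M where "M d z = (\<chi> l m. T d z l m)" for d z
  have tr: "(\<Sum>a\<in>UNIV. \<Sum>b\<in>UNIV. T d z a b * (\<Sum>i\<in>UNIV. B $ a $ i * (\<Sum>j\<in>UNIV. B $ b $ j * T d z i j)))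
      = ?tr (M d z ** B ** transpose (M d z) ** transpose B)" for d z and B :: "real ^ 'n ^ 'n"
  proof -
    have "?tr (M d z ** B ** transpose (M d z) ** transpose B)
        = (\<Sum>a\<in>UNIV. \<Sum>i\<in>UNIV. \<Sum>j\<in>UNIV. \<Sum>b\<in>UNIV. T d z a b * B $ b $ j * T d z i j * B $ a $ i)"
      by (simp add: matrix_matrix_mult_def transpose_def M_def sum_distrib_right)
    also have "\<dots> = (\<Sum>a\<in>UNIV. \<Sum>b\<in>UNIV. \<Sum>i\<in>UNIV. \<Sum>j\<in>UNIV. T d z a b * B $ b $ j * T d z i j * B $ a $ i)"
      by (rule sum.cong[OF refl], rule sum_rotate3[symmetric])
    finally show ?thesis by (simp add: sum_distrib_left mult_ac)
  qed
  have trc: "?tr (B ** C) = ?tr (C ** B)" for B C :: "real ^ 'n ^ 'n"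
    unfolding matrix_matrix_mult_def by (simp, subst sum.swap, simp add: mult.commute)
  have M: "M c x = transpose ?J ** M c' ?y ** ?J"
    using T c unfolding smooth_sym_tensor_def vec_eq_iff congruence_nth M_def by simp
  have "?tr (M c x ** ?H ** transpose (M c x) ** transpose ?H)
      = ?tr (transpose ?J ** (M c' ?y ** (?J ** ?H ** transpose ?J) ** transpose (M c' ?y) ** (?J ** transpose ?H)))"
    unfolding M by (simp add: matrix_transpose_mul matrix_mul_assoc)
  also have "\<dots> = ?tr ((M c' ?y ** (?J ** ?H ** transpose ?J) ** transpose (M c' ?y) ** (?J ** transpose ?H)) ** transpose ?J)"
    by (rule trc)
  also have "\<dots> = ?tr (M c' ?y ** ?H' ** transpose (M c' ?y) ** transpose ?H')"
    unfolding inverse_metric_transform[OF c] by (simp add: matrix_transpose_mul matrix_mul_assoc)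
  finally show ?thesis
    unfolding c.contract2_def c'.contract2_def tr .
qed

definition tensor_norm_sq :: "(('m, 'n) chart \<Rightarrow> real ^ 'n \<Rightarrow> 'n \<Rightarrow> 'n \<Rightarrow> real) \<Rightarrow> 'm \<Rightarrow> real" where
  "tensor_norm_sq T p = (let c = chart_at A p; x = snd c p in metric_chart.contract2 (g c) x (T c x) (T c x))"

lemma tensor_norm_sq_chart:
  assumes T: "smooth_sym_tensor T" and c: "c \<in> A" "x \<in> coord_image c"
  shows "tensor_norm_sq T (coord_inv c x) = metric_chart.contract2 (g c) x (T c x) (T c x)"
proof -
  let ?c = "chart_at A (coord_inv c x)"
  note c' = chart_at_facts[of "coord_inv c x"]
  have x: "x \<in> overlap c ?c" using c c' by (simp add: overlap_eq)
  show ?thesis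
    unfolding contract2_transform[OF T c(1) c'(1) x] by (simp add: tensor_norm_sq_def Let_def transition_def)
qed

lemma tensor_norm_sq_nonneg: "tensor_norm_sq T p \<ge> 0"
  unfolding tensor_norm_sq_def Let_def
  by (rule metric_chart.contract2_nonneg[OF chart_metric[OF chart_at_facts(1)] chart_facts(8)[OF chart_at_facts(1,2)]])

lemma tensor_norm_sq_continuous:
  assumes T: "smooth_sym_tensor T"
  shows "continuous_on UNIV (tensor_norm_sq T)"
proof (rule continuous_from_charts)
  fix c assume c: "c \<in> A"
  interpret metric_chart "coord_image c" "g c" by (rule chart_metric[OF c])
  have "continuous_on (coord_image c) (\<lambda>x. T c x i j)" for i j
    using T c ck_imp_continuous_on[OF smooth_on_imp_ck[where k = 0]] unfolding smooth_sym_tensor_def by blast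
  then have "continuous_on (coord_image c) (\<lambda>x. contract2 x (T c x) (T c x))"
    by (rule contract2_continuous)
  then show "continuous_on (coord_image c) (\<lambda>x. tensor_norm_sq T (coord_inv c x))"
    by (rule continuous_on_eq) (simp add: tensor_norm_sq_chart[OF T c])
qed

lemma tensor_norm_sq_integral_zero:
  assumes T: "smooth_sym_tensor T" and le: "(\<integral>p. tensor_norm_sq T p \<partial>dVol A g) \<le> 0"
    and c: "c \<in> A" "x \<in> coord_image c"
  shows "T c x i j = 0"
proof -
  interpret metric_chart "coord_image c" "g c" by (rule chart_metric[OF c(1)])
  have "tensor_norm_sq T (coord_inv c x) = 0"
    by (rule integral_eq_0_imp_zero[OF tensor_norm_sq_continuous[OF T] tensor_norm_sq_nonneg le])
  then show ?thesis
    using contract2_eq_0[OF c(2)] tensor_norm_sq_chart[OF T c] by simp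
qed

text \<open>The integrand is \<open>div (T(V))\<close>.\<close>

lemma integral_tensor_norm_sq:
  assumes T: "smooth_sym_tensor T" and V: "smooth_vector_field A V"
    and div: "\<And>c x k. c \<in> A \<Longrightarrow> x \<in> coord_image c \<Longrightarrow> divergence (g c) (T c) x k = 0"
    and lie: "\<And>c x i j. c \<in> A \<Longrightarrow> x \<in> coord_image c \<Longrightarrow>
      (1/2) * lie_metric (g c) (V c) x i j + T c x i j = f (coord_inv c x) * g c x $ i $ j"
    and f: "continuous_on UNIV f" and t: "continuous_on UNIV t"
    and tr: "\<And>c x. c \<in> A \<Longrightarrow> x \<in> coord_image c \<Longrightarrow> metric_trace (g c x) (T c x) = t (coord_inv c x)"
  shows "(\<integral>p. f p * t p - tensor_norm_sq T p \<partial>dVol A g) = 0"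
proof (rule divergence_theorem[OF contracted_field[OF T V]])
  show "continuous_on UNIV (\<lambda>p. f p * t p - tensor_norm_sq T p)"
    by (intro continuous_intros f t tensor_norm_sq_continuous[OF T])
  fix c x assume c: "c \<in> A" "x \<in> coord_image c"
  interpret metric_chart "coord_image c" "g c" by (rule chart_metric[OF c(1)])
  have dT: "(\<lambda>y. T c y l m) differentiable (at x)" for l m
    using T c smooth_on_differentiable unfolding smooth_sym_tensor_def by blast
  have sym: "T c x l m = T c x m l" for l m
    using T c unfolding smooth_sym_tensor_def by blast
  have dV: "(\<lambda>y. V c y $ m) differentiable (at x)" for m
    using vector_field_ck[OF V c(1), of "Suc 0"] c(2) ck_differentiable by blast
  have "lie_metric (g c) (V c) x i j = 2 * f (coord_inv c x) * g c x $ i $ j - 2 * T c x i j" for i j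
    using lie[OF c, of i j] by simp
  then have "lie_metric (g c) (V c) x = (\<lambda>i j. 2 * f (coord_inv c x) * g c x $ i $ j - 2 * T c x i j)"
    by (simp add: fun_eq_iff)
  \<comment> \<open>Substituting the soliton equation into <T, L_V g>: pairing with the metric gives
    the trace \<open>t\<close>, pairing with \<open>T\<close> its squared norm.\<close>
  then have C: "contract2 x (T c x) (lie_metric (g c) (V c) x)
      = 2 * f (coord_inv c x) * t (coord_inv c x) - 2 * tensor_norm_sq T (coord_inv c x)"
    by (simp only: contract2_lincomb contract2_metric[OF c(2)] tr[OF c] tensor_norm_sq_chart[OF T c])
  show "(\<Sum>k\<in>UNIV. pd k (\<lambda>y. vol_density c y *
        (\<chi> k. \<Sum>l\<in>UNIV. matrix_inv (g c y) $ k $ l * (\<Sum>m\<in>UNIV. T c y l m * V c y $ m)) $ k) x)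
      = vol_density c x * (f (coord_inv c x) * t (coord_inv c x) - tensor_norm_sq T (coord_inv c x))"
    unfolding divergence_contracted[OF c(2) dT sym dV] C by (simp add: div[OF c] algebra_simps)
qed

end

theorem theorem3p7:
  fixes A :: "('m::{t2_space, second_countable_topology}, 'n::finite) chart set"
    and g :: "('m, 'n) metric"
    and V P :: "('m, 'n) vfield"
    and lam :: "'m \<Rightarrow> real"
    and \<beta> :: real
  assumes "smooth_atlas A"
    and "riemannian_metric A g"
    and "compact (UNIV :: 'm set)"
    and "CARD('n) \<ge> 4"
    and "\<beta> \<noteq> 0"
    and "almost_omega_bach_soliton A g V lam \<beta> P"
    and "omega_bach_divergence_free A g \<beta> P"
    and "\<beta> * (\<integral>p. vf_deriv A V (norm_sq A g P) p \<partial>dVol A g)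
         + \<beta>\<^sup>2 * (\<integral>p. (norm_sq A g P p)\<^sup>2 \<partial>dVol A g) \<le> 0"
  shows "omega_bach_flat A g \<beta> P"
proof -
  interpret riemannian_manifold A g by unfold_locales fact+
  let ?n = "real CARD('n)" and ?f = "norm_sq A g P"
  define T where "T c = omega_bach (g c) \<beta> (lower (g c) (P c))" for c
  have V: "smooth_vector_field A V" and P: "smooth_vector_field A P" and lam: "smooth_function A lam"
    and lie: "\<And>c x i j. c \<in> A \<Longrightarrow> x \<in> coord_image c \<Longrightarrow>
      (1/2) * lie_metric (g c) (V c) x i j + T c x i j = lam (coord_inv c x) * g c x $ i $ j"
    using assms(6) unfolding almost_omega_bach_soliton_def T_def by blast+
  have T_eq: "T c x i j = lam (coord_inv c x) * g c x $ i $ j - (1/2) * lie_metric (g c) (V c) x i j"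
    if "c \<in> A" "x \<in> coord_image c" for c x i j
    using lie[OF that, of i j] by simp
  have lamC1: "smooth_on (coord_image c) (\<lambda>x. lam (coord_inv c x))" if "c \<in> A" for c
    using lam that unfolding smooth_function_def comp_def by blast
  have lam_cont: "continuous_on UNIV lam"
    by (intro C1_continuous) (simp add: C1_def smooth_on_imp_ck[OF lamC1] del: ck.simps)
  have f_cont: "continuous_on UNIV ?f"
    by (rule C1_continuous[OF norm_sq_C1[OF P]])
  have T: "smooth_sym_tensor T"
    unfolding smooth_sym_tensor_def
  proof (intro conjI ballI allI)
    fix c i j assume c: "c \<in> A"
    interpret metric_chart "coord_image c" "g c" by (rule chart_metric[OF c])
    have "smooth_on (coord_image c) (V c)" using V c unfolding smooth_vector_field_def by blast
    then have "smooth_on (coord_image c) (\<lambda>x. lam (coord_inv c x) * g c x $ i $ j - (1/2) * lie_metric (g c) (V c) x i j)"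
      by (intro smooth_on_diff smooth_on_mult smooth_on_const S_open lamC1[OF c] G_comp_smooth lie_metric_smooth)
    then show "smooth_on (coord_image c) (\<lambda>x. T c x i j)"
      by (subst smooth_on_cong[OF S_open T_eq[OF c]])
  next
    fix c x i j assume c: "c \<in> A" "x \<in> coord_image c"
    interpret metric_chart "coord_image c" "g c" by (rule chart_metric[OF c(1)])
    show "T c x i j = T c x j i"
      unfolding T_eq[OF c] lie_metric_sym[OF c(2), of "V c" i j] G_sym[OF c(2), of i j] ..
  next
    fix c c' x i j assume c: "c \<in> A" "c' \<in> A" "x \<in> overlap c c'"
    let ?J = "jacobian c c' x" and ?y = "transition c c' x"
    have x: "x \<in> coord_image c" using c overlap_subset by blast
    have g: "g c x $ i $ j = (\<Sum>a\<in>UNIV. \<Sum>b\<in>UNIV. ?J $ a $ i * (?J $ b $ j * g c' ?y $ a $ b))"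
      unfolding metric_transform[OF c] congruence_nth ..
    show "T c x i j = (\<Sum>a\<in>UNIV. \<Sum>b\<in>UNIV. ?J $ a $ i * (?J $ b $ j * T c' ?y a b))"
      unfolding T_eq[OF c(1) x] T_eq[OF c(2) transition_facts(2)[OF c]] transition_facts(4)[OF c]
        lie_metric_transform[OF V c] g
      by (simp add: right_diff_distrib sum_subtractf sum_distrib_left mult_ac)
  qed
  have trT: "metric_trace (g c x) (T c x) = - \<beta> * ?f (coord_inv c x)" if c: "c \<in> A" "x \<in> coord_image c" for c x
  proof -
    interpret metric_chart "coord_image c" "g c" by (rule chart_metric[OF c(1)])
    have "metric_trace (g c x) (T c x) = metric_trace (g c x) (bach (g c) x)
        - \<beta> * metric_trace (g c x) (\<lambda>i j. lower (g c) (P c) x i * lower (g c) (P c) x j)"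
      unfolding T_def omega_bach_def[abs_def] metric_trace_diff metric_trace_cmult by (simp add: eta_contract_eq)
    then show ?thesis
      using assms(4) by (simp add: metric_trace_bach[OF c(2)] metric_trace_lower_square[OF c(2)] norm_sq_chart[OF P c])
  qed
  have trL: "(1/2) * metric_trace (g c x) (lie_metric (g c) (V c) x) = ?n * lam (coord_inv c x) + \<beta> * ?f (coord_inv c x)"
    if c: "c \<in> A" "x \<in> coord_image c" for c x
  proof -
    interpret metric_chart "coord_image c" "g c" by (rule chart_metric[OF c(1)])
    have "metric_trace (g c x) (\<lambda>i j. (1/2) * lie_metric (g c) (V c) x i j + T c x i j)
        = metric_trace (g c x) (\<lambda>i j. lam (coord_inv c x) * g c x $ i $ j)"
      by (simp only: lie[OF c])
    then show ?thesis
      unfolding metric_trace_add metric_trace_cmult trT[OF c] metric_trace_metric[OF c(2)]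
      by (simp add: mult.commute)
  qed
  note i = continuous_integrable(2)
  have if2: "integrable (dVol A g) (\<lambda>p. (?f p)\<^sup>2)" and ilf: "integrable (dVol A g) (\<lambda>p. lam p * ?f p)"
    and ivf: "integrable (dVol A g) (vf_deriv A V ?f)" and iT: "integrable (dVol A g) (tensor_norm_sq T)"
    by (intro i continuous_intros f_cont lam_cont vf_deriv_continuous[OF V norm_sq_C1[OF P]] tensor_norm_sq_continuous[OF T])+
  have "(\<integral>p. vf_deriv A V ?f p + ?f p * (?n * lam p + \<beta> * ?f p) \<partial>dVol A g) = 0"
    by (rule integral_divergence_of_scaled_field[OF V P]) (intro continuous_intros f_cont lam_cont, rule trL)
  moreover have "(\<integral>p. vf_deriv A V ?f p + ?f p * (?n * lam p + \<beta> * ?f p) \<partial>dVol A g)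
      = (\<integral>p. vf_deriv A V ?f p + (?n * (lam p * ?f p) + \<beta> * (?f p)\<^sup>2) \<partial>dVol A g)"
    by (simp add: algebra_simps power2_eq_square)
  ultimately have I1: "(\<integral>p. vf_deriv A V ?f p \<partial>dVol A g) + (?n * (\<integral>p. lam p * ?f p \<partial>dVol A g) + \<beta> * (\<integral>p. (?f p)\<^sup>2 \<partial>dVol A g)) = 0"
    using if2 ilf ivf by simp
  have "(\<integral>p. lam p * (- \<beta> * ?f p) - tensor_norm_sq T p \<partial>dVol A g) = 0"
  proof (rule integral_tensor_norm_sq[OF T V _ lie lam_cont _ trT])
    show "divergence (g c) (T c) x k = 0" if "c \<in> A" "x \<in> coord_image c" for c x k
      using assms(7) that unfolding omega_bach_divergence_free_def T_def by blast
    show "continuous_on UNIV (\<lambda>p. - \<beta> * ?f p)" by (intro continuous_intros f_cont)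
  qed
  moreover have "(\<integral>p. lam p * (- \<beta> * ?f p) - tensor_norm_sq T p \<partial>dVol A g)
      = (\<integral>p. (- \<beta>) * (lam p * ?f p) - tensor_norm_sq T p \<partial>dVol A g)"
    by (simp add: mult_ac)
  ultimately have "(- \<beta>) * (\<integral>p. lam p * ?f p \<partial>dVol A g) - (\<integral>p. tensor_norm_sq T p \<partial>dVol A g) = 0"
    using ilf iT by simp
  then have "(\<integral>p. tensor_norm_sq T p \<partial>dVol A g) = - \<beta> * (\<integral>p. lam p * ?f p \<partial>dVol A g)"
    by linarith
  \<comment> \<open>The factor n matches the coefficient of the integral of \<lambda> |P|^2 in
    \<open>I1\<close>, which can then be eliminated.\<close>
  then have "?n * (\<integral>p. tensor_norm_sq T p \<partial>dVol A g) = - \<beta> * (?n * (\<integral>p. lam p * ?f p \<partial>dVol A g))"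
    by (simp only: mult.left_commute)
  also have "?n * (\<integral>p. lam p * ?f p \<partial>dVol A g) = - (\<integral>p. vf_deriv A V ?f p \<partial>dVol A g) - \<beta> * (\<integral>p. (?f p)\<^sup>2 \<partial>dVol A g)"
    using I1 by linarith
  finally have "?n * (\<integral>p. tensor_norm_sq T p \<partial>dVol A g) \<le> 0"
    using assms(8) by (simp add: algebra_simps power2_eq_square)
  then have "(\<integral>p. tensor_norm_sq T p \<partial>dVol A g) \<le> 0"
    using assms(4) by (simp add: mult_le_0_iff)
  then show ?thesis
    unfolding omega_bach_flat_def using tensor_norm_sq_integral_zero[OF T] unfolding T_def by blast
qed

end
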